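(* Let $C$ be a (smooth projective) hyperelliptic curve over $\mathbf{C}$, and let $w$ be a Weierstrass point of $C$. For any $x\in C$, $$(x,x)-(x,w)-(w,x)+(w,w)=0\quad\text{in } CH_0(C\times C).$$
   Context: $CH_0(C\times C)$ is the group of $0$-cycles on $C\times C$ modulo rational equivalence, with integer coefficients; $(a,b)$ denotes the class of the point $(a,b)\in C\times C$. The Weierstrass points of $C$ are the fixed points of the hyperelliptic involution. *)

theory Defs
  imports
    "HOL-Analysis.Analysis"
    "HOL-Algebra.Embedded_Algebras"
    "HOL-Algebra.QuotRing"
    "HOL-Algebra.Generated_Groups"
    "HOL-Algebra.Free_Abelian_Groups"
begin

section \<open>Projective varieties over the complex numbers\<close>

text \<open>
  The space with homogeneous coordinates indexed by a finite type is the set of lines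
  through the origin. Since the ground field is infinite, forms are represented by the
  functions they induce.
\<close>

type_synonym 'n ppoint = "(complex ^ 'n) set"

definition proj_space :: "('n::finite) ppoint set" where
  "proj_space = {p. vec.subspace p \<and> vec.dim p = 1}"

definition form :: "nat \<Rightarrow> (complex ^ ('n::finite) \<Rightarrow> complex) \<Rightarrow> bool" where
  "form d F \<longleftrightarrow> (\<exists>c :: ('n \<Rightarrow> nat) \<Rightarrow> complex.
     F = (\<lambda>u. \<Sum>\<alpha> | (\<Sum>i\<in>UNIV. \<alpha> i) = d. c \<alpha> * (\<Prod>i\<in>UNIV. (u $ i) ^ \<alpha> i)))"

definition vanishes_at :: "(complex ^ ('n::finite) \<Rightarrow> complex) \<Rightarrow> 'n ppoint \<Rightarrow> bool" where
  "vanishes_at F p \<longleftrightarrow> (\<forall>u\<in>p. F u = 0)"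

definition proj_closed :: "('n::finite) ppoint set \<Rightarrow> bool" where
  "proj_closed X \<longleftrightarrow> (\<exists>S. (\<forall>F\<in>S. \<exists>d. form d F) \<and>
     X = {p \<in> proj_space. \<forall>F\<in>S. vanishes_at F p})"

text \<open>Projective varieties are closed and irreducible.\<close>

definition proj_variety :: "('n::finite) ppoint set \<Rightarrow> bool" where
  "proj_variety X \<longleftrightarrow> proj_closed X \<and> X \<noteq> {} \<and>
     (\<forall>A B. proj_closed A \<longrightarrow> proj_closed B \<longrightarrow> X \<subseteq> A \<union> B \<longrightarrow> X \<subseteq> A \<or> X \<subseteq> B)"

text \<open>Dimension as the maximal length of a chain of irreducible closed subsets.\<close>

definition zdim :: "('n::finite) ppoint set \<Rightarrow> nat" where
  "zdim X = Sup {n. \<exists>Z. (\<forall>i\<le>n. proj_variety (Z i) \<and> Z i \<subseteq> X) \<and>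
                        (\<forall>i<n. Z i \<subset> Z (Suc i))}"

definition proj_curve :: "('n::finite) ppoint set \<Rightarrow> bool" where
  "proj_curve X \<longleftrightarrow> proj_variety X \<and> zdim X = 1"

text \<open>
  Jacobian criterion on the affine cone: at every nonzero vector of the cone, the common
  kernel of the differentials of all forms vanishing on the variety has dimension one more
  than the variety.
\<close>

definition smooth :: "('n::finite) ppoint set \<Rightarrow> bool" where
  "smooth X \<longleftrightarrow> (\<forall>p\<in>X. \<forall>u\<in>p. u \<noteq> 0 \<longrightarrow>
     vec.dim {v. \<forall>d F. form d F \<longrightarrow> (\<forall>q\<in>X. vanishes_at F q) \<longrightarrow>
                   deriv (\<lambda>s. F (u + s *s v)) 0 = 0} = zdim X + 1)"


section \<open>Function fields, local rings and morphisms\<close>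

definition fun_ring :: "('a \<Rightarrow> complex) ring" where
  "fun_ring = \<lparr>carrier = UNIV, monoid.mult = (\<lambda>f g x. f x * g x), one = (\<lambda>x. 1),
               ring.zero = (\<lambda>x. 0), add = (\<lambda>f g x. f x + g x)\<rparr>"

text \<open>
  A rational function is an equivalence class of functions, where two functions are
  identified when they agree on a nonempty open subset of the variety. The functions
  that vanish on such a subset form an ideal because the variety is irreducible.
\<close>

definition null_ideal :: "('n::finite) ppoint set \<Rightarrow> ('n ppoint \<Rightarrow> complex) set" where
  "null_ideal X = {r. \<exists>Z. proj_closed Z \<and> \<not> X \<subseteq> Z \<and> (\<forall>p\<in>X - Z. r p = 0)}"

definition rat_class ::
  "('n::finite) ppoint set \<Rightarrow> ('n ppoint \<Rightarrow> complex) \<Rightarrow> ('n ppoint \<Rightarrow> complex) set" where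
  "rat_class X r = null_ideal X +>\<^bsub>fun_ring\<^esub> r"

definition form_quotient ::
  "(complex ^ ('n::finite) \<Rightarrow> complex) \<Rightarrow> (complex ^ 'n \<Rightarrow> complex) \<Rightarrow> 'n ppoint \<Rightarrow> complex" where
  "form_quotient F G p = (let u = (SOME u. u \<in> p \<and> u \<noteq> 0) in F u / G u)"

definition function_field :: "('n::finite) ppoint set \<Rightarrow> ('n ppoint \<Rightarrow> complex) set ring" where
  "function_field X = (fun_ring Quot null_ideal X)
     \<lparr>carrier := {rat_class X (form_quotient F G) | d F G.
        form d F \<and> form d G \<and> (\<exists>p\<in>X. \<not> vanishes_at G p)}\<rparr>"

definition local_ring ::
  "('n::finite) ppoint set \<Rightarrow> 'n ppoint \<Rightarrow> ('n ppoint \<Rightarrow> complex) set ring" where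
  "local_ring X p = (function_field X)
     \<lparr>carrier := {rat_class X (form_quotient F G) | d F G.
        form d F \<and> form d G \<and> \<not> vanishes_at G p}\<rparr>"

text \<open>
  Regular maps are given locally by tuples of forms of equal degree. Such a tuple represents
  the map at every point of the variety where its members have no common zero.
\<close>

definition morphism ::
  "('n::finite) ppoint set \<Rightarrow> ('m::finite) ppoint set \<Rightarrow> ('n ppoint \<Rightarrow> 'm ppoint) \<Rightarrow> bool" where
  "morphism X Y f \<longleftrightarrow> f ` X \<subseteq> Y \<and>
     (\<forall>p\<in>X. \<exists>d F. (\<forall>j. form d (F j)) \<and> (\<exists>j. \<not> vanishes_at (F j) p) \<and>
        (\<forall>q\<in>X. (\<exists>j. \<not> vanishes_at (F j) q) \<longrightarrow>
           f q = vec.span ((\<lambda>u. \<chi> j. F j u) ` q)))"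

text \<open>
  The degree of the extension of the function field of the source over the pullback of the
  function field of the target. The property fails for a map with image of smaller dimension
  because the extension then has infinite degree.
\<close>

definition has_degree ::
  "('n::finite) ppoint set \<Rightarrow> ('m::finite) ppoint set \<Rightarrow> ('n ppoint \<Rightarrow> 'm ppoint) \<Rightarrow> nat \<Rightarrow> bool" where
  "has_degree X Y f n \<longleftrightarrow> ring.dimension (function_field X) n
     {rat_class X (form_quotient F G \<circ> f) | d F G.
        form d F \<and> form d G \<and> (\<exists>q\<in>Y. \<not> vanishes_at G q)}
     (carrier (function_field X))"


section \<open>Hyperelliptic curves\<close>

text \<open>
  The arithmetic genus of a curve (equal to its genus if it is smooth), read off the Hilbert
  polynomial: the forms of large degree \<open>d\<close>, restricted to the cone, span a space of
  dimension \<open>e * d + 1 - g\<close>.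
\<close>

definition has_genus :: "('n::finite) ppoint set \<Rightarrow> nat \<Rightarrow> bool" where
  "has_genus X g \<longleftrightarrow> (\<exists>e::nat. \<forall>\<^sub>F d in sequentially. \<exists>h.
     ring.dimension fun_ring h (range (\<lambda>c u. c))
       {(\<lambda>u. if u \<in> \<Union>X then F u else 0) | F. form d F} \<and>
     int h = int e * int d + 1 - int g)"

definition double_cover_P1 :: "('n::finite) ppoint set \<Rightarrow> ('n ppoint \<Rightarrow> 2 ppoint) \<Rightarrow> bool" where
  "double_cover_P1 C \<pi> \<longleftrightarrow> morphism C proj_space \<pi> \<and> has_degree C proj_space \<pi> 2"

definition hyperelliptic_curve :: "('n::finite) ppoint set \<Rightarrow> bool" where
  "hyperelliptic_curve C \<longleftrightarrow> proj_curve C \<and> smooth C \<and> (\<exists>g\<ge>2. has_genus C g) \<and>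
     (\<exists>\<pi>. double_cover_P1 C \<pi>)"

definition hyperelliptic_involution ::
  "('n::finite) ppoint set \<Rightarrow> ('n ppoint \<Rightarrow> 'n ppoint) \<Rightarrow> bool" where
  "hyperelliptic_involution C \<iota> \<longleftrightarrow>
     morphism C C \<iota> \<and> (\<forall>p\<in>C. \<iota> (\<iota> p) = p) \<and> (\<exists>p\<in>C. \<iota> p \<noteq> p) \<and>
     (\<exists>\<pi>. double_cover_P1 C \<pi> \<and> (\<forall>p\<in>C. \<pi> (\<iota> p) = \<pi> p))"

text \<open>The involution of a hyperelliptic curve is unique, so any witness will do.\<close>

definition weierstrass_point :: "('n::finite) ppoint set \<Rightarrow> 'n ppoint \<Rightarrow> bool" where
  "weierstrass_point C w \<longleftrightarrow> w \<in> C \<and> (\<exists>\<iota>. hyperelliptic_involution C \<iota> \<and> \<iota> w = w)"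


section \<open>Zero-cycles modulo rational equivalence\<close>

text \<open>
  The length of the quotient of a ring by an ideal, as the maximal length of a chain of ideals
  from the given one to the whole ring.
\<close>

definition colength :: "('a, 'b) ring_scheme \<Rightarrow> 'a set \<Rightarrow> nat" where
  "colength R I = Sup {n. \<exists>J. J 0 = I \<and> J n = carrier R \<and>
     (\<forall>i\<le>n. ideal (J i) R) \<and> (\<forall>i<n. J i \<subset> J (Suc i))}"

text \<open>
  Order of vanishing at a point of a possibly singular curve: write the function as a fraction
  of elements of the local ring and take the difference of the lengths.
\<close>

definition ord_at ::
  "('n::finite) ppoint set \<Rightarrow> 'n ppoint \<Rightarrow> ('n ppoint \<Rightarrow> complex) set \<Rightarrow> int" where
  "ord_at W p f = (THE n. \<exists>a b.
     a \<in> carrier (local_ring W p) - {\<zero>\<^bsub>local_ring W p\<^esub>} \<and>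
     b \<in> carrier (local_ring W p) - {\<zero>\<^bsub>local_ring W p\<^esub>} \<and>
     f \<otimes>\<^bsub>function_field W\<^esub> b = a \<and>
     n = int (colength (local_ring W p) (PIdl\<^bsub>local_ring W p\<^esub> a))
       - int (colength (local_ring W p) (PIdl\<^bsub>local_ring W p\<^esub> b)))"

definition principal_cycles :: "('n::finite) ppoint set \<Rightarrow> ('n ppoint \<Rightarrow>\<^sub>0 int) set" where
  "principal_cycles X = {D. \<exists>W f. proj_curve W \<and> W \<subseteq> X \<and>
     f \<in> carrier (function_field W) - {\<zero>\<^bsub>function_field W\<^esub>} \<and>
     (\<forall>p. Poly_Mapping.lookup D p = (if p \<in> W then ord_at W p f else 0))}"

definition rat_equiv_zero :: "('n::finite) ppoint set \<Rightarrow> ('n ppoint \<Rightarrow>\<^sub>0 int) set" where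
  "rat_equiv_zero X = generate (free_Abelian_group X) (principal_cycles X)"

definition CH0 :: "('n::finite) ppoint set \<Rightarrow> ('n ppoint \<Rightarrow>\<^sub>0 int) set monoid" where
  "CH0 X = free_Abelian_group X Mod rat_equiv_zero X"

definition point_class :: "('n::finite) ppoint set \<Rightarrow> 'n ppoint \<Rightarrow> ('n ppoint \<Rightarrow>\<^sub>0 int) set" where
  "point_class X p = rat_equiv_zero X #>\<^bsub>free_Abelian_group X\<^esub> frag_of p"

text \<open>Products are projective varieties through the Segre embedding.\<close>

definition segre :: "('n::finite) ppoint \<Rightarrow> ('m::finite) ppoint \<Rightarrow> ('n \<times> 'm) ppoint" where
  "segre p q = vec.span {(\<chi> ij. u $ fst ij * v $ snd ij) | u v. u \<in> p \<and> v \<in> q}"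

definition segre_product ::
  "('n::finite) ppoint set \<Rightarrow> ('m::finite) ppoint set \<Rightarrow> ('n \<times> 'm) ppoint set" where
  "segre_product X Y = {segre p q | p q. p \<in> X \<and> q \<in> Y}"

end

theory Submission
  imports Defs "HOL-Computational_Algebra.Fundamental_Theorem_Algebra"
begin

text \<open>
  Write \<open>A p = (p,p) - (p,w) - (w,p) + (w,w)\<close>. Extended linearly to divisors \<open>D\<close> on the curve,
  \<open>A D\<close> is the image of \<open>D\<close> on the diagonal, minus its images on \<open>C \<times> {w}\<close> and \<open>{w} \<times> C\<close>, plus
  \<open>deg D\<close> times \<open>(w,w)\<close>. If \<open>D\<close> is the divisor of a function, the first three terms are
  divisors of functions on curves in \<open>C \<times> C\<close> that are isomorphic to \<open>C\<close>, so \<open>A D\<close> is a multiple of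
  \<open>(w,w)\<close> up to rational equivalence.

  Let \<open>\<pi>\<close> be the double cover of the line and \<open>\<iota>\<close> its involution. Coordinates of the line have
  divisors \<open>p + \<iota> p - 2 w\<close>. Using them on the curves \<open>C \<times> {q}\<close> and \<open>{q} \<times> C\<close> gives
  \<open>A (\<iota> p) = A p\<close> (\<open>sq_cycle_\<iota>\<close>). Combined with the same relation on the diagonal this only
  yields \<open>2 * A x = 0\<close>. To remove the factor 2 a function \<open>h\<close> is needed whose divisor \<open>N\<close> satisfies
  \<open>N + \<iota> N = x + \<iota> x - 2 w\<close>: pairing conjugate points then turns \<open>A N\<close> into \<open>A x - A w = A x\<close>,
  and \<open>deg N = 0\<close>, so that \<open>A x = 0\<close> (\<open>sq_cycle_relation\<close>). Such an \<open>h\<close> exists because the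
  coordinate \<open>s\<close> with this divisor is, up to sign, a norm from the function field of \<open>C\<close>.
  Indeed that field is generated over \<open>\<complex>(s)\<close> by an element \<open>Y\<close> with \<open>Y\<^sup>2 = f(s)\<close>
  and \<open>\<iota> Y = - Y\<close>, and every complex polynomial has the form \<open>f = V\<^sup>2 + X * U\<^sup>2\<close>
  (\<open>poly_norm_form\<close>, an instance of Tsen's theorem); so \<open>h = (Y - V(s)) / U(s)\<close> has
  \<open>h * (h \<circ> \<iota>) = - s\<close> (\<open>coordinate_is_norm\<close>).

  The remaining work is to compute these divisors from the definition of the order of vanishing by
  lengths. Smoothness makes the maximal ideal of each local ring principal
  (\<open>maximal_ideal_principal\<close>: the Jacobian criterion followed by Nakayama's lemma). Everything else
  rests on one consequence of \<open>\<pi>\<close> having degree two: any three functions satisfy a linear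
  relation whose coefficients are polynomials in \<open>s\<close> that do not all vanish at zero
  (\<open>three_dependent\<close>). Applied to \<open>1, g, g\<^sup>2\<close> for suitable \<open>g\<close> it shows that every function is a power
  of the generator times a unit (\<open>uniformizer_exists\<close>), that \<open>s\<close> vanishes to order at most two
  (\<open>coordinate_not_cubic\<close>), and that a fibre of \<open>\<pi>\<close> is a pair of conjugate points or one point
  counted twice (\<open>fiber\<close>, \<open>vord_coordinate\<close>).
\<close>


section \<open>Homogeneous forms\<close>

lemma finite_exponents: "finite {\<alpha> :: ('n::finite) \<Rightarrow> nat. (\<Sum>i\<in>UNIV. \<alpha> i) = d}"
proof (rule finite_subset)
  show "{\<alpha> :: 'n \<Rightarrow> nat. (\<Sum>i\<in>UNIV. \<alpha> i) = d} \<subseteq> PiE UNIV (\<lambda>_. {..d})"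
    by (auto simp: PiE_def intro: member_le_sum)
  show "finite (PiE (UNIV :: 'n set) (\<lambda>_. {..d}))"
    by (intro finite_PiE) auto
qed

lemma form_monomial:
  fixes \<alpha> :: "('n::finite) \<Rightarrow> nat"
  shows "form (\<Sum>i\<in>UNIV. \<alpha> i) (\<lambda>u. \<Prod>i\<in>UNIV. (u $ i) ^ \<alpha> i)"
  unfolding form_def
  by (rule exI[of _ "\<lambda>\<beta>. if \<beta> = \<alpha> then 1 else 0"])
     (simp add: if_distrib[of "\<lambda>x. x * _"] sum.delta finite_exponents cong: if_cong)

lemma form_add:
  assumes "form d F" "form d G"
  shows "form d (\<lambda>u. F u + G u)"
proof -
  obtain c c' where "F = (\<lambda>u. \<Sum>\<alpha> | (\<Sum>i\<in>UNIV. \<alpha> i) = d. c \<alpha> * (\<Prod>i\<in>UNIV. (u $ i) ^ \<alpha> i))"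
    "G = (\<lambda>u. \<Sum>\<alpha> | (\<Sum>i\<in>UNIV. \<alpha> i) = d. c' \<alpha> * (\<Prod>i\<in>UNIV. (u $ i) ^ \<alpha> i))"
    using assms unfolding form_def by blast
  then show ?thesis
    unfolding form_def
    by (intro exI[of _ "\<lambda>\<alpha>. c \<alpha> + c' \<alpha>"]) (simp add: sum.distrib distrib_right)
qed

lemma form_cmult:
  assumes "form d F"
  shows "form d (\<lambda>u. a * F u)"
proof -
  obtain c where "F = (\<lambda>u. \<Sum>\<alpha> | (\<Sum>i\<in>UNIV. \<alpha> i) = d. c \<alpha> * (\<Prod>i\<in>UNIV. (u $ i) ^ \<alpha> i))"
    using assms unfolding form_def by blast
  then show ?thesis
    unfolding form_def
    by (intro exI[of _ "\<lambda>\<alpha>. a * c \<alpha>"]) (simp add: sum_distrib_left mult.assoc)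
qed

lemma form_zero: "form d (\<lambda>u. 0)"
  unfolding form_def by (rule exI[of _ "\<lambda>_. 0"]) simp

lemma form_minus: "form d F \<Longrightarrow> form d (\<lambda>u. - F u)"
  using form_cmult[of d F "-1"] by simp

lemma form_diff: "form d F \<Longrightarrow> form d G \<Longrightarrow> form d (\<lambda>u. F u - G u)"
  using form_add[OF _ form_minus, of d F G] by simp

lemma form_sum:
  assumes "\<And>i. i \<in> A \<Longrightarrow> form d (F i)"
  shows "form d (\<lambda>u. \<Sum>i\<in>A. F i u)"
  using assms by (induction A rule: infinite_finite_induct) (auto intro: form_zero form_add)

lemma form_mult:
  fixes F :: "complex ^ ('n::finite) \<Rightarrow> complex"
  assumes "form d F" "form e G"
  shows "form (d + e) (\<lambda>u. F u * G u)"
proof -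
  obtain c c' where F: "F = (\<lambda>u. \<Sum>\<alpha> | (\<Sum>i\<in>UNIV. \<alpha> i) = d. c \<alpha> * (\<Prod>i\<in>UNIV. (u $ i) ^ \<alpha> i))"
    and G: "G = (\<lambda>u. \<Sum>\<alpha> | (\<Sum>i\<in>UNIV. \<alpha> i) = e. c' \<alpha> * (\<Prod>i\<in>UNIV. (u $ i) ^ \<alpha> i))"
    using assms unfolding form_def by blast
  have "form (d + e) (\<lambda>u. \<Sum>\<alpha> | (\<Sum>i\<in>UNIV. \<alpha> i) = d. \<Sum>\<beta> | (\<Sum>i\<in>UNIV. \<beta> i) = e.
      (c \<alpha> * c' \<beta>) * (\<Prod>i\<in>UNIV. (u $ i) ^ (\<alpha> i + \<beta> i)))"
  proof (intro form_sum form_cmult, clarify)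
    fix \<alpha> \<beta> :: "'n \<Rightarrow> nat"
    show "form (sum \<alpha> UNIV + sum \<beta> UNIV) (\<lambda>u. \<Prod>i\<in>UNIV. (u $ i) ^ (\<alpha> i + \<beta> i))"
      using form_monomial[of "\<lambda>i. \<alpha> i + \<beta> i"] by (simp add: sum.distrib)
  qed
  moreover have "(\<lambda>u. F u * G u) = (\<lambda>u. \<Sum>\<alpha> | (\<Sum>i\<in>UNIV. \<alpha> i) = d. \<Sum>\<beta> | (\<Sum>i\<in>UNIV. \<beta> i) = e.
      (c \<alpha> * c' \<beta>) * (\<Prod>i\<in>UNIV. (u $ i) ^ (\<alpha> i + \<beta> i)))"
    unfolding F G sum_product power_add prod.distrib by (intro ext sum.cong refl) (simp add: mult_ac)
  ultimately show ?thesis by simp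
qed

lemma form_const: "form 0 (\<lambda>u. a)"
  using form_cmult[OF form_monomial[of "\<lambda>_. 0"], of a] by simp

lemma form_coord: "form 1 (\<lambda>u. u $ i)"
proof -
  have "(\<lambda>u. \<Prod>j\<in>UNIV. (u $ j) ^ (if j = i then 1 else 0)) = (\<lambda>u. u $ i :: complex)"
    by (simp add: if_distrib[of "\<lambda>k. _ ^ k"] prod.delta cong: if_cong)
  then show ?thesis
    using form_monomial[of "\<lambda>j. if j = i then 1 else 0"] by (simp only: sum.delta finite if_True UNIV_I)
qed

lemma form_power: "form d F \<Longrightarrow> form (k * d) (\<lambda>u. F u ^ k)"
  by (induction k) (simp_all add: form_const form_mult)

lemma form_prod:
  assumes "\<And>i. i \<in> A \<Longrightarrow> form (d i) (F i)"
  shows "form (\<Sum>i\<in>A. d i) (\<lambda>u. \<Prod>i\<in>A. F i u)"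
  using assms by (induction A rule: infinite_finite_induct) (auto intro: form_const form_mult)

lemma form_scale:
  assumes "form d F"
  shows "F (a *s u) = a ^ d * F u"
proof -
  obtain c where F: "F = (\<lambda>u. \<Sum>\<alpha> | (\<Sum>i\<in>UNIV. \<alpha> i) = d. c \<alpha> * (\<Prod>i\<in>UNIV. (u $ i) ^ \<alpha> i))"
    using assms unfolding form_def by blast
  show ?thesis
    unfolding F sum_distrib_left
    by (rule sum.cong) (auto simp: power_mult_distrib prod.distrib power_sum mult_ac)
qed

lemma form_at_0: "form d F \<Longrightarrow> 0 < d \<Longrightarrow> F 0 = 0"
  using form_scale[of d F 0 0] by (simp add: power_0_left)

lemma form_0_const:
  assumes "form 0 F"
  shows "F u = F v"
proof -
  have "F u = F 0" for u
    using form_scale[OF assms, of 0 u] by simp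
  then show ?thesis by metis
qed

lemma form_compose:
  assumes "form d F" "\<And>j. form e (\<Phi> j)"
  shows "form (d * e) (\<lambda>u. F (\<chi> j. \<Phi> j u))"
proof -
  obtain c where F: "F = (\<lambda>u. \<Sum>\<alpha> | (\<Sum>i\<in>UNIV. \<alpha> i) = d. c \<alpha> * (\<Prod>i\<in>UNIV. (u $ i) ^ \<alpha> i))"
    using assms unfolding form_def by blast
  have "form (d * e) (\<lambda>u. \<Sum>\<alpha> | (\<Sum>i\<in>UNIV. \<alpha> i) = d. c \<alpha> * (\<Prod>i\<in>UNIV. (\<Phi> i u) ^ \<alpha> i))"
  proof (intro form_sum form_cmult, clarify)
    fix \<alpha>
    show "form (sum \<alpha> UNIV * e) (\<lambda>u. \<Prod>i\<in>UNIV. (\<Phi> i u) ^ \<alpha> i)"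
      unfolding sum_distrib_right by (intro form_prod form_power assms)
  qed
  then show ?thesis unfolding F by simp
qed

definition lin :: "complex ^ ('n::finite) \<Rightarrow> complex ^ 'n \<Rightarrow> complex" where
  "lin a u = (\<Sum>i\<in>UNIV. a $ i * u $ i)"

lemma form_lin: "form 1 (lin a)"
  unfolding lin_def by (intro form_sum form_cmult form_coord)

lemma lin_simps:
  "lin (a + b) u = lin a u + lin b u" "lin (c *s a) u = c * lin a u"
  "lin a (u + v) = lin a u + lin a v" "lin a (c *s u) = c * lin a u"
  "lin (a - b) u = lin a u - lin b u" "lin a (u - v) = lin a u - lin a v"
  "lin 0 u = 0" "lin a 0 = 0"
  by (simp_all add: lin_def sum.distrib algebra_simps sum_distrib_left sum_subtractf)

lemma lin_axis: "lin (axis i 1) u = u $ i"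
  by (simp add: lin_def axis_def if_distrib[of "\<lambda>x. x * _"] sum.delta cong: if_cong)

lemma lin_eq_0_imp: 
  assumes "\<And>a. lin a u = 0"
  shows "u = 0"
  using assms[of "axis _ 1"] by (simp add: lin_axis vec_eq_iff)

text \<open>Over an infinite field a space is not a finite union of hyperplanes.\<close>

lemma exists_lin_nonzero:
  fixes A :: "(complex ^ ('n::finite)) set"
  assumes "finite A" "0 \<notin> A"
  shows "\<exists>a. \<forall>u\<in>A. lin a u \<noteq> 0"
  using assms
proof (induction A)
  case (insert v A)
  then obtain a where a: "\<forall>u\<in>A. lin a u \<noteq> 0" by auto
  obtain b where b: "lin b v \<noteq> 0"
    using lin_eq_0_imp[of v] insert.prems by auto
  have "finite ((\<lambda>u. - lin a u / lin b u) ` insert v A)"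
    using insert.hyps by simp
  then obtain t where t: "t \<notin> (\<lambda>u. - lin a u / lin b u) ` insert v A"
    using ex_new_if_finite infinite_UNIV_char_0 by blast
  have "lin (a + t *s b) u \<noteq> 0" if "u \<in> insert v A" for u
  proof (cases "lin b u = 0")
    case True
    then show ?thesis using that a b by (auto simp: lin_simps)
  next
    case False
    have "t \<noteq> - lin a u / lin b u" using t that by blast
    moreover have "t = - lin a u / lin b u" if "lin a u + t * lin b u = 0"
    proof -
      have "t * lin b u = - lin a u" using that by (simp add: add_eq_0_iff)
      then show ?thesis using False by (metis nonzero_eq_divide_eq)
    qed
    ultimately show ?thesis by (auto simp: lin_simps)
  qed
  then show ?case by blast
qed auto

section \<open>Points, closed sets and generic points\<close>

text \<open>
  A nonzero vector on the line \<open>p\<close>. Values of forms at \<open>p\<close> are taken there, so a quotient of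
  forms of equal degree does not depend on the choice.
\<close>

definition rep :: "('n::finite) ppoint \<Rightarrow> complex ^ 'n" where
  "rep p = (SOME u. u \<in> p \<and> u \<noteq> 0)"

lemma form_quotient_rep: "form_quotient F G p = F (rep p) / G (rep p)"
  by (simp add: form_quotient_def rep_def Let_def)

lemma span_in_proj_space: "u \<noteq> 0 \<Longrightarrow> vec.span {u} \<in> proj_space"
  by (simp add: proj_space_def vec.dim_span_eq_card_independent vec.independent_insert)

lemma rep_props:
  assumes "p \<in> proj_space"
  shows "rep p \<in> p" "rep p \<noteq> 0" "p = vec.span {rep p}"
proof -
  have sub: "vec.subspace p" and dim: "vec.dim p = 1"
    using assms by (auto simp: proj_space_def)
  have "\<exists>u. u \<in> p \<and> u \<noteq> 0"
  proof (rule ccontr)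
    assume "\<not> ?thesis"
    then have "p \<subseteq> {0}" by auto
    then have "vec.dim p \<le> vec.dim {0 :: complex ^ 'a}" by (rule vec.dim_subset)
    then show False using dim by simp
  qed
  then have *: "rep p \<in> p \<and> rep p \<noteq> 0"
    unfolding rep_def by (rule someI_ex)
  then show "rep p \<in> p" "rep p \<noteq> 0" by auto
  have "p \<subseteq> vec.span {rep p}"
    using * dim by (intro vec.card_ge_dim_independent) (auto simp: vec.independent_insert)
  moreover have "vec.span {rep p} \<subseteq> p"
    using * sub by (intro vec.span_minimal) auto
  ultimately show "p = vec.span {rep p}" by auto
qed

lemma mem_point: "p \<in> proj_space \<Longrightarrow> u \<in> p \<longleftrightarrow> (\<exists>c. u = c *s rep p)"
  using rep_props(3)[of p] vec.span_singleton[of "rep p"] by auto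

lemma point_eq_span:
  assumes "p \<in> proj_space" "u \<in> p" "u \<noteq> 0"
  shows "p = vec.span {u}" "\<exists>c. c \<noteq> 0 \<and> u = c *s rep p"
proof -
  obtain c where c: "u = c *s rep p" using mem_point assms by blast
  then have "c \<noteq> 0" using assms by auto
  then show "\<exists>c. c \<noteq> 0 \<and> u = c *s rep p" using c by auto
  have "vec.span {u} = vec.span {rep p}"
    using \<open>c \<noteq> 0\<close> unfolding c vec.span_singleton
    by (auto simp: image_def) (metis divide_inverse mult.commute nonzero_mult_div_cancel_left times_divide_eq_right)
  then show "p = vec.span {u}" using rep_props(3) assms by auto
qed

lemma rep_span:
  assumes "u \<noteq> 0"
  shows "\<exists>c. c \<noteq> 0 \<and> u = c *s rep (vec.span {u})"
  using point_eq_span(2)[OF span_in_proj_space[OF assms], of u] assms vec.span_base by blast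

lemma rep_inj:
  assumes "p \<in> proj_space" "q \<in> proj_space" "rep p = c *s rep q"
  shows "p = q"
proof -
  have "rep p \<in> q" using assms mem_point by blast
  then show ?thesis
    using point_eq_span(1)[of q "rep p"] rep_props[of p] assms by metis
qed

lemma vanishes_at_rep:
  assumes "form d F" "p \<in> proj_space"
  shows "vanishes_at F p \<longleftrightarrow> F (rep p) = 0"
proof
  show "vanishes_at F p \<Longrightarrow> F (rep p) = 0"
    using rep_props(1)[OF assms(2)] by (auto simp: vanishes_at_def)
  assume "F (rep p) = 0"
  then show "vanishes_at F p"
    using mem_point[OF assms(2)] form_scale[OF assms(1)] by (auto simp: vanishes_at_def)
qed

lemma form_span_eq_0:
  assumes "form d F" "u \<noteq> 0"
  shows "F (rep (vec.span {u})) = 0 \<longleftrightarrow> F u = 0"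
proof -
  obtain c where c: "c \<noteq> 0" "u = c *s rep (vec.span {u})" using rep_span[OF assms(2)] by blast
  then have "F u = c ^ d * F (rep (vec.span {u}))" using form_scale[OF assms(1)] by metis
  then show ?thesis using c by simp
qed

lemma form_quotient_span:
  assumes "form d F" "form d G" "u \<noteq> 0"
  shows "form_quotient F G (vec.span {u}) = F u / G u"
proof -
  obtain c where c: "c \<noteq> 0" "u = c *s rep (vec.span {u})" using rep_span[OF assms(3)] by blast
  then have "F u = c ^ d * F (rep (vec.span {u}))" "G u = c ^ d * G (rep (vec.span {u}))"
    using form_scale assms by metis+
  then show ?thesis using c by (simp add: form_quotient_rep)
qed

lemma proj_closedI:
  assumes "\<And>F. F \<in> S \<Longrightarrow> \<exists>d. form d F"
    and "\<And>p. p \<in> X \<longleftrightarrow> p \<in> proj_space \<and> (\<forall>F\<in>S. F (rep p) = 0)"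
  shows "proj_closed X"
  unfolding proj_closed_def
proof (intro exI[of _ S] conjI)
  show "X = {p \<in> proj_space. \<forall>F\<in>S. vanishes_at F p}"
    using assms vanishes_at_rep by blast
qed (use assms in auto)

lemma proj_closedE:
  assumes "proj_closed X"
  obtains S where "\<And>F. F \<in> S \<Longrightarrow> \<exists>d. form d F"
    and "\<And>p. p \<in> X \<longleftrightarrow> p \<in> proj_space \<and> (\<forall>F\<in>S. F (rep p) = 0)"
proof -
  obtain S where S: "\<forall>F\<in>S. \<exists>d. form d F" "X = {p \<in> proj_space. \<forall>F\<in>S. vanishes_at F p}"
    using assms unfolding proj_closed_def by blast
  show ?thesis
    by (rule that[of S]) (use S vanishes_at_rep in blast)+
qed

lemma proj_closed_subset: "proj_closed X \<Longrightarrow> X \<subseteq> proj_space"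
  by (auto simp: proj_closed_def)

lemma proj_closed_zeros: "form d F \<Longrightarrow> proj_closed {p \<in> proj_space. F (rep p) = 0}"
  by (rule proj_closedI[of "{F}"]) auto

lemma proj_closed_empty: "proj_closed {}"
  by (rule proj_closedI[of "{\<lambda>_. 1}"]) (auto intro: form_const)

lemma proj_closed_Un:
  assumes "proj_closed X" "proj_closed Y"
  shows "proj_closed (X \<union> Y)"
proof -
  obtain S where S: "\<And>F. F \<in> S \<Longrightarrow> \<exists>d. form d F"
    "\<And>p. p \<in> X \<longleftrightarrow> p \<in> proj_space \<and> (\<forall>F\<in>S. F (rep p) = 0)" by (rule proj_closedE[OF assms(1)]) blast
  obtain T where T: "\<And>F. F \<in> T \<Longrightarrow> \<exists>d. form d F"
    "\<And>p. p \<in> Y \<longleftrightarrow> p \<in> proj_space \<and> (\<forall>F\<in>T. F (rep p) = 0)" by (rule proj_closedE[OF assms(2)]) blast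
  show ?thesis
  proof (rule proj_closedI[of "(\<lambda>(F, G) u. F u * G u) ` (S \<times> T)"])
    fix H assume "H \<in> (\<lambda>(F, G) u. F u * G u) ` (S \<times> T)"
    then obtain F G where "F \<in> S" "G \<in> T" "H = (\<lambda>u. F u * G u)" by auto
    then show "\<exists>d. form d H" using S(1)[of F] T(1)[of G] form_mult by metis
  next
    fix p
    show "p \<in> X \<union> Y \<longleftrightarrow> p \<in> proj_space \<and>
        (\<forall>F\<in>(\<lambda>(F, G) u. F u * G u) ` (S \<times> T). F (rep p) = 0)"
      using S(2)[of p] T(2)[of p] by auto
  qed
qed

text \<open>
  Holding eventually in this filter means holding on a nonempty open subset. Irreducibility
  keeps intersections of nonempty open subsets nonempty, so the filter is proper. Rational functions
  are handled below as plain functions up to eventual equality.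
\<close>

definition generic :: "('n::finite) ppoint set \<Rightarrow> 'n ppoint filter" where
  "generic X = (INF Z\<in>{Z. proj_closed Z \<and> \<not> X \<subseteq> Z}. principal (X - Z))"

locale variety =
  fixes X :: "('n::finite) ppoint set"
  assumes variety: "proj_variety X"
begin

lemma closed: "proj_closed X" and nonempty: "X \<noteq> {}"
  using variety by (auto simp: proj_variety_def)

lemma in_proj_space: "p \<in> X \<Longrightarrow> p \<in> proj_space"
  using closed proj_closed_subset by blast

lemma irreducible: "proj_closed A \<Longrightarrow> proj_closed B \<Longrightarrow> X \<subseteq> A \<union> B \<Longrightarrow> X \<subseteq> A \<or> X \<subseteq> B"
  using variety by (auto simp: proj_variety_def)

lemma eventually_generic:
  "eventually P (generic X) \<longleftrightarrow> (\<exists>Z. proj_closed Z \<and> \<not> X \<subseteq> Z \<and> (\<forall>p\<in>X - Z. P p))"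
proof -
  have "eventually P (generic X) \<longleftrightarrow>
      (\<exists>Z\<in>{Z. proj_closed Z \<and> \<not> X \<subseteq> Z}. eventually P (principal (X - Z)))"
    unfolding generic_def
  proof (rule eventually_INF_base)
    show "{Z. proj_closed Z \<and> \<not> X \<subseteq> Z} \<noteq> {}"
      using proj_closed_empty nonempty by auto
    fix A B assume AB: "A \<in> {Z. proj_closed Z \<and> \<not> X \<subseteq> Z}" "B \<in> {Z. proj_closed Z \<and> \<not> X \<subseteq> Z}"
    then have "A \<union> B \<in> {Z. proj_closed Z \<and> \<not> X \<subseteq> Z}"
      using irreducible proj_closed_Un by auto
    then show "\<exists>Z\<in>{Z. proj_closed Z \<and> \<not> X \<subseteq> Z}.
        principal (X - Z) \<le> inf (principal (X - A)) (principal (X - B))"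
      by (rule rev_bexI) auto
  qed
  then show ?thesis by (auto simp: eventually_principal)
qed

lemma generic_nontrivial: "generic X \<noteq> bot"
  unfolding trivial_limit_def eventually_generic by auto

lemma generic_exists: "eventually P (generic X) \<Longrightarrow> \<exists>p\<in>X. P p"
  unfolding eventually_generic by blast

lemma generic_mem: "\<forall>\<^sub>F p in generic X. p \<in> X"
  unfolding eventually_generic using proj_closed_empty nonempty by blast

lemma generic_False [simp]: "\<not> (\<forall>\<^sub>F p in generic X. False)"
  using generic_nontrivial by (simp add: trivial_limit_def)

lemma generic_form_nonzero:
  assumes "form d F" "p \<in> X" "F (rep p) \<noteq> 0"
  shows "\<forall>\<^sub>F q in generic X. F (rep q) \<noteq> 0"
  unfolding eventually_generic
  by (rule exI[of _ "{p \<in> proj_space. F (rep p) = 0}"])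
     (use assms in_proj_space proj_closed_zeros[OF assms(1)] in auto)

lemma generic_form_zero:
  assumes "form d F" "\<forall>\<^sub>F q in generic X. F (rep q) = 0" "p \<in> X"
  shows "F (rep p) = 0"
proof (rule ccontr)
  assume "F (rep p) \<noteq> 0"
  then have "\<forall>\<^sub>F q in generic X. F (rep q) \<noteq> 0" by (rule generic_form_nonzero[OF assms(1,3)])
  then have "\<forall>\<^sub>F q in generic X. False" using assms(2) by eventually_elim simp
  then show False by simp
qed

end

section \<open>Rational functions and their values\<close>

text \<open>
  Representatives of the elements of the function field.
\<close>

definition rational :: "('n::finite) ppoint set \<Rightarrow> ('n ppoint \<Rightarrow> complex) \<Rightarrow> bool" where
  "rational X r \<longleftrightarrow> (\<exists>d F G. form d F \<and> form d G \<and> (\<exists>p\<in>X. G (rep p) \<noteq> 0) \<and>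
     (\<forall>\<^sub>F q in generic X. r q = F (rep q) / G (rep q)))"

text \<open>
  The function \<open>r\<close> represents an element of the local ring at \<open>p\<close> whose residue is \<open>c\<close>. The
  residue need not be \<open>r p\<close>, because \<open>r\<close> is only determined generically.
\<close>

definition has_val ::
  "('n::finite) ppoint set \<Rightarrow> 'n ppoint \<Rightarrow> ('n ppoint \<Rightarrow> complex) \<Rightarrow> complex \<Rightarrow> bool" where
  "has_val X p r c \<longleftrightarrow> (\<exists>d F G. form d F \<and> form d G \<and> G (rep p) \<noteq> 0 \<and> F (rep p) = c * G (rep p) \<and>
     (\<forall>\<^sub>F q in generic X. r q = F (rep q) / G (rep q)))"

lemma rationalI:
  assumes "form d F" "form d G" "p \<in> X" "G (rep p) \<noteq> 0"
    "\<forall>\<^sub>F q in generic X. r q = F (rep q) / G (rep q)"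
  shows "rational X r"
  using assms unfolding rational_def by blast

lemma has_valI:
  assumes "form d F" "form d G" "G (rep p) \<noteq> 0" "F (rep p) = c * G (rep p)"
    "\<forall>\<^sub>F q in generic X. r q = F (rep q) / G (rep q)"
  shows "has_val X p r c"
  using assms unfolding has_val_def by blast

lemma has_val_rational: "has_val X p r c \<Longrightarrow> p \<in> X \<Longrightarrow> rational X r"
  unfolding rational_def has_val_def by blast

lemma has_val_form:
  assumes "form d F" "form d G" "G (rep p) \<noteq> 0"
  shows "has_val X p (\<lambda>q. F (rep q) / G (rep q)) (F (rep p) / G (rep p))"
  by (rule has_valI[OF assms]) (use assms in auto)

lemma has_val_const: "has_val X p (\<lambda>_. c) c"
  by (rule has_valI[OF form_const[of c] form_const[of 1]]) auto

lemma has_val_cong: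
  assumes "has_val X p r c" "\<forall>\<^sub>F q in generic X. r' q = r q"
  shows "has_val X p r' c"
proof -
  obtain d F G where 1: "form d F" "form d G" "G (rep p) \<noteq> 0" "F (rep p) = c * G (rep p)"
    and 2: "\<forall>\<^sub>F q in generic X. r q = F (rep q) / G (rep q)"
    using assms(1) unfolding has_val_def by blast
  show ?thesis
    by (rule has_valI[OF 1]) (use 2 assms(2) in eventually_elim, simp)
qed

lemma rational_cong:
  assumes "rational X r" "\<forall>\<^sub>F q in generic X. r' q = r q"
  shows "rational X r'"
proof -
  obtain d F G where 1: "form d F" "form d G" "\<exists>p\<in>X. G (rep p) \<noteq> 0"
    and 2: "\<forall>\<^sub>F q in generic X. r q = F (rep q) / G (rep q)"
    using assms(1) unfolding rational_def by blast
  have "\<forall>\<^sub>F q in generic X. r' q = F (rep q) / G (rep q)"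
    using 2 assms(2) by eventually_elim simp
  then show ?thesis using 1 unfolding rational_def by blast
qed

context variety
begin

lemma has_val_add:
  assumes "has_val X p r c" "has_val X p r' c'" "p \<in> X"
  shows "has_val X p (\<lambda>q. r q + r' q) (c + c')"
proof -
  obtain d F G where 1: "form d F" "form d G" "G (rep p) \<noteq> 0" "F (rep p) = c * G (rep p)"
    "\<forall>\<^sub>F q in generic X. r q = F (rep q) / G (rep q)"
    using assms(1) unfolding has_val_def by blast
  obtain d' F' G' where 2: "form d' F'" "form d' G'" "G' (rep p) \<noteq> 0" "F' (rep p) = c' * G' (rep p)"
    "\<forall>\<^sub>F q in generic X. r' q = F' (rep q) / G' (rep q)"
    using assms(2) unfolding has_val_def by blast
  show ?thesis
  proof (rule has_valI)
    show "form (d + d') (\<lambda>u. F u * G' u + F' u * G u)"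
      using form_mult[OF 1(1) 2(2)] form_mult[OF 2(1) 1(2)] by (intro form_add) (auto simp: add.commute)
    show "form (d + d') (\<lambda>u. G u * G' u)"
      using form_mult[OF 1(2) 2(2)] .
    show "\<forall>\<^sub>F q in generic X. r q + r' q =
      (F (rep q) * G' (rep q) + F' (rep q) * G (rep q)) / (G (rep q) * G' (rep q))"
      using 1(5) 2(5) generic_form_nonzero[OF 1(2) assms(3) 1(3)] generic_form_nonzero[OF 2(2) assms(3) 2(3)]
      by eventually_elim (simp add: field_simps)
  qed (use 1 2 in \<open>auto simp: algebra_simps\<close>)
qed

lemma has_val_mult:
  assumes "has_val X p r c" "has_val X p r' c'"
  shows "has_val X p (\<lambda>q. r q * r' q) (c * c')"
proof -
  obtain d F G where 1: "form d F" "form d G" "G (rep p) \<noteq> 0" "F (rep p) = c * G (rep p)"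
    "\<forall>\<^sub>F q in generic X. r q = F (rep q) / G (rep q)"
    using assms(1) unfolding has_val_def by blast
  obtain d' F' G' where 2: "form d' F'" "form d' G'" "G' (rep p) \<noteq> 0" "F' (rep p) = c' * G' (rep p)"
    "\<forall>\<^sub>F q in generic X. r' q = F' (rep q) / G' (rep q)"
    using assms(2) unfolding has_val_def by blast
  show ?thesis
  proof (rule has_valI)
    show "form (d + d') (\<lambda>u. F u * F' u)" "form (d + d') (\<lambda>u. G u * G' u)"
      using form_mult 1 2 by auto
    show "\<forall>\<^sub>F q in generic X. r q * r' q = (F (rep q) * F' (rep q)) / (G (rep q) * G' (rep q))"
      using 1(5) 2(5) by eventually_elim (simp add: field_simps)
  qed (use 1 2 in \<open>auto simp: algebra_simps\<close>)
qed

lemma has_val_inverse: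
  assumes "has_val X p r c" "c \<noteq> 0"
  shows "has_val X p (\<lambda>q. inverse (r q)) (inverse c)"
proof -
  obtain d F G where 1: "form d F" "form d G" "G (rep p) \<noteq> 0" "F (rep p) = c * G (rep p)"
    "\<forall>\<^sub>F q in generic X. r q = F (rep q) / G (rep q)"
    using assms(1) unfolding has_val_def by blast
  show ?thesis
  proof (rule has_valI[OF 1(2,1)])
    show "\<forall>\<^sub>F q in generic X. inverse (r q) = G (rep q) / F (rep q)"
      using 1(5) by eventually_elim simp
  qed (use 1 assms in auto)
qed

lemma has_val_minus: "has_val X p r c \<Longrightarrow> has_val X p (\<lambda>q. - r q) (- c)"
  using has_val_mult[OF has_val_const[of X p "-1"], of r c] by simp

lemma has_val_diff:
  "has_val X p r c \<Longrightarrow> has_val X p r' c' \<Longrightarrow> p \<in> X \<Longrightarrow> has_val X p (\<lambda>q. r q - r' q) (c - c')"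
  using has_val_add[OF _ has_val_minus, of p r c r' c'] by simp

lemma has_val_divide:
  "has_val X p r c \<Longrightarrow> has_val X p r' c' \<Longrightarrow> c' \<noteq> 0 \<Longrightarrow> has_val X p (\<lambda>q. r q / r' q) (c / c')"
  using has_val_mult[OF _ has_val_inverse, of p r c r' c'] by (simp add: divide_inverse)

lemma has_val_power: "has_val X p r c \<Longrightarrow> has_val X p (\<lambda>q. r q ^ n) (c ^ n)"
  by (induction n) (simp_all add: has_val_const has_val_mult)

lemma has_val_sum:
  assumes "\<And>i. i \<in> A \<Longrightarrow> has_val X p (r i) (c i)" "p \<in> X"
  shows "has_val X p (\<lambda>q. \<Sum>i\<in>A. r i q) (\<Sum>i\<in>A. c i)"
  using assms by (induction A rule: infinite_finite_induct) (auto intro: has_val_const has_val_add)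

lemma has_val_poly:
  assumes "has_val X p r c" "p \<in> X"
  shows "has_val X p (\<lambda>q. poly P (r q)) (poly P c)"
proof (induction P)
  case (pCons a P)
  show ?case
    using has_val_add[OF has_val_const has_val_mult[OF assms(1) pCons(2)] assms(2), of a] by simp
qed (simp add: has_val_const)

text \<open>
  A form that vanishes generically vanishes everywhere, so the residue does not depend on the
  fraction chosen to represent the function.
\<close>

lemma has_val_unique:
  assumes "has_val X p r c" "has_val X p r c'" "p \<in> X"
  shows "c = c'"
proof -
  obtain d F G where 1: "form d F" "form d G" "G (rep p) \<noteq> 0" "F (rep p) = c * G (rep p)"
    "\<forall>\<^sub>F q in generic X. r q = F (rep q) / G (rep q)"
    using assms(1) unfolding has_val_def by blast
  obtain d' F' G' where 2: "form d' F'" "form d' G'" "G' (rep p) \<noteq> 0" "F' (rep p) = c' * G' (rep p)"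
    "\<forall>\<^sub>F q in generic X. r q = F' (rep q) / G' (rep q)"
    using assms(2) unfolding has_val_def by blast
  have f: "form (d + d') (\<lambda>u. F u * G' u - F' u * G u)"
    using form_mult[OF 1(1) 2(2)] form_mult[OF 2(1) 1(2)] by (intro form_diff) (auto simp: add.commute)
  have "\<forall>\<^sub>F q in generic X. F (rep q) * G' (rep q) - F' (rep q) * G (rep q) = 0"
    using 1(5) 2(5) generic_form_nonzero[OF 1(2) assms(3) 1(3)] generic_form_nonzero[OF 2(2) assms(3) 2(3)]
    by eventually_elim (simp add: field_simps)
  then have "F (rep p) * G' (rep p) - F' (rep p) * G (rep p) = 0"
    using generic_form_zero[OF f _ assms(3)] by simp
  then show ?thesis using 1 2 by (simp add: field_simps)
qed

lemma has_val_generic_nonzero: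
  assumes "has_val X p r c" "c \<noteq> 0" "p \<in> X"
  shows "\<forall>\<^sub>F q in generic X. r q \<noteq> 0"
proof -
  obtain d F G where 1: "form d F" "form d G" "G (rep p) \<noteq> 0" "F (rep p) = c * G (rep p)"
    "\<forall>\<^sub>F q in generic X. r q = F (rep q) / G (rep q)"
    using assms(1) unfolding has_val_def by blast
  have "\<forall>\<^sub>F q in generic X. F (rep q) \<noteq> 0"
    using generic_form_nonzero[OF 1(1) assms(3)] 1 assms by auto
  with 1(5) generic_form_nonzero[OF 1(2) assms(3) 1(3)] show ?thesis
    by eventually_elim simp
qed

lemma rational_local_fraction:
  assumes "rational X r" "p \<in> X"
  obtains a b \<alpha> \<beta> where "has_val X p a \<alpha>" "has_val X p b \<beta>"
    "\<forall>\<^sub>F q in generic X. b q \<noteq> 0" "\<forall>\<^sub>F q in generic X. r q = a q / b q"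
proof -
  obtain d F G p0 where 1: "form d F" "form d G" "p0 \<in> X" "G (rep p0) \<noteq> 0"
    and ev: "\<forall>\<^sub>F q in generic X. r q = F (rep q) / G (rep q)"
    using assms(1) unfolding rational_def by blast
  obtain l where "lin l (rep p) \<noteq> 0"
    using lin_eq_0_imp rep_props(2) in_proj_space[OF assms(2)] by blast
  then have L: "form d (\<lambda>u. lin l u ^ d)" "lin l (rep p) ^ d \<noteq> 0"
    using form_power[OF form_lin, of d l] by auto
  note evL = generic_form_nonzero[OF L(1) assms(2) L(2)] and evG = generic_form_nonzero[OF 1(2-4)]
  show ?thesis
  proof (rule that[OF has_val_form[OF 1(1) L] has_val_form[OF 1(2) L]])
    show "\<forall>\<^sub>F q in generic X. G (rep q) / lin l (rep q) ^ d \<noteq> 0"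
      using evL evG by eventually_elim simp
    show "\<forall>\<^sub>F q in generic X. r q = F (rep q) / lin l (rep q) ^ d / (G (rep q) / lin l (rep q) ^ d)"
      using evL evG ev by eventually_elim simp
  qed
qed

text \<open>
  This is where irreducibility enters: the zeros of the numerator either contain the variety or
  miss a nonempty open subset.
\<close>

lemma rational_dichotomy:
  assumes "rational X r"
  shows "(\<forall>\<^sub>F q in generic X. r q = 0) \<or> (\<forall>\<^sub>F q in generic X. r q \<noteq> 0)"
proof -
  obtain d F G p0 where 1: "form d F" "form d G" "p0 \<in> X" "G (rep p0) \<noteq> 0"
    and ev: "\<forall>\<^sub>F q in generic X. r q = F (rep q) / G (rep q)"
    using assms(1) unfolding rational_def by blast
  show ?thesis
  proof (cases "\<exists>p\<in>X. F (rep p) \<noteq> 0")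
    case True
    then obtain p1 where "p1 \<in> X" "F (rep p1) \<noteq> 0" by blast
    from generic_form_nonzero[OF 1(1) this] ev generic_form_nonzero[OF 1(2-4)]
    have "\<forall>\<^sub>F q in generic X. r q \<noteq> 0" by eventually_elim simp
    then show ?thesis ..
  next
    case False
    have "\<forall>\<^sub>F q in generic X. r q = 0"
      using ev generic_mem by eventually_elim (use False in auto)
    then show ?thesis ..
  qed
qed

lemma generic_zero_nonzero_False:
  assumes "\<forall>\<^sub>F q in generic X. r q \<noteq> (0::complex)" "\<forall>\<^sub>F q in generic X. r q = 0"
  shows False
proof -
  have "\<forall>\<^sub>F q in generic X. False" using assms by eventually_elim simp
  then show ?thesis by simp
qed

lemma rational_const: "rational X (\<lambda>_. c)"
  using has_val_rational[OF has_val_const] nonempty by blast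

lemma rational_add:
  assumes "rational X r" "rational X r'"
  shows "rational X (\<lambda>q. r q + r' q)"
proof -
  obtain d F G p where 1: "form d F" "form d G" "p \<in> X" "G (rep p) \<noteq> 0"
    "\<forall>\<^sub>F q in generic X. r q = F (rep q) / G (rep q)"
    using assms(1) unfolding rational_def by blast
  obtain d' F' G' p' where 2: "form d' F'" "form d' G'" "p' \<in> X" "G' (rep p') \<noteq> 0"
    "\<forall>\<^sub>F q in generic X. r' q = F' (rep q) / G' (rep q)"
    using assms(2) unfolding rational_def by blast
  note ev = generic_form_nonzero[OF 1(2-4)] generic_form_nonzero[OF 2(2-4)]
  have "\<forall>\<^sub>F q in generic X. G (rep q) * G' (rep q) \<noteq> 0"
    using ev by eventually_elim simp
  then obtain p0 where p0: "p0 \<in> X" "G (rep p0) * G' (rep p0) \<noteq> 0"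
    using generic_exists by blast
  show ?thesis
  proof (rule rationalI[of "d + d'" "\<lambda>u. F u * G' u + F' u * G u" "\<lambda>u. G u * G' u", OF _ _ p0])
    show "form (d + d') (\<lambda>u. F u * G' u + F' u * G u)"
      using form_mult[OF 1(1) 2(2)] form_mult[OF 2(1) 1(2)] by (intro form_add) (auto simp: add.commute)
    show "form (d + d') (\<lambda>u. G u * G' u)"
      using form_mult[OF 1(2) 2(2)] .
    show "\<forall>\<^sub>F q in generic X. r q + r' q =
      (F (rep q) * G' (rep q) + F' (rep q) * G (rep q)) / (G (rep q) * G' (rep q))"
      using 1(5) 2(5) ev by eventually_elim (simp add: field_simps)
  qed
qed

lemma rational_mult:
  assumes "rational X r" "rational X r'"
  shows "rational X (\<lambda>q. r q * r' q)"
proof -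
  obtain d F G p where 1: "form d F" "form d G" "p \<in> X" "G (rep p) \<noteq> 0"
    "\<forall>\<^sub>F q in generic X. r q = F (rep q) / G (rep q)"
    using assms(1) unfolding rational_def by blast
  obtain d' F' G' p' where 2: "form d' F'" "form d' G'" "p' \<in> X" "G' (rep p') \<noteq> 0"
    "\<forall>\<^sub>F q in generic X. r' q = F' (rep q) / G' (rep q)"
    using assms(2) unfolding rational_def by blast
  note ev = generic_form_nonzero[OF 1(2-4)] generic_form_nonzero[OF 2(2-4)]
  have "\<forall>\<^sub>F q in generic X. G (rep q) * G' (rep q) \<noteq> 0"
    using ev by eventually_elim simp
  then obtain p0 where p0: "p0 \<in> X" "G (rep p0) * G' (rep p0) \<noteq> 0"
    using generic_exists by blast
  show ?thesis
  proof (rule rationalI[OF form_mult[OF 1(1) 2(1)] form_mult[OF 1(2) 2(2)] p0])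
    show "\<forall>\<^sub>F q in generic X. r q * r' q = (F (rep q) * F' (rep q)) / (G (rep q) * G' (rep q))"
      using 1(5) 2(5) by eventually_elim (simp add: field_simps)
  qed
qed

lemma rational_inverse:
  assumes "rational X r"
  shows "rational X (\<lambda>q. inverse (r q))"
proof -
  obtain d F G p where 1: "form d F" "form d G" "p \<in> X" "G (rep p) \<noteq> 0"
    and ev: "\<forall>\<^sub>F q in generic X. r q = F (rep q) / G (rep q)"
    using assms(1) unfolding rational_def by blast
  show ?thesis
  proof (cases "\<exists>p\<in>X. F (rep p) \<noteq> 0")
    case True
    then obtain p1 where p1: "p1 \<in> X" "F (rep p1) \<noteq> 0" by blast
    show ?thesis
      by (rule rationalI[OF 1(2,1) p1]) (use ev in eventually_elim, simp)
  next
    case False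
    have "\<forall>\<^sub>F q in generic X. inverse (r q) = 0"
      using ev generic_mem by eventually_elim (use False in auto)
    then show ?thesis using rational_cong[OF rational_const[of 0]] by simp
  qed
qed

lemma rational_minus: "rational X r \<Longrightarrow> rational X (\<lambda>q. - r q)"
  using rational_mult[OF rational_const[of "-1"], of r] by simp

lemma rational_diff: "rational X r \<Longrightarrow> rational X r' \<Longrightarrow> rational X (\<lambda>q. r q - r' q)"
  using rational_add[OF _ rational_minus, of r r'] by simp

lemma rational_divide: "rational X r \<Longrightarrow> rational X r' \<Longrightarrow> rational X (\<lambda>q. r q / r' q)"
  using rational_mult[OF _ rational_inverse, of r r'] by (simp add: divide_inverse)

lemma rational_power: "rational X r \<Longrightarrow> rational X (\<lambda>q. r q ^ n)"
  by (induction n) (simp_all add: rational_const rational_mult)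

lemma rational_poly: "rational X r \<Longrightarrow> rational X (\<lambda>q. poly P (r q))"
proof (induction P)
  case (pCons a P)
  then show ?case
    using rational_add[OF rational_const rational_mult[of r "\<lambda>q. poly P (r q)"], of a] by simp
qed (simp add: rational_const)

end

section \<open>Local rings and orders of vanishing\<close>

text \<open>
  When every element is a unit times a power of \<open>z\<close>, an ideal is determined by the least
  power of \<open>z\<close> that it contains. A strict chain lowers this exponent at each step, and the powers of \<open>z\<close>
  realise the longest chain.
\<close>

lemma (in domain) colength_uniformizer_power:
  assumes z: "z \<in> carrier R" "z \<notin> Units R" "z \<noteq> \<zero>"
    and gen: "\<And>a. a \<in> carrier R - {\<zero>} \<Longrightarrow> \<exists>n::nat. \<exists>u\<in>Units R. a = z [^] n \<otimes> u"
    and u: "u \<in> Units R"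
  shows "colength R (PIdl (z [^] (n::nat) \<otimes> u)) = n"
proof -
  let ?I = "PIdl (z [^] n \<otimes> u)"
  have zc: "z [^] (k::nat) \<in> carrier R" for k using z by simp
  have uc: "u \<in> carrier R" "inv u \<in> carrier R" "u \<otimes> inv u = \<one>" using u by auto
  have pow0: "z [^] (k::nat) \<noteq> \<zero>" for k
    using z by (induction k) (auto simp: integral_iff)
  have mem_power: "z [^] k \<in> J" if "ideal J R" "z [^] (l::nat) \<in> J" "l \<le> k" for J and k l :: nat
  proof -
    interpret J: ideal J R by fact
    have "z [^] l \<otimes> z [^] (k - l) \<in> J" using J.I_r_closed that zc by blast
    then show ?thesis using that z by (simp add: nat_pow_mult)
  qed
  have mem_unit: "z [^] k \<in> J \<longleftrightarrow> z [^] k \<otimes> v \<in> J" if "ideal J R" "v \<in> Units R" for J v and k :: nat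
  proof -
    interpret J: ideal J R by fact
    have v: "v \<in> carrier R" "inv v \<in> carrier R" "v \<otimes> inv v = \<one>" using that by auto
    have "z [^] k \<otimes> v \<otimes> inv v = z [^] k" using v zc by (simp add: m_assoc)
    then show ?thesis using J.I_r_closed[of "z [^] k" v] J.I_r_closed[of "z [^] k \<otimes> v" "inv v"] v by auto
  qed
  have I: "ideal ?I R" "z [^] n \<in> ?I"
    using cgenideal_ideal[of "z [^] n \<otimes> u"] cgenideal_self[of "z [^] n \<otimes> u"]
      mem_unit[OF _ u, of ?I n] zc uc by auto
  (* An ideal grows strictly only if the least exponent of a power in it drops. *)
  have drop: "(LEAST k :: nat. z [^] k \<in> J') < (LEAST k :: nat. z [^] k \<in> J)"
    if J: "ideal J R" "z [^] (l::nat) \<in> J" and J': "ideal J' R" and "J \<subset> J'" for J J' and l :: nat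
  proof -
    define m where "m = (LEAST k :: nat. z [^] k \<in> J)"
    define m' where "m' = (LEAST k :: nat. z [^] k \<in> J')"
    have m: "z [^] m \<in> J" unfolding m_def using J(2) by (rule LeastI)
    then have "m' \<le> m" unfolding m'_def using \<open>J \<subset> J'\<close> by (intro Least_le) auto
    moreover have "m' \<noteq> m"
    proof
      assume "m' = m"
      have "J' \<subseteq> J"
      proof
        fix a assume a: "a \<in> J'"
        interpret J: ideal J R by fact
        interpret J': ideal J' R by fact
        show "a \<in> J"
        proof (cases "a = \<zero>")
          case False
          then obtain k v where kv: "v \<in> Units R" "a = z [^] (k::nat) \<otimes> v"
            using gen[of a] a J'.Icarr by blast
          then have "z [^] k \<in> J'" using a mem_unit[OF J' kv(1)] by simp
          then have "m \<le> k" unfolding \<open>m' = m\<close>[symmetric] m'_def by (rule Least_le)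
          then have "z [^] k \<in> J" using mem_power[OF J(1) m] by simp
          then show ?thesis using kv mem_unit[OF J(1) kv(1)] by simp
        qed (simp add: J.zero_closed)
      qed
      then show False using \<open>J \<subset> J'\<close> by auto
    qed
    ultimately show ?thesis unfolding m_def m'_def by simp
  qed
  have "Sup {n. \<exists>J. J 0 = ?I \<and> J n = carrier R \<and>
     (\<forall>i\<le>n. ideal (J i) R) \<and> (\<forall>i<n. J i \<subset> J (Suc i))} = n" (is "Sup ?L = n")
  proof (rule cSup_eq_maximum)
    let ?J = "\<lambda>i. PIdl (z [^] (n - i))"
    have "?J i \<subset> ?J (Suc i)" if i: "i < n" for i
    proof -
      obtain k where k: "n - i = Suc k" "n - Suc i = k" using Suc_diff_Suc[OF i] by metis
      have "z [^] Suc k \<in> PIdl (z [^] k)"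
        using mem_power[OF cgenideal_ideal[OF zc] cgenideal_self[OF zc], of k "Suc k"] by simp
      then have "PIdl (z [^] Suc k) \<subseteq> PIdl (z [^] k)"
        by (intro cgenideal_minimal cgenideal_ideal zc)
      moreover have "z [^] k \<notin> PIdl (z [^] Suc k)"
      proof
        assume "z [^] k \<in> PIdl (z [^] Suc k)"
        then obtain r where r: "r \<in> carrier R" "z [^] k = r \<otimes> z [^] Suc k"
          unfolding cgenideal_def by blast
        have "r \<otimes> z [^] Suc k = z [^] k \<otimes> (z \<otimes> r)"
          using z r(1) zc[of k] by (simp add: m_ac)
        then have "z [^] k \<otimes> \<one> = z [^] k \<otimes> (z \<otimes> r)"
          using r(2) r_one[OF zc[of k]] by metis
        then have "\<one> = z \<otimes> r" using m_lcancel[OF pow0 zc one_closed m_closed[OF z(1) r(1)]] by blast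
        then have "z \<in> Units R"
          using z r(1) m_comm[of z r] unfolding Units_def by (intro CollectI conjI bexI[of _ r]) auto
        then show False using z by simp
      qed
      moreover have "z [^] k \<in> PIdl (z [^] k)" by (intro cgenideal_self zc)
      ultimately show ?thesis unfolding k by blast
    qed
    moreover have "?J 0 = ?I"
    proof -
      have "z [^] n \<otimes> u \<in> PIdl (z [^] n)"
        using mem_unit[OF cgenideal_ideal[OF zc] u] cgenideal_self[OF zc] by blast
      then show ?thesis
        using I by (simp add: subset_antisym cgenideal_minimal cgenideal_ideal zc)
    qed
    moreover have "?J n = carrier R"
      using cgenideal_self[of \<one>] ideal.one_imp_carrier[OF cgenideal_ideal[of \<one>]] by simp
    ultimately show "n \<in> ?L"
      by (intro CollectI exI[of _ ?J]) (auto intro: cgenideal_ideal zc)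
  next
    fix m assume "m \<in> ?L"
    then obtain J where "J 0 = ?I \<and> J m = carrier R \<and> (\<forall>i\<le>m. ideal (J i) R) \<and> (\<forall>i<m. J i \<subset> J (Suc i))"
      unfolding mem_Collect_eq ..
    then have J: "J 0 = ?I" "J m = carrier R" "\<And>i. i \<le> m \<Longrightarrow> ideal (J i) R"
      "\<And>i. i < m \<Longrightarrow> J i \<subset> J (Suc i)" by simp_all
    have "z [^] n \<in> J i \<and> (LEAST k :: nat. z [^] k \<in> J i) + i \<le> n" if "i \<le> m" for i
      using that
    proof (induction i)
      case 0
      then show ?case using I J(1) by (auto intro: Least_le)
    next
      case (Suc i)
      then have "z [^] n \<in> J i" "(LEAST k :: nat. z [^] k \<in> J i) + i \<le> n" by auto
      moreover have "J i \<subset> J (Suc i)" using J(4)[of i] Suc.prems by simp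
      moreover have "(LEAST k :: nat. z [^] k \<in> J (Suc i)) < (LEAST k :: nat. z [^] k \<in> J i)"
        by (rule drop[OF J(3) calculation(1) J(3) calculation(3)]) (use Suc.prems in auto)
      ultimately show ?case by auto
    qed
    from this[of m] show "m \<le> n" by simp
  qed
  then show ?thesis by (simp add: colength_def)
qed

lemma fun_ring_cring: "cring (fun_ring :: ('a \<Rightarrow> complex) ring)"
proof (rule cringI)
  show "abelian_group (fun_ring :: ('a \<Rightarrow> complex) ring)"
  proof (rule abelian_groupI)
    fix f :: "'a \<Rightarrow> complex"
    show "\<exists>g\<in>carrier fun_ring. g \<oplus>\<^bsub>fun_ring\<^esub> f = \<zero>\<^bsub>fun_ring\<^esub>"
      by (rule bexI[of _ "\<lambda>x. - f x"]) (auto simp: fun_ring_def)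
  qed (auto simp: fun_ring_def algebra_simps)
  show "comm_monoid (fun_ring :: ('a \<Rightarrow> complex) ring)"
    by (rule comm_monoidI) (auto simp: fun_ring_def algebra_simps)
qed (auto simp: fun_ring_def algebra_simps)

context variety
begin

lemma null_ideal_eq: "null_ideal X = {r. \<forall>\<^sub>F q in generic X. r q = 0}"
  by (simp add: null_ideal_def eventually_generic)

lemma null_ideal_ideal: "ideal (null_ideal X) fun_ring"
proof -
  interpret cring "fun_ring :: ('n ppoint \<Rightarrow> complex) ring" by (rule fun_ring_cring)
  show ?thesis
  proof (rule idealI)
    show "subgroup (null_ideal X) (add_monoid fun_ring)"
    proof (rule add.subgroupI)
      show "null_ideal X \<noteq> {}" unfolding null_ideal_eq by (auto intro: exI[of _ "\<lambda>_. 0"])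
      fix a assume a: "a \<in> null_ideal X"
      have "\<ominus>\<^bsub>fun_ring\<^esub> a = (\<lambda>x. - a x)"
        by (rule minus_equality) (auto simp: fun_ring_def)
      moreover have "\<forall>\<^sub>F q in generic X. - a q = 0"
        using a unfolding null_ideal_eq by simp
      ultimately show "\<ominus>\<^bsub>fun_ring\<^esub> a \<in> null_ideal X" unfolding null_ideal_eq by simp
      fix b assume b: "b \<in> null_ideal X"
      have "\<forall>\<^sub>F q in generic X. a q + b q = 0"
        using a b unfolding null_ideal_eq mem_Collect_eq by eventually_elim simp
      then show "a \<oplus>\<^bsub>fun_ring\<^esub> b \<in> null_ideal X" unfolding null_ideal_eq by (simp add: fun_ring_def)
    qed (simp add: fun_ring_def)
  next
    fix a x assume a: "a \<in> null_ideal X"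
    have "\<forall>\<^sub>F q in generic X. x q * a q = 0 \<and> a q * x q = 0"
      using a unfolding null_ideal_eq mem_Collect_eq by eventually_elim simp
    then show "x \<otimes>\<^bsub>fun_ring\<^esub> a \<in> null_ideal X" "a \<otimes>\<^bsub>fun_ring\<^esub> x \<in> null_ideal X"
      unfolding null_ideal_eq by (auto simp: fun_ring_def elim: eventually_mono)
  qed (rule ring_axioms)
qed

lemma rat_class_hom: "ring_hom_cring fun_ring (fun_ring Quot null_ideal X) (rat_class X)"
proof -
  have "rat_class X = (+>\<^bsub>fun_ring\<^esub>) (null_ideal X)" by (simp add: rat_class_def fun_eq_iff)
  then show ?thesis
    using ideal.rcos_ring_hom_cring[OF null_ideal_ideal fun_ring_cring] by simp
qed

lemma rat_class_eq: "rat_class X r = rat_class X r' \<longleftrightarrow> (\<forall>\<^sub>F q in generic X. r q = r' q)"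
proof -
  interpret I: ideal "null_ideal X" fun_ring by (rule null_ideal_ideal)
  have neg: "r \<ominus>\<^bsub>fun_ring\<^esub> r' = (\<lambda>x. r x - r' x)" for r r' :: "'n ppoint \<Rightarrow> complex"
  proof -
    have "\<ominus>\<^bsub>fun_ring\<^esub> r' = (\<lambda>x. - r' x)"
      by (rule I.minus_equality) (auto simp: fun_ring_def)
    then show ?thesis by (simp add: a_minus_def) (simp add: fun_ring_def)
  qed
  have "rat_class X r = rat_class X r' \<longleftrightarrow> r \<ominus>\<^bsub>fun_ring\<^esub> r' \<in> null_ideal X"
    unfolding rat_class_def
    using I.quotient_eq_iff_same_a_r_cos[OF null_ideal_ideal, of r r'] by (simp add: fun_ring_def)
  also have "\<dots> \<longleftrightarrow> (\<forall>\<^sub>F q in generic X. r q = r' q)"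
    unfolding neg null_ideal_eq by simp
  finally show ?thesis .
qed

text \<open>
  The function field and its local rings are both of this shape, which lets them share the
  proof that they are domains.
\<close>

definition fun_classes :: "('n ppoint \<Rightarrow> complex) set \<Rightarrow> ('n ppoint \<Rightarrow> complex) set ring" where
  "fun_classes K = (fun_ring Quot null_ideal X) \<lparr>carrier := rat_class X ` K\<rparr>"

lemma fun_classes_simps:
  "carrier (fun_classes K) = rat_class X ` K"
  "rat_class X r \<otimes>\<^bsub>fun_classes K\<^esub> rat_class X r' = rat_class X (\<lambda>q. r q * r' q)"
  "rat_class X r \<oplus>\<^bsub>fun_classes K\<^esub> rat_class X r' = rat_class X (\<lambda>q. r q + r' q)"
  "\<zero>\<^bsub>fun_classes K\<^esub> = rat_class X (\<lambda>_. 0)" "\<one>\<^bsub>fun_classes K\<^esub> = rat_class X (\<lambda>_. 1)"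
proof -
  interpret h: ring_hom_cring fun_ring "fun_ring Quot null_ideal X" "rat_class X"
    by (rule rat_class_hom)
  show "rat_class X r \<otimes>\<^bsub>fun_classes K\<^esub> rat_class X r' = rat_class X (\<lambda>q. r q * r' q)"
    using h.hom_mult[of r r'] by (simp add: fun_classes_def fun_ring_def)
  show "rat_class X r \<oplus>\<^bsub>fun_classes K\<^esub> rat_class X r' = rat_class X (\<lambda>q. r q + r' q)"
    using h.hom_add[of r r'] by (simp add: fun_classes_def fun_ring_def)
  show "\<zero>\<^bsub>fun_classes K\<^esub> = rat_class X (\<lambda>_. 0)" "\<one>\<^bsub>fun_classes K\<^esub> = rat_class X (\<lambda>_. 1)"
    using h.hom_zero h.hom_one by (simp_all add: fun_classes_def fun_ring_def)
qed (simp add: fun_classes_def)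

lemma fun_classes_domain:
  assumes rat: "\<And>r. r \<in> K \<Longrightarrow> rational X r"
    and const: "\<And>c. (\<lambda>_. c) \<in> K"
    and add: "\<And>r r'. r \<in> K \<Longrightarrow> r' \<in> K \<Longrightarrow> (\<lambda>q. r q + r' q) \<in> K"
    and mult: "\<And>r r'. r \<in> K \<Longrightarrow> r' \<in> K \<Longrightarrow> (\<lambda>q. r q * r' q) \<in> K"
  shows "domain (fun_classes K)"
proof -
  interpret h: ring_hom_cring fun_ring "fun_ring Quot null_ideal X" "rat_class X"
    by (rule rat_class_hom)
  have sub: "subring K fun_ring"
  proof (rule h.R.subringI)
    fix r assume r: "r \<in> K"
    have "\<ominus>\<^bsub>fun_ring\<^esub> r = (\<lambda>x. - r x)"
      by (rule h.R.minus_equality) (auto simp: fun_ring_def)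
    also have "\<dots> = (\<lambda>x. (-1) * r x)" by simp
    finally show "\<ominus>\<^bsub>fun_ring\<^esub> r \<in> K" using mult[OF const r] by metis
  qed (use const add mult in \<open>auto simp: fun_ring_def\<close>)
  have img: "subring (rat_class X ` K) (fun_ring Quot null_ideal X)"
    by (rule ring_hom_ring.img_is_subring[OF _ sub]) (rule ring_hom_ringI2[OF h.R.ring_axioms h.S.ring_axioms h.homh])
  interpret cring "fun_classes K"
    using h.S.subcringI'[OF img] h.S.subcring_iff[OF subringE(1)[OF img]]
    unfolding fun_classes_def by blast
  show ?thesis
  proof (rule domainI)
    show "\<one>\<^bsub>fun_classes K\<^esub> \<noteq> \<zero>\<^bsub>fun_classes K\<^esub>"
      by (simp add: fun_classes_simps rat_class_eq)
    fix a b assume ab: "a \<otimes>\<^bsub>fun_classes K\<^esub> b = \<zero>\<^bsub>fun_classes K\<^esub>"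
      "a \<in> carrier (fun_classes K)" "b \<in> carrier (fun_classes K)"
    then obtain r r' where r: "r \<in> K" "r' \<in> K" "a = rat_class X r" "b = rat_class X r'"
      by (auto simp: fun_classes_simps)
    have 0: "\<forall>\<^sub>F q in generic X. r q * r' q = 0"
      using ab r by (simp add: fun_classes_simps rat_class_eq)
    show "a = \<zero>\<^bsub>fun_classes K\<^esub> \<or> b = \<zero>\<^bsub>fun_classes K\<^esub>"
    proof (cases "\<forall>\<^sub>F q in generic X. r q = 0")
      case False
      then have "\<forall>\<^sub>F q in generic X. r q \<noteq> 0" using rational_dichotomy rat r by blast
      then have "\<forall>\<^sub>F q in generic X. r' q = 0" using 0 by eventually_elim auto
      then show ?thesis using r by (simp add: fun_classes_simps rat_class_eq)
    qed (use r in \<open>simp add: fun_classes_simps rat_class_eq\<close>)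
  qed (rule cring_axioms)
qed

lemma function_field_eq: "function_field X = fun_classes {r. rational X r}"
proof -
  have "{rat_class X (form_quotient F G) | d F G.
        form d F \<and> form d G \<and> (\<exists>p\<in>X. \<not> vanishes_at G p)} = rat_class X ` {r. rational X r}" (is "?A = ?B")
  proof
    show "?A \<subseteq> ?B"
    proof
      fix a assume "a \<in> ?A"
      then obtain d F G p where FG: "form d F" "form d G" "p \<in> X" "\<not> vanishes_at G p"
        and a: "a = rat_class X (form_quotient F G)" by blast
      have "rational X (form_quotient F G)"
        by (rule rationalI[OF FG(1-3)]) (use FG in_proj_space vanishes_at_rep in \<open>auto simp: form_quotient_rep\<close>)
      then show "a \<in> ?B" using a by blast
    qed
    show "?B \<subseteq> ?A"
    proof (rule image_subsetI, clarify)
      fix r assume "rational X r"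
      then obtain d F G p where FG: "form d F" "form d G" "p \<in> X" "G (rep p) \<noteq> 0"
        "\<forall>\<^sub>F q in generic X. r q = F (rep q) / G (rep q)" unfolding rational_def by blast
      then have "rat_class X r = rat_class X (form_quotient F G)" "\<not> vanishes_at G p"
        using in_proj_space vanishes_at_rep by (auto simp: rat_class_eq form_quotient_rep)
      then show "\<exists>d F G. rat_class X r = rat_class X (form_quotient F G) \<and>
        form d F \<and> form d G \<and> (\<exists>p\<in>X. \<not> vanishes_at G p)" using FG by blast
    qed
  qed
  then show ?thesis unfolding function_field_def fun_classes_def by simp
qed

lemma local_ring_eq:
  assumes "p \<in> X"
  shows "local_ring X p = fun_classes {r. \<exists>c. has_val X p r c}"
proof -
  have "{rat_class X (form_quotient F G) | d F G.
        form d F \<and> form d G \<and> \<not> vanishes_at G p} = rat_class X ` {r. \<exists>c. has_val X p r c}" (is "?A = ?B")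
  proof
    show "?A \<subseteq> ?B"
    proof
      fix a assume "a \<in> ?A"
      then obtain d F G where FG: "form d F" "form d G" "\<not> vanishes_at G p"
        and a: "a = rat_class X (form_quotient F G)" by blast
      have "has_val X p (form_quotient F G) (F (rep p) / G (rep p))"
        using has_val_form[OF FG(1,2), of p] FG(3) in_proj_space[OF assms] vanishes_at_rep[OF FG(2)]
        unfolding form_quotient_rep[abs_def] by blast
      then show "a \<in> ?B" using a by blast
    qed
    show "?B \<subseteq> ?A"
    proof (rule image_subsetI, clarify)
      fix r c assume "has_val X p r c"
      then obtain d F G where FG: "form d F" "form d G" "G (rep p) \<noteq> 0"
        "\<forall>\<^sub>F q in generic X. r q = F (rep q) / G (rep q)" unfolding has_val_def by blast
      then have "rat_class X r = rat_class X (form_quotient F G)" "\<not> vanishes_at G p"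
        using in_proj_space assms vanishes_at_rep by (auto simp: rat_class_eq form_quotient_rep)
      then show "\<exists>d F G. rat_class X r = rat_class X (form_quotient F G) \<and>
        form d F \<and> form d G \<and> \<not> vanishes_at G p" using FG by blast
    qed
  qed
  then show ?thesis unfolding local_ring_def function_field_def fun_classes_def by simp
qed

lemma function_field_domain: "domain (function_field X)"
  unfolding function_field_eq
  by (rule fun_classes_domain) (auto intro: rational_const rational_add rational_mult)

lemma local_ring_domain: "p \<in> X \<Longrightarrow> domain (local_ring X p)"
  unfolding local_ring_eq
  by (rule fun_classes_domain)
    (auto intro: has_val_rational has_val_const has_val_add has_val_mult)

end

definition unit_at :: "('n::finite) ppoint set \<Rightarrow> 'n ppoint \<Rightarrow> ('n ppoint \<Rightarrow> complex) \<Rightarrow> bool" where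
  "unit_at X p u \<longleftrightarrow> (\<exists>c. c \<noteq> 0 \<and> has_val X p u c)"

text \<open>
  The last clause is the unique factorisation in a discrete valuation ring, stated for the
  whole function field.
\<close>

definition uniformizer :: "('n::finite) ppoint set \<Rightarrow> 'n ppoint \<Rightarrow> ('n ppoint \<Rightarrow> complex) \<Rightarrow> bool" where
  "uniformizer X p z \<longleftrightarrow> has_val X p z 0 \<and> (\<forall>\<^sub>F q in generic X. z q \<noteq> 0) \<and>
     (\<forall>r. rational X r \<longrightarrow> (\<forall>\<^sub>F q in generic X. r q \<noteq> 0) \<longrightarrow>
        (\<exists>(k::int) u. unit_at X p u \<and> (\<forall>\<^sub>F q in generic X. r q = z q powi k * u q)))"

abbreviation vord :: "('n::finite) ppoint set \<Rightarrow> 'n ppoint \<Rightarrow> ('n ppoint \<Rightarrow> complex) \<Rightarrow> int" where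
  "vord X p r \<equiv> ord_at X p (rat_class X r)"

context variety
begin

lemma unit_at_mult: "unit_at X p u \<Longrightarrow> unit_at X p v \<Longrightarrow> unit_at X p (\<lambda>q. u q * v q)"
  unfolding unit_at_def using has_val_mult by (metis mult_eq_0_iff)

lemma unit_at_inverse: "unit_at X p u \<Longrightarrow> unit_at X p (\<lambda>q. inverse (u q))"
  unfolding unit_at_def using has_val_inverse by (metis inverse_nonzero_iff_nonzero)

lemma unit_at_divide: "unit_at X p u \<Longrightarrow> unit_at X p v \<Longrightarrow> unit_at X p (\<lambda>q. u q / v q)"
  using unit_at_mult[OF _ unit_at_inverse] by (simp add: divide_inverse)

lemma unit_at_power: "unit_at X p u \<Longrightarrow> unit_at X p (\<lambda>q. u q ^ n)"
  unfolding unit_at_def using has_val_power by (metis power_not_zero)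

lemma unit_at_powi: "unit_at X p u \<Longrightarrow> unit_at X p (\<lambda>q. u q powi n)"
  by (cases "n \<ge> 0") (auto simp: power_int_def intro: unit_at_power unit_at_inverse)

lemma unit_at_nonzero: "unit_at X p u \<Longrightarrow> p \<in> X \<Longrightarrow> \<forall>\<^sub>F q in generic X. u q \<noteq> 0"
  unfolding unit_at_def using has_val_generic_nonzero by blast

text \<open>
  Cancelling the smaller power would make a unit equal to an element with residue zero.
\<close>

lemma powi_times_unit_unique:
  assumes p: "p \<in> X" and z: "has_val X p z 0" "\<forall>\<^sub>F q in generic X. z q \<noteq> 0"
    and u: "unit_at X p u" "unit_at X p v"
    and eq: "\<forall>\<^sub>F q in generic X. z q powi m * u q = z q powi n * v q"
  shows "m = n"
proof -
  have aux: "\<not> m < n" if u: "unit_at X p u" "unit_at X p v"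
    and eq: "\<forall>\<^sub>F q in generic X. z q powi m * u q = z q powi n * v q" for m n :: int and u v
  proof
    assume "m < n"
    then obtain k where k: "n = m + int (Suc k)" by (metis zless_iff_Suc_zadd)
    obtain c d where c: "has_val X p u c" "c \<noteq> 0" and d: "has_val X p v d"
      using u unfolding unit_at_def by blast
    have "has_val X p (\<lambda>q. z q ^ Suc k * v q) 0"
      using has_val_mult[OF has_val_power[OF z(1), of "Suc k"] d] by simp
    moreover have "\<forall>\<^sub>F q in generic X. u q = z q ^ Suc k * v q"
      using eq z(2)
    proof eventually_elim
      case (elim q)
      have "z q powi n = z q powi m * z q ^ Suc k"
        using elim(2) unfolding k by (subst power_int_add) (simp, simp only: power_int_of_nat)
      then show ?case using elim by (simp add: power_int_eq_0_iff)
    qed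
    ultimately have "has_val X p u 0" by (rule has_val_cong)
    then show False using has_val_unique c p by blast
  qed
  have "\<not> m < n" using aux u eq by blast
  moreover have "\<not> n < m" 
    by (rule aux[OF u(2,1)]) (use eq in eventually_elim, simp)
  ultimately show ?thesis by simp
qed

text \<open>
  Lengths of quotients by powers of a uniformizer are the exponents, so the difference of lengths
  in the definition of the order recovers the exponent, whichever fraction is used.
\<close>

lemma vord_eq:
  assumes z: "uniformizer X p z" and p: "p \<in> X" and u: "unit_at X p u"
    and r: "\<forall>\<^sub>F q in generic X. r q = z q powi n * u q"
  shows "vord X p r = n"
proof -
  let ?R = "local_ring X p" and ?c = "rat_class X"
  interpret domain ?R using local_ring_domain[OF p] .
  note R = local_ring_eq[OF p]
  have z0: "has_val X p z 0" and znz: "\<forall>\<^sub>F q in generic X. z q \<noteq> 0" using z by (auto simp: uniformizer_def)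
  have zR: "?c z \<in> carrier ?R" unfolding R fun_classes_simps using z0 by blast
  have pow: "?c z [^]\<^bsub>?R\<^esub> k = ?c (\<lambda>q. z q ^ k)" for k :: nat
    by (induction k) (auto simp: R fun_classes_simps mult.commute)
  have unit: "?c v \<in> Units ?R" if v: "unit_at X p v" for v
  proof -
    have "\<forall>\<^sub>F q in generic X. v q * inverse (v q) = 1"
      using unit_at_nonzero[OF v p] by eventually_elim simp
    then have "?c v \<otimes>\<^bsub>?R\<^esub> ?c (\<lambda>q. inverse (v q)) = \<one>\<^bsub>?R\<^esub>"
      unfolding R fun_classes_simps rat_class_eq .
    moreover have "?c v \<in> carrier ?R" "?c (\<lambda>q. inverse (v q)) \<in> carrier ?R"
      using v unit_at_inverse[OF v] unfolding R fun_classes_simps unit_at_def by blast+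
    ultimately show ?thesis
      unfolding Units_def using m_comm[of "?c v" "?c (\<lambda>q. inverse (v q))"]
      by (intro CollectI conjI bexI[of _ "?c (\<lambda>q. inverse (v q))"]) auto
  qed
  have znu: "?c z \<notin> Units ?R"
  proof
    assume "?c z \<in> Units ?R"
    then obtain b where "b \<in> carrier ?R" "?c z \<otimes>\<^bsub>?R\<^esub> b = \<one>\<^bsub>?R\<^esub>" unfolding Units_def using m_comm by auto
    then obtain s d where s: "has_val X p s d" "\<forall>\<^sub>F q in generic X. z q * s q = 1"
      unfolding R by (auto simp: fun_classes_simps rat_class_eq)
    have "has_val X p (\<lambda>_. 1) (0 * d)"
      by (rule has_val_cong[OF has_val_mult[OF z0 s(1)]]) (use s(2) in eventually_elim, simp)
    then show False using has_val_unique[OF _ has_val_const p] by fastforce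
  qed
  have znz': "?c z \<noteq> \<zero>\<^bsub>?R\<^esub>"
    using generic_zero_nonzero_False[OF znz] unfolding R fun_classes_simps rat_class_eq by blast
  have regular: "\<exists>k::nat. \<exists>v. unit_at X p v \<and> (\<forall>\<^sub>F q in generic X. a q = z q ^ k * v q)"
    if a: "has_val X p a c" "?c a \<noteq> \<zero>\<^bsub>?R\<^esub>" for a c
  proof -
    have anz: "\<forall>\<^sub>F q in generic X. a q \<noteq> 0"
      using rational_dichotomy[OF has_val_rational[OF a(1) p]] a(2)
      unfolding R fun_classes_simps rat_class_eq by blast
    then obtain k v where kv: "unit_at X p v" "\<forall>\<^sub>F q in generic X. a q = z q powi k * v q"
      using z has_val_rational[OF a(1) p] unfolding uniformizer_def by blast
    have "k \<ge> 0"
    proof (rule ccontr)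
      assume "\<not> k \<ge> 0"
      then obtain m where m: "k = - int (Suc m)" by (metis negD not_le)
      have "has_val X p v (0 * c)"
        by (rule has_val_cong[OF has_val_mult[OF _ a(1)], of "\<lambda>q. z q ^ Suc m"])
          (use has_val_power[OF z0, of "Suc m"] in simp,
           use kv(2) znz in \<open>eventually_elim\<close>, simp add: m power_int_minus del: power_Suc of_nat_Suc)
      then show False using kv(1) has_val_unique p unfolding unit_at_def by fastforce
    qed
    then show ?thesis
      using kv by (intro exI[of _ "nat k"] exI[of _ v]) (auto simp: power_int_def)
  qed
  have gen: "\<exists>k::nat. \<exists>v\<in>Units ?R. a = ?c z [^]\<^bsub>?R\<^esub> k \<otimes>\<^bsub>?R\<^esub> v" if a: "a \<in> carrier ?R - {\<zero>\<^bsub>?R\<^esub>}" for a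
  proof -
    obtain s d where s: "has_val X p s d" "a = ?c s" using a unfolding R fun_classes_simps by blast
    then obtain k v where "unit_at X p v" "\<forall>\<^sub>F q in generic X. s q = z q ^ k * v q"
      using regular a by blast
    then show ?thesis
      unfolding s(2) pow by (intro exI[of _ k] bexI[of _ "?c v"]) (auto simp: R fun_classes_simps rat_class_eq unit[unfolded R])
  qed
  have colen: "colength ?R (PIdl\<^bsub>?R\<^esub> (?c a)) = k"
    if "unit_at X p v" "\<forall>\<^sub>F q in generic X. a q = z q ^ k * v q" for a v k
  proof -
    have "?c a = ?c z [^]\<^bsub>?R\<^esub> k \<otimes>\<^bsub>?R\<^esub> ?c v"
      unfolding pow using that by (simp add: R fun_classes_simps rat_class_eq)
    then show ?thesis using colength_uniformizer_power[OF zR znu znz' gen unit] that by simp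
  qed
  show ?thesis
    unfolding ord_at_def
  proof (rule the_equality, goal_cases)
    case 1
    define i j where "i = nat n" and "j = nat (- n)"
    have ij: "n = int i - int j" by (simp add: i_def j_def)
    have one: "unit_at X p (\<lambda>_. 1)" unfolding unit_at_def by (intro exI[of _ 1] conjI has_val_const) simp
    have val: "has_val X p (\<lambda>q. z q ^ k * v q) (0 ^ k * c)" if "has_val X p v c" for k v c
      using has_val_mult[OF has_val_power[OF z0] that] .
    have nz: "?c (\<lambda>q. z q ^ k * v q) \<in> carrier ?R - {\<zero>\<^bsub>?R\<^esub>}" if v: "unit_at X p v" for k v
    proof -
      have "\<forall>\<^sub>F q in generic X. z q ^ k * v q \<noteq> 0"
        using znz unit_at_nonzero[OF v p] by eventually_elim simp
      then have "?c (\<lambda>q. z q ^ k * v q) \<noteq> \<zero>\<^bsub>?R\<^esub>"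
        unfolding R fun_classes_simps rat_class_eq
        using generic_zero_nonzero_False[of "\<lambda>q. z q ^ k * v q"] by blast
      moreover have "?c (\<lambda>q. z q ^ k * v q) \<in> carrier ?R"
      proof -
        obtain c where "has_val X p v c" using v unfolding unit_at_def by blast
        from val[OF this] show ?thesis unfolding R fun_classes_simps by (intro imageI CollectI exI)
      qed
      ultimately show ?thesis by blast
    qed
    have "rat_class X r \<otimes>\<^bsub>function_field X\<^esub> ?c (\<lambda>q. z q ^ j * 1) = ?c (\<lambda>q. z q ^ i * u q)"
      unfolding function_field_eq fun_classes_simps rat_class_eq
      using r znz
    proof eventually_elim
      case (elim q)
      have "z q powi n * z q ^ j = z q powi (n + int j)"
        using elim(2) by (subst power_int_add) auto
      also have "\<dots> = z q ^ i" by (simp add: ij)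
      finally have "z q powi n * z q ^ j = z q ^ i" .
      moreover have "r q * (z q ^ j * 1) = (z q powi n * z q ^ j) * u q"
        unfolding elim(1) by (simp only: mult_ac mult_1_left mult_1_right)
      ultimately show ?case by simp
    qed
    moreover have "n = int (colength ?R (PIdl\<^bsub>?R\<^esub> (?c (\<lambda>q. z q ^ i * u q))))
       - int (colength ?R (PIdl\<^bsub>?R\<^esub> (?c (\<lambda>q. z q ^ j * 1))))"
      using colen[OF u, of "\<lambda>q. z q ^ i * u q" i] colen[OF one, of "\<lambda>q. z q ^ j * 1" j]
      unfolding ij by simp
    ultimately show ?case
      using nz[OF u, of i] nz[OF one, of j] by blast
  next
    case (2 m)
    then obtain a b where ab: "a \<in> carrier ?R - {\<zero>\<^bsub>?R\<^esub>}" "b \<in> carrier ?R - {\<zero>\<^bsub>?R\<^esub>}"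
      "rat_class X r \<otimes>\<^bsub>function_field X\<^esub> b = a"
      "m = int (colength ?R (PIdl\<^bsub>?R\<^esub> a)) - int (colength ?R (PIdl\<^bsub>?R\<^esub> b))" by blast
    obtain a' b' ca cb where a': "has_val X p a' ca" "a = ?c a'" and b': "has_val X p b' cb" "b = ?c b'"
      using ab(1,2) unfolding R fun_classes_simps by blast
    obtain i v where iv: "unit_at X p v" "\<forall>\<^sub>F q in generic X. a' q = z q ^ i * v q"
      using regular a' ab by blast
    obtain j v' where jv: "unit_at X p v'" "\<forall>\<^sub>F q in generic X. b' q = z q ^ j * v' q"
      using regular b' ab by blast
    have "\<forall>\<^sub>F q in generic X. r q * b' q = a' q"
      using ab(3) unfolding function_field_eq a' b' fun_classes_simps rat_class_eq .
    then have "\<forall>\<^sub>F q in generic X. z q powi (n + int j) * (u q * v' q) = z q powi (int i) * v q"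
      using r iv(2) jv(2) znz
    proof eventually_elim
      case (elim q)
      have "z q powi (n + int j) = z q powi n * z q ^ j"
        using elim(5) by (subst power_int_add) auto
      then have "z q powi (n + int j) * (u q * v' q) = r q * b' q"
        unfolding elim(2,4) by (simp only: mult_ac)
      then show ?case unfolding elim(1,3) by simp
    qed
    then have "n + int j = int i"
      using powi_times_unit_unique[OF p z0 znz unit_at_mult[OF u jv(1)] iv(1)] by blast
    then show ?case using ab(4) colen[OF iv] colen[OF jv] a' b' by simp
  qed
qed

lemma vord_decomp:
  assumes z: "uniformizer X p z" and p: "p \<in> X"
    and r: "rational X r" "\<forall>\<^sub>F q in generic X. r q \<noteq> 0"
  obtains u where "unit_at X p u" "\<forall>\<^sub>F q in generic X. r q = z q powi (vord X p r) * u q"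
proof -
  obtain k u where ku: "unit_at X p u" "\<forall>\<^sub>F q in generic X. r q = z q powi k * u q"
    using z r unfolding uniformizer_def by blast
  show ?thesis by (rule that[OF ku(1)]) (use ku(2) vord_eq[OF z p ku] in simp)
qed

lemma vord_cong: "\<forall>\<^sub>F q in generic X. r q = r' q \<Longrightarrow> vord X p r = vord X p r'"
  using rat_class_eq by metis

end

section \<open>Morphisms and isomorphisms\<close>

text \<open>
  The tuple \<open>\<Phi>\<close> describes \<open>f\<close> wherever its members have no common zero, in terms of
  representing vectors.
\<close>

definition represents ::
  "('n::finite) ppoint set \<Rightarrow> ('n ppoint \<Rightarrow> ('m::finite) ppoint) \<Rightarrow> nat \<Rightarrow>
   ('m \<Rightarrow> complex ^ 'n \<Rightarrow> complex) \<Rightarrow> bool" where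
  "represents X f e \<Phi> \<longleftrightarrow> (\<forall>j. form e (\<Phi> j)) \<and>
     (\<forall>q\<in>X. (\<chi> j. \<Phi> j (rep q)) \<noteq> 0 \<longrightarrow> f q = vec.span {\<chi> j. \<Phi> j (rep q)})"

lemma span_image_point:
  assumes "\<And>j. form e (\<Phi> j)" "q \<in> proj_space"
  shows "vec.span ((\<lambda>u. \<chi> j. \<Phi> j u) ` q) = vec.span {\<chi> j. \<Phi> j (rep q)}"
  unfolding vec.span_eq
proof
  have "(\<chi> j. \<Phi> j (c *s rep q)) = c ^ e *s (\<chi> j. \<Phi> j (rep q))" for c
    using form_scale[OF assms(1)] by (simp add: vec_eq_iff)
  moreover have "c ^ e *s (\<chi> j. \<Phi> j (rep q)) \<in> vec.span {\<chi> j. \<Phi> j (rep q)}" for c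
    by (rule vec.span_scale[OF vec.span_base]) simp
  ultimately show "(\<lambda>u. \<chi> j. \<Phi> j u) ` q \<subseteq> vec.span {\<chi> j. \<Phi> j (rep q)}"
    using mem_point[OF assms(2)] by auto
  show "{\<chi> j. \<Phi> j (rep q)} \<subseteq> vec.span ((\<lambda>u. \<chi> j. \<Phi> j u) ` q)"
    using rep_props(1)[OF assms(2)] by (auto intro: vec.span_base)
qed

lemma vanishes_all_iff:
  assumes "\<And>j. form e (\<Phi> j)" "q \<in> proj_space"
  shows "(\<exists>j. \<not> vanishes_at (\<Phi> j) q) \<longleftrightarrow> (\<chi> j. \<Phi> j (rep q)) \<noteq> 0"
  using vanishes_at_rep[OF assms(1) assms(2)] by (simp add: vec_eq_iff)

lemma morphism_iff:
  assumes "X \<subseteq> proj_space"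
  shows "morphism X Y f \<longleftrightarrow> f ` X \<subseteq> Y \<and>
    (\<forall>p\<in>X. \<exists>e \<Phi>. represents X f e \<Phi> \<and> (\<chi> j. \<Phi> j (rep p)) \<noteq> 0)"
proof -
  have *: "(\<forall>j. form e (\<Phi> j)) \<and> (\<exists>j. \<not> vanishes_at (\<Phi> j) p) \<and>
        (\<forall>q\<in>X. (\<exists>j. \<not> vanishes_at (\<Phi> j) q) \<longrightarrow> f q = vec.span ((\<lambda>u. \<chi> j. \<Phi> j u) ` q))
      \<longleftrightarrow> represents X f e \<Phi> \<and> (\<chi> j. \<Phi> j (rep p)) \<noteq> 0" if p: "p \<in> X" for e \<Phi> p
  proof (cases "\<forall>j. form e (\<Phi> j)")
    case True
    then have form: "form e (\<Phi> j)" for j by blast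
    have A: "(\<exists>j. \<not> vanishes_at (\<Phi> j) q) \<longleftrightarrow> (\<chi> j. \<Phi> j (rep q)) \<noteq> 0" if "q \<in> X" for q
      by (rule vanishes_all_iff[OF form]) (use that assms in blast)
    have B: "vec.span ((\<lambda>u. \<chi> j. \<Phi> j u) ` q) = vec.span {\<chi> j. \<Phi> j (rep q)}" if "q \<in> X" for q
      by (rule span_image_point[OF form]) (use that assms in blast)
    have "(\<forall>q\<in>X. (\<exists>j. \<not> vanishes_at (\<Phi> j) q) \<longrightarrow> f q = vec.span ((\<lambda>u. \<chi> j. \<Phi> j u) ` q)) \<longleftrightarrow>
        (\<forall>q\<in>X. (\<chi> j. \<Phi> j (rep q)) \<noteq> 0 \<longrightarrow> f q = vec.span {\<chi> j. \<Phi> j (rep q)})"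
      by (intro ball_cong refl) (simp only: A B)
    note LR = this
    show ?thesis
      unfolding represents_def A[OF p] LR by (rule iffI; elim conjE; intro conjI; assumption)
  next
    case False
    then show ?thesis by (simp only: represents_def simp_thms)
  qed
  have "(\<forall>p\<in>X. \<exists>e \<Phi>. (\<forall>j. form e (\<Phi> j)) \<and> (\<exists>j. \<not> vanishes_at (\<Phi> j) p) \<and>
        (\<forall>q\<in>X. (\<exists>j. \<not> vanishes_at (\<Phi> j) q) \<longrightarrow> f q = vec.span ((\<lambda>u. \<chi> j. \<Phi> j u) ` q))) \<longleftrightarrow>
     (\<forall>p\<in>X. \<exists>e \<Phi>. represents X f e \<Phi> \<and> (\<chi> j. \<Phi> j (rep p)) \<noteq> 0)"
    by (intro ball_cong refl) (simp only: *)
  then show ?thesis unfolding morphism_def by simp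
qed

lemma morphism_in_proj_space:
  assumes "X \<subseteq> proj_space" "morphism X Y f" "p \<in> X"
  shows "f p \<in> proj_space"
  using assms span_in_proj_space unfolding morphism_iff[OF assms(1)] represents_def by metis

lemma morphism_preimage_closed:
  assumes X: "proj_closed X" and f: "morphism X Y f" and Z: "proj_closed Z"
  shows "proj_closed {p \<in> X. f p \<in> Z}"
proof -
  obtain S where S: "\<And>F. F \<in> S \<Longrightarrow> \<exists>d. form d F"
    "\<And>p. p \<in> X \<longleftrightarrow> p \<in> proj_space \<and> (\<forall>F\<in>S. F (rep p) = 0)" by (rule proj_closedE[OF X]) blast
  obtain T where T: "\<And>F. F \<in> T \<Longrightarrow> \<exists>d. form d F"
    "\<And>p. p \<in> Z \<longleftrightarrow> p \<in> proj_space \<and> (\<forall>F\<in>T. F (rep p) = 0)" by (rule proj_closedE[OF Z]) blast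
  have sub: "X \<subseteq> proj_space" using X by (rule proj_closed_subset)
  let ?R = "{\<lambda>u. G (\<chi> j. \<Phi> j u) | G \<Phi>. G \<in> T \<and> (\<exists>e. represents X f e \<Phi>)}"
  show ?thesis
  proof (rule proj_closedI[of "S \<union> ?R"])
    fix F assume "F \<in> S \<union> ?R"
    then show "\<exists>d. form d F"
    proof
      assume "F \<in> ?R"
      then obtain G \<Phi> e where "G \<in> T" "represents X f e \<Phi>" "F = (\<lambda>u. G (\<chi> j. \<Phi> j u))" by blast
      then show ?thesis using T(1)[of G] form_compose unfolding represents_def by blast
    qed (use S in auto)
  next
    fix p
    show "p \<in> {p \<in> X. f p \<in> Z} \<longleftrightarrow> p \<in> proj_space \<and> (\<forall>F\<in>S \<union> ?R. F (rep p) = 0)"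
    proof (cases "p \<in> X")
      case True
      have val: "G (rep (f p)) = 0 \<longleftrightarrow> G (\<chi> j. \<Phi> j (rep p)) = 0"
        if G: "G \<in> T" and \<Phi>: "represents X f e \<Phi>" "(\<chi> j. \<Phi> j (rep p)) \<noteq> 0" for G e \<Phi>
      proof -
        have fp: "f p = vec.span {\<chi> j. \<Phi> j (rep p)}" using \<Phi> True unfolding represents_def by blast
        obtain d where "form d G" using T(1)[OF G] by blast
        then show ?thesis unfolding fp by (rule form_span_eq_0[OF _ \<Phi>(2)])
      qed
      have val0: "G (\<chi> j. \<Phi> j (rep p)) = 0"
        if G: "G \<in> T" "G (rep (f p)) = 0" and 0: "(\<chi> j. \<Phi> j (rep p)) = 0" for G \<Phi>
      proof -
        obtain d where "form d G" using T(1) G by blast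
        then show ?thesis
          using form_at_0[of d G] form_0_const[of G 0 "rep (f p)"] G 0 by (cases "d = 0") auto
      qed
      obtain e \<Phi> where rp: "represents X f e \<Phi>" "(\<chi> j. \<Phi> j (rep p)) \<noteq> 0"
        using f True unfolding morphism_iff[OF sub] by blast
      have "f p \<in> Z \<longleftrightarrow> (\<forall>F\<in>?R. F (rep p) = 0)"
      proof
        assume *: "f p \<in> Z"
        show "\<forall>F\<in>?R. F (rep p) = 0"
        proof
          fix F assume "F \<in> ?R"
          then obtain G \<Psi> e' where F: "G \<in> T" "represents X f e' \<Psi>" "F = (\<lambda>u. G (\<chi> j. \<Psi> j u))" by blast
          have "G (rep (f p)) = 0" using * T(2)[of "f p"] F(1) by blast
          then have "G (\<chi> j. \<Psi> j (rep p)) = 0"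
            using val[OF F(1,2)] val0[OF F(1), of \<Psi>] by blast
          then show "F (rep p) = 0" unfolding F(3) .
        qed
      next
        assume *: "\<forall>F\<in>?R. F (rep p) = 0"
        have "G (rep (f p)) = 0" if G: "G \<in> T" for G
        proof -
          have "(\<lambda>u. G (\<chi> j. \<Phi> j u)) \<in> ?R" using G rp(1) by blast
          from bspec[OF * this] have "G (\<chi> j. \<Phi> j (rep p)) = 0" .
          then show ?thesis using val[OF G rp] by blast
        qed
        then show "f p \<in> Z" using T(2)[of "f p"] morphism_in_proj_space[OF sub f True] by blast
      qed
      then show ?thesis using True S(2)[of p] by (simp only: ball_Un mem_Collect_eq simp_thms)
    next
      case False
      then show ?thesis using S(2)[of p] by (simp only: ball_Un mem_Collect_eq simp_thms) simp
    qed
  qed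
qed

text \<open>
  The preimage of a proper closed subset is closed, and it is proper because the map is onto.
\<close>

lemma (in variety) generic_surj:
  assumes f: "morphism X Y f" "f ` X = Y" and Y: "proj_variety Y"
    and P: "eventually P (generic Y)"
  shows "\<forall>\<^sub>F p in generic X. P (f p)"
proof -
  interpret Y: variety Y by standard (rule Y)
  obtain Z where Z: "proj_closed Z" "\<not> Y \<subseteq> Z" "\<forall>p\<in>Y - Z. P p"
    using P unfolding Y.eventually_generic by blast
  show ?thesis
    unfolding eventually_generic
    by (rule exI[of _ "{p \<in> X. f p \<in> Z}"])
      (use Z f(2) morphism_preimage_closed[OF closed f(1) Z(1)] in auto)
qed

lemma (in variety) has_val_form_compose:
  assumes f: "morphism X Y f" and p: "p \<in> X"
    and FG: "form d F" "form d G" "G (rep (f p)) \<noteq> 0"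
  shows "has_val X p (\<lambda>q. F (rep (f q)) / G (rep (f q))) (F (rep (f p)) / G (rep (f p)))"
proof -
  have sub: "X \<subseteq> proj_space" using closed by (rule proj_closed_subset)
  obtain e \<Phi> where rp: "represents X f e \<Phi>" "(\<chi> j. \<Phi> j (rep p)) \<noteq> 0"
    using f p unfolding morphism_iff[OF sub] by blast
  then have \<Phi>: "\<And>j. form e (\<Phi> j)" by (auto simp: represents_def)
  have quot: "F (rep (f q)) / G (rep (f q)) = F (\<chi> j. \<Phi> j (rep q)) / G (\<chi> j. \<Phi> j (rep q))"
    if "q \<in> X" "(\<chi> j. \<Phi> j (rep q)) \<noteq> 0" for q
    using rp(1) that form_quotient_span[OF FG(1,2), of "\<chi> j. \<Phi> j (rep q)"]
    unfolding represents_def form_quotient_rep by auto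
  have G0: "G (\<chi> j. \<Phi> j (rep p)) \<noteq> 0"
    using form_span_eq_0[OF FG(2) rp(2)] FG(3) rp p unfolding represents_def by auto
  obtain j where "\<Phi> j (rep p) \<noteq> 0" using rp(2) by (auto simp: vec_eq_iff)
  from generic_form_nonzero[OF \<Phi> p this] generic_mem
  have ev: "\<forall>\<^sub>F q in generic X. F (rep (f q)) / G (rep (f q)) = F (\<chi> j. \<Phi> j (rep q)) / G (\<chi> j. \<Phi> j (rep q))"
  proof eventually_elim
    case (elim q)
    then have "(\<chi> j. \<Phi> j (rep q)) \<noteq> 0" by (auto simp: vec_eq_iff)
    then show ?case using quot elim by blast
  qed
  show ?thesis
    unfolding quot[OF p rp(2)]
    by (rule has_val_cong[OF has_val_form[OF form_compose[OF FG(1) \<Phi>] form_compose[OF FG(2) \<Phi>] G0] ev])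
qed

lemma (in variety) has_val_compose:
  assumes f: "morphism X Y f" "f ` X = Y" and Y: "proj_variety Y" and p: "p \<in> X"
    and r: "has_val Y (f p) r c"
  shows "has_val X p (\<lambda>q. r (f q)) c"
proof -
  obtain d F G where 1: "form d F" "form d G" "G (rep (f p)) \<noteq> 0" "F (rep (f p)) = c * G (rep (f p))"
    "\<forall>\<^sub>F q in generic Y. r q = F (rep q) / G (rep q)"
    using r unfolding has_val_def by blast
  have "has_val X p (\<lambda>q. F (rep (f q)) / G (rep (f q))) c"
    using has_val_form_compose[OF f(1) p 1(1-3)] 1(3,4) by simp
  then show ?thesis
    by (rule has_val_cong) (rule generic_surj[OF f Y 1(5)])
qed

lemma (in variety) rational_compose:
  assumes f: "morphism X Y f" "f ` X = Y" and Y: "proj_variety Y" and r: "rational Y r"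
  shows "rational X (\<lambda>q. r (f q))"
proof -
  obtain d F G p where 1: "form d F" "form d G" "p \<in> Y" "G (rep p) \<noteq> 0"
    "\<forall>\<^sub>F q in generic Y. r q = F (rep q) / G (rep q)"
    using r unfolding rational_def by blast
  then obtain p' where p': "p' \<in> X" "p = f p'" using f(2) by blast
  have "has_val Y p r (F (rep p) / G (rep p))"
    by (rule has_val_cong[OF has_val_form[OF 1(1,2,4)] 1(5)])
  then show ?thesis
    using has_val_rational[OF has_val_compose[OF f Y p'(1)] p'(1)] p'(2) by blast
qed

text \<open>
  Isomorphisms are needed before the target is known to be irreducible: that, and its
  dimension, are transported from the source.
\<close>

locale closed_iso =
  fixes X :: "('n::finite) ppoint set" and Y :: "('m::finite) ppoint set" and \<phi> \<psi>
  assumes closed_X: "proj_closed X" and closed_Y: "proj_closed Y"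
    and morph: "morphism X Y \<phi>" "morphism Y X \<psi>"
    and inverse: "\<And>p. p \<in> X \<Longrightarrow> \<psi> (\<phi> p) = p" "\<And>q. q \<in> Y \<Longrightarrow> \<phi> (\<psi> q) = q"
begin

lemma flip: "closed_iso Y X \<psi> \<phi>"
  by standard (use closed_X closed_Y morph inverse in auto)

lemma maps: "\<phi> ` X = Y" "\<psi> ` Y = X"
proof -
  have sub: "\<phi> ` X \<subseteq> Y" "\<psi> ` Y \<subseteq> X" using morph unfolding morphism_def by blast+
  show "\<phi> ` X = Y"
  proof (rule subset_antisym[OF sub(1)], rule subsetI)
    fix q assume q: "q \<in> Y"
    then have "\<psi> q \<in> X" using sub(2) by blast
    then show "q \<in> \<phi> ` X" using imageI[of "\<psi> q" X \<phi>] inverse(2)[OF q] by simp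
  qed
  show "\<psi> ` Y = X"
  proof (rule subset_antisym[OF sub(2)], rule subsetI)
    fix p assume p: "p \<in> X"
    then have "\<phi> p \<in> Y" using sub(1) by blast
    then show "p \<in> \<psi> ` Y" using imageI[of "\<phi> p" Y \<psi>] inverse(1)[OF p] by simp
  qed
qed

lemma image_closed:
  assumes "proj_closed Z" "Z \<subseteq> X"
  shows "proj_closed (\<phi> ` Z)"
proof -
  have "\<phi> ` Z = {q \<in> Y. \<psi> q \<in> Z}"
  proof (intro subset_antisym subsetI)
    fix q assume "q \<in> \<phi> ` Z"
    then show "q \<in> {q \<in> Y. \<psi> q \<in> Z}" using assms(2) maps inverse(1) by auto
  next
    fix q assume "q \<in> {q \<in> Y. \<psi> q \<in> Z}"
    then show "q \<in> \<phi> ` Z" using imageI[of "\<psi> q" Z \<phi>] inverse(2)[of q] by simp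
  qed
  then show ?thesis using morphism_preimage_closed[OF closed_Y morph(2) assms(1)] by simp
qed

lemma image_variety:
  assumes "proj_variety Z" "Z \<subseteq> X"
  shows "proj_variety (\<phi> ` Z)"
  unfolding proj_variety_def
proof (intro conjI allI impI)
  show "proj_closed (\<phi> ` Z)" "\<phi> ` Z \<noteq> {}"
    using assms image_closed by (auto simp: proj_variety_def)
  fix A B assume AB: "proj_closed A" "proj_closed B" "\<phi> ` Z \<subseteq> A \<union> B"
  have "Z \<subseteq> {p \<in> X. \<phi> p \<in> A} \<or> Z \<subseteq> {p \<in> X. \<phi> p \<in> B}"
    using AB assms morphism_preimage_closed[OF closed_X morph(1)]
    by (intro variety.irreducible[unfolded variety_def]) auto
  then show "\<phi> ` Z \<subseteq> A \<or> \<phi> ` Z \<subseteq> B" by blast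
qed

lemma image_chain:
  assumes "\<forall>i\<le>n. proj_variety (Z i) \<and> Z i \<subseteq> X" "\<forall>i<n. Z i \<subset> Z (Suc i)"
  shows "\<exists>Z'. (\<forall>i\<le>n. proj_variety (Z' i) \<and> Z' i \<subseteq> Y) \<and> (\<forall>i<n. Z' i \<subset> Z' (Suc i))"
proof (intro exI[of _ "\<lambda>i. \<phi> ` Z i"] conjI allI impI)
  have inj: "inj_on \<phi> X" using inverse(1) by (metis inj_onI)
  fix i
  show "i \<le> n \<Longrightarrow> proj_variety (\<phi> ` Z i)" "i \<le> n \<Longrightarrow> \<phi> ` Z i \<subseteq> Y"
    using assms image_variety maps by auto
  assume i: "i < n"
  then have "Z i \<subset> Z (Suc i)" "Z (Suc i) \<subseteq> X" using assms by auto
  then show "\<phi> ` Z i \<subset> \<phi> ` Z (Suc i)"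
    using inj_on_image_eq_iff[OF inj, of "Z i" "Z (Suc i)"] by blast
qed

lemma zdim_eq: "zdim X = zdim Y"
proof -
  interpret flip: closed_iso Y X \<psi> \<phi> by (rule flip)
  have "(\<exists>Z. (\<forall>i\<le>n. proj_variety (Z i) \<and> Z i \<subseteq> X) \<and> (\<forall>i<n. Z i \<subset> Z (Suc i))) \<longleftrightarrow>
      (\<exists>Z. (\<forall>i\<le>n. proj_variety (Z i) \<and> Z i \<subseteq> Y) \<and> (\<forall>i<n. Z i \<subset> Z (Suc i)))" for n
    by (intro iffI; elim exE conjE; intro image_chain flip.image_chain)
  then show ?thesis unfolding zdim_def by simp
qed

lemma proj_curve_image: "proj_curve X \<Longrightarrow> proj_curve Y"
  unfolding proj_curve_def using image_variety[of X] maps(1) zdim_eq by simp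

end

locale variety_iso = closed_iso + X: variety X + Y: variety Y
begin

text \<open>
  Composition with the two inverse morphisms identifies the local rings.
\<close>

lemma uniformizer_transport:
  assumes p: "p \<in> X" and z: "uniformizer X p z"
  shows "uniformizer Y (\<phi> p) (\<lambda>q. z (\<psi> q))"
  unfolding uniformizer_def
proof (intro conjI allI impI)
  have fp: "\<phi> p \<in> Y" "\<psi> (\<phi> p) = p" using p maps inverse by auto
  note pull = Y.has_val_compose[OF morph(2) maps(2) X.variety fp(1)]
  show "has_val Y (\<phi> p) (\<lambda>q. z (\<psi> q)) 0"
    using pull z fp(2) unfolding uniformizer_def by simp
  show "\<forall>\<^sub>F q in generic Y. z (\<psi> q) \<noteq> 0"
    using Y.generic_surj[OF morph(2) maps(2) X.variety, of "\<lambda>q. z q \<noteq> 0"] z unfolding uniformizer_def by simp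
  fix r assume r: "rational Y r" "\<forall>\<^sub>F q in generic Y. r q \<noteq> 0"
  have "rational X (\<lambda>q. r (\<phi> q))" "\<forall>\<^sub>F q in generic X. r (\<phi> q) \<noteq> 0"
    using X.rational_compose[OF morph(1) maps(1) Y.variety r(1)]
      X.generic_surj[OF morph(1) maps(1) Y.variety r(2)] by auto
  then obtain k u where ku: "unit_at X p u" "\<forall>\<^sub>F q in generic X. r (\<phi> q) = z q powi k * u q"
    using z unfolding uniformizer_def by blast
  have "\<forall>\<^sub>F q in generic Y. r (\<phi> (\<psi> q)) = z (\<psi> q) powi k * u (\<psi> q)"
    using Y.generic_surj[OF morph(2) maps(2) X.variety ku(2)] .
  then have "\<forall>\<^sub>F q in generic Y. r q = z (\<psi> q) powi k * u (\<psi> q)"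
    using Y.generic_mem by eventually_elim (simp add: inverse)
  moreover have "unit_at Y (\<phi> p) (\<lambda>q. u (\<psi> q))"
    using ku(1) pull fp(2) unfolding unit_at_def by auto
  ultimately show "\<exists>k u. unit_at Y (\<phi> p) u \<and> (\<forall>\<^sub>F q in generic Y. r q = z (\<psi> q) powi k * u q)"
    by (intro exI[of _ k] exI[of _ "\<lambda>q. u (\<psi> q)"] conjI)
qed

lemma vord_transport:
  assumes p: "p \<in> X" and z: "uniformizer X p z"
    and r: "rational X r" "\<forall>\<^sub>F q in generic X. r q \<noteq> 0"
  shows "vord Y (\<phi> p) (\<lambda>q. r (\<psi> q)) = vord X p r"
proof -
  obtain u where u: "unit_at X p u" "\<forall>\<^sub>F q in generic X. r q = z q powi (vord X p r) * u q"
    using X.vord_decomp[OF z p r] by blast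
  have fp: "\<phi> p \<in> Y" "\<psi> (\<phi> p) = p" using p maps inverse by auto
  have "unit_at Y (\<phi> p) (\<lambda>q. u (\<psi> q))"
    using u(1) Y.has_val_compose[OF morph(2) maps(2) X.variety fp(1)] fp(2) unfolding unit_at_def by auto
  moreover have "\<forall>\<^sub>F q in generic Y. r (\<psi> q) = z (\<psi> q) powi (vord X p r) * u (\<psi> q)"
    using Y.generic_surj[OF morph(2) maps(2) X.variety u(2)] .
  ultimately show ?thesis
    by (rule Y.vord_eq[OF uniformizer_transport[OF p z] fp(1)])
qed

end

lemma principal_cycleI:
  assumes W: "proj_curve W" "W \<subseteq> S" and r: "rational W r" "\<forall>\<^sub>F q in generic W. r q \<noteq> 0"
    and D: "\<And>p. p \<in> W \<Longrightarrow> Poly_Mapping.lookup D p = vord W p r"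
      "\<And>p. p \<notin> W \<Longrightarrow> Poly_Mapping.lookup D p = 0"
  shows "D \<in> principal_cycles S"
proof -
  interpret variety W by standard (use W in \<open>simp add: proj_curve_def\<close>)
  have "rat_class W r \<in> carrier (function_field W) - {\<zero>\<^bsub>function_field W\<^esub>}"
    unfolding function_field_eq fun_classes_simps
    using r generic_zero_nonzero_False[OF r(2)] by (auto simp: rat_class_eq)
  then show ?thesis
    unfolding principal_cycles_def using W D by (intro CollectI exI[of _ W] exI[of _ "rat_class W r"]) auto
qed

section \<open>The Jacobian criterion\<close>

text \<open>
  A functional outside \<open>A\<close> would be separated from \<open>A\<close> by a vector.
\<close>

lemma subspace_double_annihilator:
  fixes A :: "(complex ^ ('n::finite)) set"
  assumes A: "vec.subspace A" and b: "\<And>v. (\<And>a. a \<in> A \<Longrightarrow> lin a v = 0) \<Longrightarrow> lin b v = 0"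
  shows "b \<in> A"
proof (rule ccontr)
  assume "b \<notin> A"
  obtain B where B: "B \<subseteq> A" "vec.independent B" "A \<subseteq> vec.span B"
    by (rule vec.basis_exists[of A])
  have "vec.span B \<subseteq> A" using B(1) A by (rule vec.span_minimal)
  then have "vec.independent (insert b B)"
    using B(2) \<open>b \<notin> A\<close> by (intro vec.independent_insertI) auto
  then obtain g where g: "Vector_Spaces.linear (*s) (*s) g" "\<forall>x\<in>insert b B. g x = (if x = b then b else 0)"
    using vec.linear_independent_extend[of "insert b B" "\<lambda>x. if x = b then b else 0"] by blast
  interpret g: Vector_Spaces.linear "(*s)" "(*s)" g by (rule g(1))
  have "b \<noteq> 0" using \<open>b \<notin> A\<close> vec.subspace_0[OF A] by auto
  then obtain k where k: "b $ k \<noteq> 0" by (auto simp: vec_eq_iff)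
  define v :: "complex ^ 'n" where "v = (\<chi> i. g (axis i 1) $ k)"
  have lin: "lin a v = g a $ k" for a
  proof -
    have "g a = g (\<Sum>i\<in>UNIV. a $ i *s axis i 1)" by (simp add: basis_expansion)
    also have "\<dots> = (\<Sum>i\<in>UNIV. a $ i *s g (axis i 1))" by (simp only: g.sum g.scale)
    finally show ?thesis by (simp add: lin_def v_def)
  qed
  have "g a = 0" if a: "a \<in> A" for a
  proof (rule vec.linear_eq_0_on_span[OF g(1)])
    show "g x = 0" if x: "x \<in> B" for x using g(2) x B(1) \<open>b \<notin> A\<close> by auto
    show "a \<in> vec.span B" using a B(3) by blast
  qed
  then have "lin b v = 0" by (intro b) (simp add: lin)
  then show False using g(2) lin k by simp
qed

text \<open>
  The affine chart on which the linear form \<open>l\<close> is normalised to one.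
\<close>

locale affine_chart = variety X for X :: "('n::finite) ppoint set" +
  fixes p :: "'n ppoint" and l :: "complex ^ 'n"
  assumes p: "p \<in> X" and l: "lin l (rep p) = 1"
begin

text \<open>
  The affine coordinates of a point in the chart.
\<close>

definition norm_rep :: "'n ppoint \<Rightarrow> complex ^ 'n" where
  "norm_rep q = inverse (lin l (rep q)) *s rep q"

text \<open>
  These functions generate the maximal ideal at \<open>p\<close>.
\<close>

definition \<eta> :: "'n \<Rightarrow> 'n ppoint \<Rightarrow> complex" where
  "\<eta> i q = norm_rep q $ i - rep p $ i"

lemma generic_l: "\<forall>\<^sub>F q in generic X. lin l (rep q) \<noteq> 0"
  using generic_form_nonzero[OF form_lin p, of l] l by simp

lemma has_val_lin: "has_val X p (\<lambda>q. lin a (norm_rep q)) (lin a (rep p))"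
  using has_val_form[OF form_lin form_lin, of l p X a] l
  by (simp add: norm_rep_def lin_simps divide_inverse mult.commute)

lemma has_val_\<eta>: "has_val X p (\<eta> i) 0"
  using has_val_diff[OF has_val_lin has_val_const p, of "axis i 1" "rep p $ i"]
  unfolding \<eta>_def[abs_def] by (simp add: lin_axis)

lemma lin_\<eta>: "lin a (norm_rep q) = lin a (rep p) + (\<Sum>i\<in>UNIV. a $ i * \<eta> i q)"
  by (simp add: \<eta>_def lin_def algebra_simps sum_subtractf)

text \<open>
  First-order expansion of \<open>f\<close> at \<open>p\<close>: the coefficients \<open>\<kappa> i\<close> are regular with residues the
  partial derivatives. The second clause ties \<open>a\<close> to the derivatives in the Jacobian criterion. The
  property is inherited by sums and products, which gives it for all forms without partial derivatives of
  monomials.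
\<close>

definition taylor :: "(complex ^ 'n \<Rightarrow> complex) \<Rightarrow> complex ^ 'n \<Rightarrow> bool" where
  "taylor f a \<longleftrightarrow> (\<exists>\<kappa>. (\<forall>i. has_val X p (\<kappa> i) (a $ i)) \<and>
     (\<forall>\<^sub>F q in generic X. f (norm_rep q) = f (rep p) + (\<Sum>i\<in>UNIV. \<kappa> i q * \<eta> i q))) \<and>
     (\<forall>v. ((\<lambda>s. f (rep p + s *s v)) has_field_derivative lin a v) (at 0))"

lemma taylor_val:
  assumes "taylor f a"
  shows "has_val X p (\<lambda>q. f (norm_rep q)) (f (rep p))"
proof -
  obtain \<kappa> where \<kappa>: "\<And>i. has_val X p (\<kappa> i) (a $ i)"
    "\<forall>\<^sub>F q in generic X. f (norm_rep q) = f (rep p) + (\<Sum>i\<in>UNIV. \<kappa> i q * \<eta> i q)"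
    using assms unfolding taylor_def by blast
  have "has_val X p (\<lambda>q. \<Sum>i\<in>UNIV. \<kappa> i q * \<eta> i q) (\<Sum>i\<in>UNIV. a $ i * 0)"
    using \<kappa>(1) has_val_\<eta> by (intro has_val_sum has_val_mult p)
  from has_val_cong[OF has_val_add[OF has_val_const this p] \<kappa>(2)] show ?thesis by simp
qed

lemma taylor_const: "taylor (\<lambda>_. c) 0"
  unfolding taylor_def
  by (intro conjI exI[of _ "\<lambda>_ _. 0"]) (auto intro: has_val_const simp: lin_simps)

lemma taylor_coord: "taylor (\<lambda>u. u $ i) (axis i 1)"
  unfolding taylor_def
proof (intro conjI exI[of _ "\<lambda>j _. axis i 1 $ j"] allI has_val_const always_eventually)
  fix q show "norm_rep q $ i = rep p $ i + (\<Sum>j\<in>UNIV. axis i 1 $ j * \<eta> j q)"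
    using lin_\<eta>[of "axis i 1" q] by (simp add: lin_axis)
  fix v show "((\<lambda>s. (rep p + s *s v) $ i) has_field_derivative lin (axis i 1) v) (at 0)"
    by (auto intro!: derivative_eq_intros simp: lin_axis)
qed

lemma taylor_add:
  assumes "taylor f a" "taylor g b"
  shows "taylor (\<lambda>u. f u + g u) (a + b)"
proof -
  obtain \<kappa> where \<kappa>: "\<And>i. has_val X p (\<kappa> i) (a $ i)"
    "\<forall>\<^sub>F q in generic X. f (norm_rep q) = f (rep p) + (\<Sum>i\<in>UNIV. \<kappa> i q * \<eta> i q)"
    using assms(1) unfolding taylor_def by blast
  obtain \<kappa>' where \<kappa>': "\<And>i. has_val X p (\<kappa>' i) (b $ i)"
    "\<forall>\<^sub>F q in generic X. g (norm_rep q) = g (rep p) + (\<Sum>i\<in>UNIV. \<kappa>' i q * \<eta> i q)"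
    using assms(2) unfolding taylor_def by blast
  show ?thesis
    unfolding taylor_def
  proof (intro conjI exI[of _ "\<lambda>i q. \<kappa> i q + \<kappa>' i q"] allI)
    show "has_val X p (\<lambda>q. \<kappa> i q + \<kappa>' i q) ((a + b) $ i)" for i
      using has_val_add[OF \<kappa>(1) \<kappa>'(1) p] by simp
    show "\<forall>\<^sub>F q in generic X. f (norm_rep q) + g (norm_rep q) =
        f (rep p) + g (rep p) + (\<Sum>i\<in>UNIV. (\<kappa> i q + \<kappa>' i q) * \<eta> i q)"
      using \<kappa>(2) \<kappa>'(2) by eventually_elim (simp add: distrib_right sum.distrib)
    show "((\<lambda>s. f (rep p + s *s v) + g (rep p + s *s v)) has_field_derivative lin (a + b) v) (at 0)" for v
      unfolding lin_simps using assms by (intro DERIV_add) (auto simp: taylor_def)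
  qed
qed

lemma taylor_mult:
  assumes "taylor f a" "taylor g b"
  shows "taylor (\<lambda>u. f u * g u) (f (rep p) *s b + g (rep p) *s a)"
proof -
  obtain \<kappa> where \<kappa>: "\<And>i. has_val X p (\<kappa> i) (a $ i)"
    "\<forall>\<^sub>F q in generic X. f (norm_rep q) = f (rep p) + (\<Sum>i\<in>UNIV. \<kappa> i q * \<eta> i q)"
    using assms(1) unfolding taylor_def by blast
  obtain \<kappa>' where \<kappa>': "\<And>i. has_val X p (\<kappa>' i) (b $ i)"
    "\<forall>\<^sub>F q in generic X. g (norm_rep q) = g (rep p) + (\<Sum>i\<in>UNIV. \<kappa>' i q * \<eta> i q)"
    using assms(2) unfolding taylor_def by blast
  show ?thesis
    unfolding taylor_def
  proof (intro conjI exI[of _ "\<lambda>i q. f (rep p) * \<kappa>' i q + g (norm_rep q) * \<kappa> i q"] allI)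
    show "has_val X p (\<lambda>q. f (rep p) * \<kappa>' i q + g (norm_rep q) * \<kappa> i q) ((f (rep p) *s b + g (rep p) *s a) $ i)" for i
      using has_val_add[OF has_val_mult[OF has_val_const \<kappa>'(1)] has_val_mult[OF taylor_val[OF assms(2)] \<kappa>(1)] p]
      by simp
    show "\<forall>\<^sub>F q in generic X. f (norm_rep q) * g (norm_rep q) =
        f (rep p) * g (rep p) + (\<Sum>i\<in>UNIV. (f (rep p) * \<kappa>' i q + g (norm_rep q) * \<kappa> i q) * \<eta> i q)"
      using \<kappa>(2) \<kappa>'(2)
    proof eventually_elim
      case (elim q)
      have "(\<Sum>i\<in>UNIV. (f (rep p) * \<kappa>' i q + g (norm_rep q) * \<kappa> i q) * \<eta> i q) =
          f (rep p) * (\<Sum>i\<in>UNIV. \<kappa>' i q * \<eta> i q) + g (norm_rep q) * (\<Sum>i\<in>UNIV. \<kappa> i q * \<eta> i q)"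
        by (simp add: sum_distrib_left sum.distrib algebra_simps)
      moreover have "(\<Sum>i\<in>UNIV. \<kappa>' i q * \<eta> i q) = g (norm_rep q) - g (rep p)"
        "(\<Sum>i\<in>UNIV. \<kappa> i q * \<eta> i q) = f (norm_rep q) - f (rep p)" using elim by simp_all
      ultimately show ?case by (simp add: algebra_simps)
    qed
    fix v
    have "((\<lambda>s. f (rep p + s *s v)) has_field_derivative lin a v) (at 0)"
      "((\<lambda>s. g (rep p + s *s v)) has_field_derivative lin b v) (at 0)"
      using assms unfolding taylor_def by blast+
    from DERIV_mult[OF this]
    show "((\<lambda>s. f (rep p + s *s v) * g (rep p + s *s v)) has_field_derivative
        lin (f (rep p) *s b + g (rep p) *s a) v) (at 0)"
      by (simp add: lin_simps algebra_simps)
  qed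
qed

lemma taylor_form:
  assumes "form d F"
  shows "\<exists>a. taylor F a"
proof -
  have power: "\<exists>a. taylor (\<lambda>u. (u $ i) ^ k) a" for i and k :: nat
  proof (induction k)
    case 0
    show ?case using taylor_const[of 1] by auto
  next
    case (Suc k)
    then obtain a where "taylor (\<lambda>u. (u $ i) ^ k) a" by blast
    from taylor_mult[OF taylor_coord[of i] this] show ?case by auto
  qed
  have prod: "\<exists>a. taylor (\<lambda>u. \<Prod>i\<in>I. (u $ i) ^ \<alpha> i) a" for I :: "'n set" and \<alpha> :: "'n \<Rightarrow> nat"
  proof (induction I rule: infinite_finite_induct)
    case (insert i I)
    obtain a b where "taylor (\<lambda>u. (u $ i) ^ \<alpha> i) a" "taylor (\<lambda>u. \<Prod>i\<in>I. (u $ i) ^ \<alpha> i) b"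
      using power insert.IH by blast
    from taylor_mult[OF this] show ?case using insert.hyps by auto
  qed (use taylor_const[of 1] in auto)
  have sum: "\<exists>a. taylor (\<lambda>u. \<Sum>\<alpha>\<in>A. c \<alpha> * (\<Prod>i\<in>UNIV. (u $ i) ^ \<alpha> i)) a"
    for A :: "('n \<Rightarrow> nat) set" and c
  proof (induction A rule: infinite_finite_induct)
    case (insert \<alpha> A)
    obtain a where "taylor (\<lambda>u. \<Prod>i\<in>UNIV. (u $ i) ^ \<alpha> i) a" using prod by blast
    note a = taylor_mult[OF taylor_const[of "c \<alpha>"] this]
    obtain b where "taylor (\<lambda>u. \<Sum>\<alpha>\<in>A. c \<alpha> * (\<Prod>i\<in>UNIV. (u $ i) ^ \<alpha> i)) b"
      using insert.IH by blast
    from taylor_add[OF a this] show ?case using insert.hyps by auto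
  qed (use taylor_const[of 0] in auto)
  obtain c where F: "F = (\<lambda>u. \<Sum>\<alpha> | (\<Sum>i\<in>UNIV. \<alpha> i) = d. c \<alpha> * (\<Prod>i\<in>UNIV. (u $ i) ^ \<alpha> i))"
    using assms unfolding form_def by blast
  show ?thesis unfolding F by (rule sum)
qed

lemma taylor_deriv: "taylor f a \<Longrightarrow> deriv (\<lambda>s. f (rep p + s *s v)) 0 = lin a v"
  unfolding taylor_def by (auto intro: DERIV_imp_deriv)

lemma form_norm_rep_zero:
  assumes "form d F"
  shows "F (rep q) = 0 \<Longrightarrow> F (norm_rep q) = 0"
  unfolding norm_rep_def form_scale[OF assms] by simp

text \<open>The conormal space of the cone: the differentials of the forms vanishing on the variety.\<close>

definition conormal :: "(complex ^ 'n) set" where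
  "conormal = {a. \<exists>d F. form d F \<and> (\<forall>q\<in>X. vanishes_at F q) \<and> taylor F a}"

lemma vanishes_on: "form d F \<Longrightarrow> (\<forall>q\<in>X. vanishes_at F q) \<longleftrightarrow> (\<forall>q\<in>X. F (rep q) = 0)"
  using vanishes_at_rep in_proj_space by blast

lemma conormal_subspace: "vec.subspace conormal"
proof (rule vec.subspaceI)
  show "0 \<in> conormal"
    unfolding conormal_def
    using form_zero[of 0] taylor_const[of 0] by (auto simp: vanishes_at_def intro!: exI[of _ "0::nat"] exI[of _ "\<lambda>_. 0"])
next
  fix a b assume "a \<in> conormal" "b \<in> conormal"
  then obtain d F e G where F: "form d F" "\<forall>q\<in>X. F (rep q) = 0" "taylor F a"
    and G: "form e G" "\<forall>q\<in>X. G (rep q) = 0" "taylor G b"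
    unfolding conormal_def using vanishes_on by blast
  have L: "form k (\<lambda>u. lin l u ^ k)" for k using form_power[OF form_lin, of k l] by simp
  obtain a' b' where "taylor (\<lambda>u. lin l u ^ e) a'" "taylor (\<lambda>u. lin l u ^ d) b'"
    using taylor_form[OF L] by blast
  note t = taylor_add[OF taylor_mult[OF F(3) this(1)] taylor_mult[OF G(3) this(2)]]
  have f: "form (d + e) (\<lambda>u. F u * lin l u ^ e + G u * lin l u ^ d)"
    using form_mult[OF F(1) L, of e] form_mult[OF G(1) L, of d] by (intro form_add) (simp_all add: add.commute)
  have "F (rep p) = 0" "G (rep p) = 0" using F(2) G(2) p by auto
  then have "taylor (\<lambda>u. F u * lin l u ^ e + G u * lin l u ^ d) (a + b)"
    using t by (simp add: l)
  moreover have "\<forall>q\<in>X. F (rep q) * lin l (rep q) ^ e + G (rep q) * lin l (rep q) ^ d = 0"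
    using F(2) G(2) by simp
  ultimately show "a + b \<in> conormal"
    unfolding conormal_def using f vanishes_on[OF f] by blast
next
  fix a and c :: complex assume "a \<in> conormal"
  then obtain d F where F: "form d F" "\<forall>q\<in>X. F (rep q) = 0" "taylor F a"
    unfolding conormal_def using vanishes_on by blast
  have "taylor (\<lambda>u. c * F u) (c *s a)"
    using taylor_mult[OF taylor_const[of c] F(3)] by simp
  then show "c *s a \<in> conormal"
    unfolding conormal_def using form_cmult[OF F(1), of c] F(2) vanishes_on[OF form_cmult[OF F(1), of c]] by auto
qed

lemma tangent_space_eq:
  "{v. \<forall>d F. form d F \<longrightarrow> (\<forall>q\<in>X. vanishes_at F q) \<longrightarrow> deriv (\<lambda>s. F (rep p + s *s v)) 0 = 0}
   = {v. \<forall>a\<in>conormal. lin a v = 0}" (is "?L = ?R")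
proof
  show "?L \<subseteq> ?R" unfolding conormal_def using taylor_deriv by fastforce
  show "?R \<subseteq> ?L"
  proof (intro subsetI CollectI allI impI)
    fix v d F assume v: "v \<in> ?R" and F: "form d F" "\<forall>q\<in>X. vanishes_at F q"
    obtain a where "taylor F a" using taylor_form[OF F(1)] by blast
    then show "deriv (\<lambda>s. F (rep p + s *s v)) 0 = 0"
      using v F taylor_deriv unfolding conormal_def by fastforce
  qed
qed

text \<open>
  Euler's relation: a cone contains the line through each of its vectors.
\<close>

lemma rep_tangent:
  assumes "a \<in> conormal"
  shows "lin a (rep p) = 0"
proof -
  obtain d F where F: "form d F" "\<forall>q\<in>X. F (rep q) = 0" "taylor F a"
    using assms unfolding conormal_def using vanishes_on by blast
  have "F (rep p + s *s rep p) = 0" for s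
  proof -
    have eq: "rep p + s *s rep p = (1 + s) *s rep p" by (simp add: vec.scale_left_distrib)
    show ?thesis unfolding eq form_scale[OF F(1)] using F(2) p by simp
  qed
  moreover have "((\<lambda>s. F (rep p + s *s rep p)) has_field_derivative lin a (rep p)) (at 0)"
    using F(3) unfolding taylor_def by blast
  ultimately have "((\<lambda>s. 0) has_field_derivative lin a (rep p)) (at 0)" by simp
  then show ?thesis using DERIV_unique[OF _ DERIV_const] by blast
qed

text \<open>
  Nakayama's lemma in coordinates. If the generators satisfy
  \<open>\<eta> = \<rho> z + \<mu> \<eta>\<close> with the entries of \<open>\<mu>\<close> in the maximal ideal, then \<open>1 - \<mu>\<close> is invertible;
  the variables are eliminated one at a time since each pivot \<open>1 - \<mu> k k\<close> is a unit.
\<close>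

lemma small_relations_solvable:
  assumes rel: "\<And>i. has_val X p (\<rho> i) (c i)" "\<And>i j. has_val X p (\<mu> i j) 0"
    "\<And>i. \<forall>\<^sub>F q in generic X. \<eta> i q = \<rho> i q * z q + (\<Sum>j\<in>UNIV. \<mu> i j q * \<eta> j q)"
  shows "\<exists>\<rho>'. \<forall>i. (\<exists>c. has_val X p (\<rho>' i) c) \<and> (\<forall>\<^sub>F q in generic X. \<eta> i q = \<rho>' i q * z q)"
proof -
  have "\<exists>\<rho>' \<mu>'. \<forall>i. (\<exists>c. has_val X p (\<rho>' i) c) \<and> (\<forall>j. has_val X p (\<mu>' i j) 0) \<and>
    (\<forall>\<^sub>F q in generic X. \<eta> i q = \<rho>' i q * z q + (\<Sum>j\<in>-J. \<mu>' i j q * \<eta> j q))" for J :: "'n set"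
    using finite[of J]
  proof (induction J rule: finite_induct)
    case empty
    show ?case
    proof (intro exI[of _ \<rho>] exI[of _ \<mu>] allI conjI)
      show "\<exists>c. has_val X p (\<rho> i) c" for i using rel(1) by blast
      show "has_val X p (\<mu> i j) 0" for i j by (rule rel(2))
      show "\<forall>\<^sub>F q in generic X. \<eta> i q = \<rho> i q * z q + (\<Sum>j\<in>-{}. \<mu> i j q * \<eta> j q)" for i
        using rel(3)[of i] by simp
    qed
  next
    case (insert k J)
    from insert.IH obtain \<rho>' \<mu>' where *: "\<forall>i. (\<exists>c. has_val X p (\<rho>' i) c) \<and> (\<forall>j. has_val X p (\<mu>' i j) 0) \<and>
      (\<forall>\<^sub>F q in generic X. \<eta> i q = \<rho>' i q * z q + (\<Sum>j\<in>-J. \<mu>' i j q * \<eta> j q))" by (elim exE)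
    then have 1: "\<And>i. \<exists>c. has_val X p (\<rho>' i) c" "\<And>i j. has_val X p (\<mu>' i j) 0"
      "\<And>i. \<forall>\<^sub>F q in generic X. \<eta> i q = \<rho>' i q * z q + (\<Sum>j\<in>-J. \<mu>' i j q * \<eta> j q)"
      by blast+
    (* Solve the k-th relation for \<eta> k and substitute into the others. *)
    define e where "e q = inverse (1 - \<mu>' k k q)" for q
    have e: "has_val X p e 1"
      using has_val_inverse[OF has_val_diff[OF has_val_const[of X p 1] 1(2)[of k k] p]] unfolding e_def[abs_def] by simp
    have e_nz: "\<forall>\<^sub>F q in generic X. 1 - \<mu>' k k q \<noteq> 0"
      using has_val_generic_nonzero[OF e _ p] by (simp add: e_def[abs_def])
    have split: "-J = insert k (-insert k J)" using insert.hyps by auto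
    define \<rho>'' where "\<rho>'' i q = \<rho>' i q + \<mu>' i k q * (e q * \<rho>' k q)" for i q
    define \<mu>'' where "\<mu>'' i j q = \<mu>' i j q + \<mu>' i k q * (e q * \<mu>' k j q)" for i j q
    show ?case
    proof (intro exI[of _ \<rho>''] exI[of _ \<mu>''] allI conjI)
      fix i
      obtain c c' where "has_val X p (\<rho>' i) c" "has_val X p (\<rho>' k) c'" using 1(1) by blast
      from has_val_add[OF this(1) has_val_mult[OF 1(2)[of i k] has_val_mult[OF e this(2)]] p]
      show "\<exists>c. has_val X p (\<rho>'' i) c" unfolding \<rho>''_def[abs_def] by blast
      show "has_val X p (\<mu>'' i j) 0" for j
        using has_val_add[OF 1(2)[of i j] has_val_mult[OF 1(2)[of i k] has_val_mult[OF e 1(2)[of k j]]] p]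
        unfolding \<mu>''_def[abs_def] by simp
      show "\<forall>\<^sub>F q in generic X. \<eta> i q = \<rho>'' i q * z q + (\<Sum>j\<in>- insert k J. \<mu>'' i j q * \<eta> j q)"
        using 1(3)[of i] 1(3)[of k] e_nz
      proof eventually_elim
        case (elim q)
        have s: "(\<Sum>j\<in>-J. \<mu>' i j q * \<eta> j q) = \<mu>' i k q * \<eta> k q + (\<Sum>j\<in>-insert k J. \<mu>' i j q * \<eta> j q)" for i
          unfolding split by (subst sum.insert) auto
        have "\<eta> k q * (1 - \<mu>' k k q) = \<rho>' k q * z q + (\<Sum>j\<in>-insert k J. \<mu>' k j q * \<eta> j q)"
          using elim(2) unfolding s[of k] by (simp add: algebra_simps)
        then have k: "\<eta> k q = e q * (\<rho>' k q * z q + (\<Sum>j\<in>-insert k J. \<mu>' k j q * \<eta> j q))"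
          using elim(3) by (simp add: e_def field_simps)
        have t: "(\<Sum>j\<in>- insert k J. \<mu>'' i j q * \<eta> j q) = (\<Sum>j\<in>-insert k J. \<mu>' i j q * \<eta> j q) +
            \<mu>' i k q * (e q * (\<Sum>j\<in>-insert k J. \<mu>' k j q * \<eta> j q))"
          unfolding \<mu>''_def sum_distrib_left sum.distrib[symmetric]
          by (intro sum.cong refl) (simp add: algebra_simps)
        have "\<eta> i q = \<rho>' i q * z q + (\<mu>' i k q * \<eta> k q + (\<Sum>j\<in>-insert k J. \<mu>' i j q * \<eta> j q))"
          using elim(1) unfolding s[of i] .
        then show ?case unfolding t \<rho>''_def by (subst (asm) k) (simp add: algebra_simps)
      qed
    qed
  qed
  from this[of UNIV] show ?thesis by simp blast
qed

text \<open>
  The tangent space of the cone is a plane, spanned by the point itself and one direction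
  \<open>\<tau>\<close>. Let \<open>z\<close> be the affine coordinate dual to \<open>\<tau>\<close>. For each coordinate \<open>\<eta> i\<close> the linear form
  \<open>\<eta> i - \<tau> i * z\<close> kills the tangent space, so it is the differential of a form vanishing on the
  variety. The expansion of that form expresses \<open>\<eta> i\<close> as \<open>\<tau> i * z\<close> plus a combination of the \<open>\<eta> j\<close> with
  coefficients in the maximal ideal, and Nakayama's lemma shows that \<open>z\<close> generates.
\<close>

lemma parameter_exists:
  assumes smooth: "smooth X" "zdim X = 1"
  shows "\<exists>z. has_val X p z 0 \<and>
    (\<forall>a. has_val X p a 0 \<longrightarrow> (\<exists>b c. has_val X p b c \<and> (\<forall>\<^sub>F q in generic X. a q = z q * b q)))"
proof -
  let ?u = "rep p"
  have u: "?u \<in> p" "?u \<noteq> 0" using rep_props in_proj_space[OF p] by auto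
  let ?T = "{v. \<forall>a\<in>conormal. lin a v = 0}"
  have dimT: "vec.dim ?T = 2"
    using smooth p u unfolding smooth_def tangent_space_eq[symmetric] by fastforce
  have uT: "?u \<in> ?T" using rep_tangent by blast
  obtain B where B: "{?u} \<subseteq> B" "B \<subseteq> ?T" "vec.independent B" "?T \<subseteq> vec.span B"
    using vec.maximal_independent_subset_extend[of "{?u}" ?T] uT u(2) by auto
  have "card B = 2" using vec.basis_card_eq_dim[OF B(2,4,3)] dimT by simp
  then obtain t where t: "B = {?u, t}" "t \<noteq> ?u"
    using B(1) by (auto simp: card_2_iff)
  (* Make the second tangent direction parallel to the chart. *)
  define \<tau> where "\<tau> = t - lin l t *s ?u"
  have "\<tau> \<noteq> 0"
  proof
    assume "\<tau> = 0"
    then have "t = lin l t *s ?u" by (simp add: \<tau>_def)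
    then have "t \<in> vec.span {?u}" using vec.span_singleton[of ?u] by auto
    moreover have "vec.independent (insert t {?u})" using B(3) t by (simp add: insert_commute)
    ultimately show False using t(2) vec.independent_insert[of t "{?u}"] by auto
  qed
  then obtain m where "lin m \<tau> \<noteq> 0" using lin_eq_0_imp by blast
  define l1 where "l1 = inverse (lin m \<tau>) *s m - lin (inverse (lin m \<tau>) *s m) ?u *s l"
  have l\<tau>: "lin l \<tau> = 0" by (simp add: \<tau>_def lin_simps l)
  have l1: "lin l1 ?u = 0" "lin l1 \<tau> = 1"
    using \<open>lin m \<tau> \<noteq> 0\<close> by (simp_all add: l1_def lin_simps l l\<tau>)
  define z where "z q = lin l1 (norm_rep q)" for q
  have z: "has_val X p z 0" using has_val_lin[of l1] l1 by (simp add: z_def[abs_def])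
  (* The linear form \<eta> i - \<tau> i * z, corrected by a multiple of l to vanish at the point. *)
  define b where "b i = axis i 1 - (?u $ i) *s l - (\<tau> $ i) *s l1" for i
  have b: "b i \<in> conormal" for i
  proof (rule subspace_double_annihilator[OF conormal_subspace])
    fix v assume "\<And>a. a \<in> conormal \<Longrightarrow> lin a v = 0"
    then have "v \<in> vec.span {t, ?u}" using B(4) t by (auto simp: insert_commute)
    then obtain \<alpha> \<beta> where "v - \<alpha> *s t = \<beta> *s ?u"
      using vec.span_breakdown_eq[of v t "{?u}"] vec.span_singleton[of ?u] by auto
    then have "v = \<alpha> *s t + \<beta> *s ?u" by (simp add: algebra_simps)
    then have "v = \<alpha> *s \<tau> + (\<beta> + \<alpha> * lin l t) *s ?u" by (simp add: \<tau>_def vec_eq_iff algebra_simps)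
    then show "lin (b i) v = 0" by (simp add: b_def lin_simps l1 l l\<tau> lin_axis algebra_simps)
  qed
  have "\<forall>i. \<exists>\<mu>. (\<forall>j. has_val X p (\<mu> j) 0) \<and>
    (\<forall>\<^sub>F q in generic X. \<eta> i q = \<tau> $ i * z q + (\<Sum>j\<in>UNIV. \<mu> j q * \<eta> j q))"
  proof
    fix i
    obtain d F where F: "form d F" "\<forall>q\<in>X. F (rep q) = 0" "taylor F (b i)"
      using b[of i] unfolding conormal_def using vanishes_on by blast
    then obtain \<kappa> where \<kappa>: "\<And>j. has_val X p (\<kappa> j) (b i $ j)"
      "\<forall>\<^sub>F q in generic X. F (norm_rep q) = F (rep p) + (\<Sum>j\<in>UNIV. \<kappa> j q * \<eta> j q)"
      unfolding taylor_def by blast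
    show "\<exists>\<mu>. (\<forall>j. has_val X p (\<mu> j) 0) \<and>
      (\<forall>\<^sub>F q in generic X. \<eta> i q = \<tau> $ i * z q + (\<Sum>j\<in>UNIV. \<mu> j q * \<eta> j q))"
    proof (intro exI[of _ "\<lambda>j q. b i $ j - \<kappa> j q"] conjI allI)
      show "has_val X p (\<lambda>q. b i $ j - \<kappa> j q) 0" for j
        using has_val_diff[OF has_val_const \<kappa>(1) p, of "b i $ j" j] by simp
      show "\<forall>\<^sub>F q in generic X. \<eta> i q = \<tau> $ i * z q + (\<Sum>j\<in>UNIV. (b i $ j - \<kappa> j q) * \<eta> j q)"
        using \<kappa>(2) generic_mem generic_l
      proof eventually_elim
        case (elim q)
        have "F (norm_rep q) = 0" "F (rep p) = 0"
          using F elim(2) p form_norm_rep_zero by auto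
        then have 0: "(\<Sum>j\<in>UNIV. \<kappa> j q * \<eta> j q) = 0" using elim(1) by simp
        have "lin l (norm_rep q) = 1" using elim(3) by (simp add: norm_rep_def lin_simps)
        then have "lin (b i) (norm_rep q) = \<eta> i q - \<tau> $ i * z q"
          by (simp add: b_def lin_simps lin_axis \<eta>_def z_def)
        moreover have "lin (b i) (norm_rep q) = (\<Sum>j\<in>UNIV. b i $ j * \<eta> j q)"
          using rep_tangent[OF b] by (simp add: lin_\<eta>)
        ultimately show ?case using 0 by (simp add: left_diff_distrib sum_subtractf)
      qed
    qed
  qed
  then obtain \<mu> where \<mu>: "\<And>i j. has_val X p (\<mu> i j) 0"
    "\<And>i. \<forall>\<^sub>F q in generic X. \<eta> i q = \<tau> $ i * z q + (\<Sum>j\<in>UNIV. \<mu> i j q * \<eta> j q)"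
    by (auto dest!: choice)
  obtain \<rho> where "\<forall>i. (\<exists>c. has_val X p (\<rho> i) c) \<and> (\<forall>\<^sub>F q in generic X. \<eta> i q = \<rho> i q * z q)"
    using small_relations_solvable[OF has_val_const \<mu>] by (elim exE)
  then have \<rho>: "\<forall>i. \<exists>c. has_val X p (\<rho> i) c" "\<And>i. \<forall>\<^sub>F q in generic X. \<eta> i q = \<rho> i q * z q"
    by blast+
  obtain c where c: "\<And>i. has_val X p (\<rho> i) (c i)" using choice[OF \<rho>(1)] by blast
  have "\<exists>b c. has_val X p b c \<and> (\<forall>\<^sub>F q in generic X. a q = z q * b q)" if a: "has_val X p a 0" for a
  proof -
    obtain d F G where FG: "form d F" "form d G" "G (rep p) \<noteq> 0" "F (rep p) = 0 * G (rep p)"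
      "\<forall>\<^sub>F q in generic X. a q = F (rep q) / G (rep q)"
      using a unfolding has_val_def by blast
    obtain f g where f: "taylor F f" and g: "taylor G g" using taylor_form FG by blast
    obtain \<kappa> where \<kappa>: "\<And>j. has_val X p (\<kappa> j) (f $ j)"
      "\<forall>\<^sub>F q in generic X. F (norm_rep q) = F (rep p) + (\<Sum>j\<in>UNIV. \<kappa> j q * \<eta> j q)"
      using f unfolding taylor_def by blast

    let ?b = "\<lambda>q. (\<Sum>j\<in>UNIV. \<kappa> j q * \<rho> j q) / G (norm_rep q)"
    have "has_val X p ?b ((\<Sum>j\<in>UNIV. f $ j * c j) / G (rep p))"
      by (intro has_val_divide has_val_sum has_val_mult \<kappa> c p taylor_val[OF g] FG)
    moreover have "\<forall>\<^sub>F q in generic X. \<forall>i\<in>UNIV. \<eta> i q = \<rho> i q * z q"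
      using \<rho>(2) by (intro eventually_ball_finite) auto
    then have "\<forall>\<^sub>F q in generic X. a q = z q * ?b q"
      using FG(5) \<kappa>(2) generic_l
    proof eventually_elim
      case (elim q)
      have "F (norm_rep q) / G (norm_rep q) = F (rep q) / G (rep q)"
        using elim(4) unfolding norm_rep_def form_scale[OF FG(1)] form_scale[OF FG(2)] by simp
      then have "a q = (\<Sum>j\<in>UNIV. \<kappa> j q * \<eta> j q) / G (norm_rep q)"
        using elim(2,3) FG(4) by simp
      also have "(\<Sum>j\<in>UNIV. \<kappa> j q * \<eta> j q) = z q * (\<Sum>j\<in>UNIV. \<kappa> j q * \<rho> j q)"
        using elim(1) by (simp add: sum_distrib_left mult_ac)
      finally show ?case by simp
    qed
    ultimately show ?thesis by blast
  qed
  then show ?thesis using z by blast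
qed

end

lemma (in variety) maximal_ideal_principal:
  assumes "smooth X" "zdim X = 1" "p \<in> X"
  obtains z where "has_val X p z 0"
    "\<And>a. has_val X p a 0 \<Longrightarrow> \<exists>b c. has_val X p b c \<and> (\<forall>\<^sub>F q in generic X. a q = z q * b q)"
proof -
  obtain m where m: "lin m (rep p) \<noteq> 0"
    using lin_eq_0_imp rep_props(2) in_proj_space[OF assms(3)] by blast
  interpret affine_chart X p "inverse (lin m (rep p)) *s m"
    by standard (use assms m in \<open>auto simp: lin_simps\<close>)
  show ?thesis using parameter_exists[OF assms(1,2)] that by blast
qed

section \<open>Double covers of the line\<close>

text \<open>
  The vector of minors of a two by three system is a solution. If all minors vanish, the rows
  are proportional and a solution of one nonzero row will do.
\<close>

lemma two_linear_equations:
  fixes k0 k1 k2 l0 l1 l2 :: "'a::idom"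
  assumes closed: "0 \<in> S" "1 \<in> S" "\<And>a b. a \<in> S \<Longrightarrow> b \<in> S \<Longrightarrow> a * b \<in> S" "\<And>a b. a \<in> S \<Longrightarrow> b \<in> S \<Longrightarrow> a - b \<in> S"
    and S: "k0 \<in> S" "k1 \<in> S" "k2 \<in> S" "l0 \<in> S" "l1 \<in> S" "l2 \<in> S"
  shows "\<exists>c0\<in>S. \<exists>c1\<in>S. \<exists>c2\<in>S. \<not> (c0 = 0 \<and> c1 = 0 \<and> c2 = 0) \<and>
    c0 * k0 + c1 * k1 + c2 * k2 = 0 \<and> c0 * l0 + c1 * l1 + c2 * l2 = 0"
proof -
  have neg: "- a \<in> S" if "a \<in> S" for a using closed(4)[OF closed(1) that] by simp
  let ?m0 = "k1 * l2 - k2 * l1" and ?m1 = "k2 * l0 - k0 * l2" and ?m2 = "k0 * l1 - k1 * l0"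
  show ?thesis
  proof (cases "?m0 = 0 \<and> ?m1 = 0 \<and> ?m2 = 0")
    case False
    have "?m0 * k0 + ?m1 * k1 + ?m2 * k2 = 0" "?m0 * l0 + ?m1 * l1 + ?m2 * l2 = 0" by (simp_all add: algebra_simps)
    moreover have "?m0 \<in> S" "?m1 \<in> S" "?m2 \<in> S" using S closed by blast+
    ultimately show ?thesis using False by blast
  next
    case minors: True
    consider (a) "k0 \<noteq> 0 \<or> k1 \<noteq> 0" | (b) "k0 = 0" "k1 = 0" "k2 \<noteq> 0"
      | (c) "k0 = 0" "k1 = 0" "k2 = 0" "l0 \<noteq> 0 \<or> l1 \<noteq> 0"
      | (d) "k0 = 0" "k1 = 0" "k2 = 0" "l0 = 0" "l1 = 0" by blast
    then show ?thesis
    proof cases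
      case a
      have "k1 * k0 + (- k0) * k1 + 0 * k2 = 0" "k1 * l0 + (- k0) * l1 + 0 * l2 = 0" using minors by (simp_all add: mult.commute)
      moreover have "k1 \<in> S" "(- k0) \<in> S" "0 \<in> S" using S closed(1,2) neg by simp_all
      moreover have "\<not> (k1 = 0 \<and> (- k0) = 0 \<and> 0 = 0)" using a by auto
      ultimately show ?thesis by blast
    next
      case b
      have "k2 * k0 + 0 * k1 + 0 * k2 = 0" "k2 * l0 + 0 * l1 + 0 * l2 = 0" using minors b by (simp_all add: mult.commute)
      moreover have "k2 \<in> S" "0 \<in> S" "0 \<in> S" using S closed(1,2) neg by simp_all
      moreover have "\<not> (k2 = 0 \<and> 0 = 0 \<and> 0 = 0)" using b by simp
      ultimately show ?thesis by blast
    next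
      case c
      have "l1 * k0 + (- l0) * k1 + 0 * k2 = 0" "l1 * l0 + (- l0) * l1 + 0 * l2 = 0" using c by simp_all
      moreover have "l1 \<in> S" "(- l0) \<in> S" "0 \<in> S" using S closed(1,2) neg by simp_all
      moreover have "\<not> (l1 = 0 \<and> (- l0) = 0 \<and> 0 = 0)" using c by auto
      ultimately show ?thesis by blast
    next
      case d
      show ?thesis
      proof (cases "l2 = 0")
        case True
        have "1 * k0 + 0 * k1 + 0 * k2 = 0" "1 * l0 + 0 * l1 + 0 * l2 = 0" using d True by simp_all
        moreover have "1 \<in> S" "0 \<in> S" "0 \<in> S" using S closed(1,2) neg by simp_all
        moreover have "\<not> ((1::'a) = 0 \<and> (0::'a) = 0 \<and> (0::'a) = 0)" by simp
        ultimately show ?thesis by blast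
      next
        case False
        have "l2 * k0 + 0 * k1 + 0 * k2 = 0" "l2 * l0 + 0 * l1 + 0 * l2 = 0" using d by simp_all
        moreover have "l2 \<in> S" "0 \<in> S" "0 \<in> S" using S closed(1,2) neg by simp_all
        moreover have "\<not> (l2 = 0 \<and> 0 = 0 \<and> 0 = 0)" using d False by simp
        ultimately show ?thesis by blast
      qed
    qed
  qed
qed

text \<open>
  Three vectors in a space spanned by two are dependent; clearing denominators makes the
  coefficients polynomial. The set \<open>S\<close> of allowed polynomials is a parameter because the constant
  polynomials serve to exclude a constant map to the line, before any function of the line is known to be
  transcendental on the curve.
\<close>

lemma (in variety) rational_functions_dependent:
  fixes S :: "complex poly set"
  assumes closed: "0 \<in> S" "1 \<in> S" "\<And>a b. a \<in> S \<Longrightarrow> b \<in> S \<Longrightarrow> a * b \<in> S" "\<And>a b. a \<in> S \<Longrightarrow> b \<in> S \<Longrightarrow> a - b \<in> S"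
    and spans: "\<And>i. i < 3 \<Longrightarrow> \<exists>P\<in>S. \<exists>Q\<in>S. \<exists>P'\<in>S. \<exists>Q'\<in>S.
      (\<forall>\<^sub>F x in generic X. poly Q (t x) \<noteq> 0 \<and> poly Q' (t x) \<noteq> 0 \<and>
        e i x = poly P (t x) / poly Q (t x) * v x + poly P' (t x) / poly Q' (t x) * v' x)"
  shows "\<exists>c0\<in>S. \<exists>c1\<in>S. \<exists>c2\<in>S. \<not> (c0 = 0 \<and> c1 = 0 \<and> c2 = 0) \<and>
    (\<forall>\<^sub>F x in generic X. poly c0 (t x) * e (0::nat) x + poly c1 (t x) * e 1 x + poly c2 (t x) * e 2 x = 0)"
proof -
  have key: "\<exists>B\<in>S. \<exists>k\<in>S. \<exists>l\<in>S. B \<noteq> 0 \<and>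
    (\<forall>\<^sub>F x in generic X. poly B (t x) * e i x = poly k (t x) * v x + poly l (t x) * v' x)" if i: "i < 3" for i
  proof -
    obtain P Q P' Q' where *: "P \<in> S" "Q \<in> S" "P' \<in> S" "Q' \<in> S"
      "\<forall>\<^sub>F x in generic X. poly Q (t x) \<noteq> 0 \<and> poly Q' (t x) \<noteq> 0 \<and>
        e i x = poly P (t x) / poly Q (t x) * v x + poly P' (t x) / poly Q' (t x) * v' x"
      using spans[OF i] by blast
    show ?thesis
    proof (rule bexI[of _ "Q * Q'"], rule bexI[of _ "P * Q'"], rule bexI[of _ "P' * Q"], rule conjI)
      show "Q * Q' \<noteq> 0"
      proof
        assume "Q * Q' = 0"
        from *(5) have "\<forall>\<^sub>F x in generic X. False"
          by eventually_elim (use \<open>Q * Q' = 0\<close> in auto)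
        then show False by simp
      qed
      show "\<forall>\<^sub>F x in generic X. poly (Q * Q') (t x) * e i x = poly (P * Q') (t x) * v x + poly (P' * Q) (t x) * v' x"
        using *(5) by eventually_elim (simp add: field_simps)
    qed (use * closed(3) in simp_all)
  qed
  obtain B0 k0 l0 where 0: "B0 \<in> S" "k0 \<in> S" "l0 \<in> S" "B0 \<noteq> 0"
    "\<forall>\<^sub>F x in generic X. poly B0 (t x) * e 0 x = poly k0 (t x) * v x + poly l0 (t x) * v' x"
    using key[of 0] by auto
  obtain B1 k1 l1 where 1: "B1 \<in> S" "k1 \<in> S" "l1 \<in> S" "B1 \<noteq> 0"
    "\<forall>\<^sub>F x in generic X. poly B1 (t x) * e 1 x = poly k1 (t x) * v x + poly l1 (t x) * v' x"
    using key[of 1] by auto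
  obtain B2 k2 l2 where 2: "B2 \<in> S" "k2 \<in> S" "l2 \<in> S" "B2 \<noteq> 0"
    "\<forall>\<^sub>F x in generic X. poly B2 (t x) * e 2 x = poly k2 (t x) * v x + poly l2 (t x) * v' x"
    using key[of 2] by auto
  obtain c0 c1 c2 where c: "c0 \<in> S" "c1 \<in> S" "c2 \<in> S" "\<not> (c0 = 0 \<and> c1 = 0 \<and> c2 = 0)"
    "c0 * k0 + c1 * k1 + c2 * k2 = 0" "c0 * l0 + c1 * l1 + c2 * l2 = 0"
    using two_linear_equations[OF closed 0(2) 1(2) 2(2) 0(3) 1(3) 2(3)] by blast
  show ?thesis
  proof (rule bexI[of _ "c0 * B0"], rule bexI[of _ "c1 * B1"], rule bexI[of _ "c2 * B2"], rule conjI)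
    show "\<not> (c0 * B0 = 0 \<and> c1 * B1 = 0 \<and> c2 * B2 = 0)" using c 0 1 2 by simp
    show "\<forall>\<^sub>F x in generic X. poly (c0 * B0) (t x) * e 0 x + poly (c1 * B1) (t x) * e 1 x + poly (c2 * B2) (t x) * e 2 x = 0"
      using 0(5) 1(5) 2(5)
    proof eventually_elim
      case (elim x)
      have "poly (c0 * B0) (t x) * e 0 x + poly (c1 * B1) (t x) * e 1 x + poly (c2 * B2) (t x) * e 2 x =
        poly c0 (t x) * (poly B0 (t x) * e 0 x) + poly c1 (t x) * (poly B1 (t x) * e 1 x) + poly c2 (t x) * (poly B2 (t x) * e 2 x)"
        by (simp add: mult.assoc)
      also have "\<dots> = poly (c0 * k0 + c1 * k1 + c2 * k2) (t x) * v x + poly (c0 * l0 + c1 * l1 + c2 * l2) (t x) * v' x"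
        unfolding elim by (simp add: algebra_simps)
      finally show ?case unfolding c by simp
    qed
  qed (use c 0 1 2 closed(3) in simp_all)
qed

text \<open>
  The linear form on the plane, unique up to scaling, that vanishes on the line \<open>q\<close>.
\<close>

definition line_form :: "2 ppoint \<Rightarrow> complex ^ 2" where
  "line_form q = (\<chi> i. if i = 1 then - (rep q $ 2) else rep q $ 1)"

lemma lin_line_form: "lin (line_form q) v = rep q $ 1 * v $ 2 - rep q $ 2 * v $ 1"
  by (simp add: lin_def line_form_def sum_2)

lemma plane_kernel:
  fixes a u v :: "complex ^ 2"
  assumes "a \<noteq> 0" "lin a u = 0" "lin a v = 0" "v \<noteq> 0"
  shows "\<exists>c. u = c *s v"
proof -
  have e: "a $ 1 * u $ 1 = - (a $ 2 * u $ 2)" "a $ 1 * v $ 1 = - (a $ 2 * v $ 2)"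
    using assms(2,3) by (simp_all add: lin_def sum_2 add_eq_0_iff)
  have det: "u $ 1 * v $ 2 = u $ 2 * v $ 1"
  proof (cases "a $ 1 = 0")
    case True
    then have "a $ 2 \<noteq> 0" using assms(1) by (auto simp: vec_eq_iff forall_2)
    then show ?thesis using e True by simp
  next
    case False
    have "a $ 1 * (u $ 1 * v $ 2) = (a $ 1 * u $ 1) * v $ 2" by (simp only: mult.assoc)
    also have "\<dots> = u $ 2 * (a $ 1 * v $ 1)" unfolding e by (simp add: mult_ac)
    also have "\<dots> = a $ 1 * (u $ 2 * v $ 1)" by (simp only: mult_ac)
    finally show ?thesis using False by simp
  qed
  show ?thesis
  proof (cases "v $ 1 = 0")
    case True
    then have v2: "v $ 2 \<noteq> 0" using assms(4) by (auto simp: vec_eq_iff forall_2)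
    then have "u $ 1 = 0" using det True by simp
    then show ?thesis
      using v2 True by (intro exI[of _ "u $ 2 / v $ 2"]) (simp add: vec_eq_iff forall_2)
  next
    case False
    have "u $ 2 = u $ 1 / v $ 1 * v $ 2" using det False by (simp add: field_simps)
    then show ?thesis
      using False by (intro exI[of _ "u $ 1 / v $ 1"]) (simp add: vec_eq_iff forall_2)
  qed
qed

lemma line_form_nonzero: "q \<in> proj_space \<Longrightarrow> line_form q \<noteq> 0"
proof
  assume q: "q \<in> proj_space" and 0: "line_form q = 0"
  then have "rep q = 0" by (simp add: line_form_def vec_eq_iff forall_2)
  then show False using rep_props(2)[OF q] by simp
qed

lemma line_form_eq_0_iff:
  assumes "q \<in> proj_space" "q' \<in> proj_space"
  shows "lin (line_form q) (rep q') = 0 \<longleftrightarrow> q' = q"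
proof
  assume "lin (line_form q) (rep q') = 0"
  moreover have "lin (line_form q) (rep q) = 0" by (simp add: lin_line_form)
  ultimately obtain c where "rep q' = c *s rep q"
    using plane_kernel[OF line_form_nonzero[OF assms(1)]] rep_props(2)[OF assms(1)] by blast
  then show "q' = q" using rep_inj assms by blast
qed (simp add: lin_line_form)

lemma line_point_exists:
  assumes "q \<in> proj_space"
  obtains q' :: "2 ppoint" where "q' \<in> proj_space" "q' \<noteq> q"
proof -
  have "axis 1 1 \<noteq> (0 :: complex ^ 2)" "axis 2 1 \<noteq> (0 :: complex ^ 2)" by (simp_all add: axis_eq_0_iff)
  note * = span_in_proj_space[OF this(1)] span_in_proj_space[OF this(2)]
  have "vec.span {axis 1 1 :: complex ^ 2} \<noteq> vec.span {axis 2 1}"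
  proof
    assume "vec.span {axis 1 1 :: complex ^ 2} = vec.span {axis 2 1}"
    then have "axis 1 1 \<in> vec.span {axis 2 1 :: complex ^ 2}" using vec.span_base by blast
    then obtain c where "axis 1 1 = c *s (axis 2 1 :: complex ^ 2)" unfolding vec.span_singleton by blast
    from arg_cong[OF this, of "\<lambda>v. v $ 1"] show False by (simp add: axis_def)
  qed
  then show ?thesis using that[OF *(1)] that[OF *(2)] by blast
qed

text \<open>
  Both coordinates of the plane are combinations of the linear forms of two distinct points, so
  a binary form is a polynomial in their quotient.
\<close>

lemma binary_form_dehomogenize:
  fixes F :: "complex ^ 2 \<Rightarrow> complex"
  assumes q: "q0 \<in> proj_space" "q1 \<in> proj_space" "q0 \<noteq> q1" and F: "form d F"
  shows "\<exists>P. \<forall>v. lin (line_form q1) v \<noteq> 0 \<longrightarrow>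
    F v = lin (line_form q1) v ^ d * poly P (lin (line_form q0) v / lin (line_form q1) v)"
proof -
  obtain c where F_eq: "F = (\<lambda>u. \<Sum>\<alpha> | (\<Sum>i\<in>UNIV. \<alpha> i) = d. c \<alpha> * (\<Prod>i\<in>UNIV. (u $ i) ^ \<alpha> i))"
    using F unfolding form_def by blast
  define D where "D = rep q0 $ 1 * rep q1 $ 2 - rep q0 $ 2 * rep q1 $ 1"
  have D: "D \<noteq> 0" using line_form_eq_0_iff[OF q(1,2)] q(3) by (auto simp: lin_line_form D_def)
  define w :: "2 \<Rightarrow> complex poly" where "w i = [: - (rep q0 $ i) / D, rep q1 $ i / D :]" for i
  define P where "P = (\<Sum>\<alpha> | (\<Sum>i\<in>UNIV. \<alpha> i) = d. [:c \<alpha>:] * (\<Prod>i\<in>UNIV. w i ^ \<alpha> i))"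
  have "F v = lin (line_form q1) v ^ d * poly P (lin (line_form q0) v / lin (line_form q1) v)"
    if nz: "lin (line_form q1) v \<noteq> 0" for v
  proof -
    let ?l = "lin (line_form q1) v" and ?s = "lin (line_form q0) v / lin (line_form q1) v"
    have comb: "rep q1 $ i * lin (line_form q0) v - rep q0 $ i * ?l = D * v $ i" for i
      using exhaust_2[of i] by (auto simp: lin_line_form D_def algebra_simps)
    have "poly (w i) ?s = v $ i / ?l" for i
    proof -
      have "poly (w i) ?s = (rep q1 $ i * lin (line_form q0) v - rep q0 $ i * ?l) / (D * ?l)"
        using nz D by (simp add: w_def field_simps)
      then show ?thesis unfolding comb using D by simp
    qed
    then have "poly P ?s = F (inverse ?l *s v)"
      by (simp add: P_def F_eq poly_sum poly_prod divide_inverse mult.commute)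
    then have "poly P ?s = inverse ?l ^ d * F v" unfolding form_scale[OF F] .
    then show ?thesis using nz by (simp add: power_inverse)
  qed
  then show ?thesis by blast
qed

text \<open>
  A quotient of two linear forms in general position: the denominator misses the given points
  and the numerator distinguishes their normalised vectors.
\<close>

lemma (in variety) separating_function:
  assumes P: "finite P" "P \<subseteq> X"
  shows "\<exists>g val. inj_on val P \<and> (\<forall>p\<in>P. has_val X p g (val p))"
proof -
  have pr: "p \<in> proj_space" if "p \<in> P" for p using that P in_proj_space by blast
  obtain m where m: "\<forall>u\<in>rep ` P. lin m u \<noteq> 0"
    using exists_lin_nonzero[of "rep ` P"] P(1) rep_props(2)[OF pr] by fastforce
  let ?n = "\<lambda>p. inverse (lin m (rep p)) *s rep p"
  have ne: "?n p \<noteq> ?n p'" if "p \<in> P" "p' \<in> P" "p \<noteq> p'" for p p'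
  proof
    assume eq: "?n p = ?n p'"
    have "rep p = lin m (rep p) *s ?n p" using m that by simp
    also have "\<dots> = (lin m (rep p) * inverse (lin m (rep p'))) *s rep p'" unfolding eq by simp
    finally show False using rep_inj[OF pr pr] that by blast
  qed
  have "finite ((\<lambda>(p, p'). ?n p - ?n p') ` {(p, p'). p \<in> P \<and> p' \<in> P \<and> p \<noteq> p'})"
    by (intro finite_imageI finite_subset[OF _ finite_cartesian_product[OF P(1) P(1)]]) auto
  then obtain a where a: "\<forall>u\<in>(\<lambda>(p, p'). ?n p - ?n p') ` {(p, p'). p \<in> P \<and> p' \<in> P \<and> p \<noteq> p'}. lin a u \<noteq> 0"
    using exists_lin_nonzero ne by fastforce
  show ?thesis
  proof (intro exI conjI ballI inj_onI)
    show "has_val X p (\<lambda>q. lin a (rep q) / lin m (rep q)) (lin a (rep p) / lin m (rep p))" if "p \<in> P" for p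
      by (rule has_val_form[OF form_lin form_lin]) (use m that in auto)
    fix p p' assume pp: "p \<in> P" "p' \<in> P" and eq: "lin a (rep p) / lin m (rep p) = lin a (rep p') / lin m (rep p')"
    show "p = p'"
    proof (rule ccontr)
      assume "p \<noteq> p'"
      then have "?n p - ?n p' \<in> (\<lambda>(p, p'). ?n p - ?n p') ` {(p, p'). p \<in> P \<and> p' \<in> P \<and> p \<noteq> p'}"
        using pp by (intro image_eqI[of _ _ "(p, p')"]) auto
      with a have "lin a (?n p - ?n p') \<noteq> 0" by (rule bspec)
      then show False using eq by (simp add: lin_simps divide_inverse mult.commute)
    qed
  qed
qed

lemma (in variety) generic_form_compose_nonzero:
  assumes f: "morphism X Y f" and p: "p \<in> X" and G: "form d G" "G (rep (f p)) \<noteq> 0"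
  shows "\<forall>\<^sub>F q in generic X. G (rep (f q)) \<noteq> 0"
proof -
  have "\<forall>\<^sub>F q in generic X. G (rep (f q)) / G (rep (f q)) \<noteq> 0"
    by (rule has_val_generic_nonzero[OF has_val_form_compose[OF f p G(1) G] _ p]) (use G in simp)
  then show ?thesis by eventually_elim auto
qed

text \<open>
  A smooth curve with a nontrivial involution over a map of degree two to the line.
\<close>

locale double_cover = variety C for C :: "('n::finite) ppoint set" +
  fixes \<iota> :: "'n ppoint \<Rightarrow> 'n ppoint" and \<pi> :: "'n ppoint \<Rightarrow> 2 ppoint"
  assumes smooth: "smooth C" and dim: "zdim C = 1"
    and \<iota>: "morphism C C \<iota>" and involution: "\<And>p. p \<in> C \<Longrightarrow> \<iota> (\<iota> p) = p"
    and nontrivial: "\<exists>p\<in>C. \<iota> p \<noteq> p"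
    and \<pi>: "morphism C proj_space \<pi>" and degree: "has_degree C proj_space \<pi> 2"
    and invariant: "\<And>p. p \<in> C \<Longrightarrow> \<pi> (\<iota> p) = \<pi> p"
begin

lemma \<iota>_mem: "p \<in> C \<Longrightarrow> \<iota> p \<in> C"
  using \<iota> unfolding morphism_def by blast

lemma \<pi>_mem: "p \<in> C \<Longrightarrow> \<pi> p \<in> proj_space"
  using \<pi> unfolding morphism_def by blast

lemma \<iota>_surj: "\<iota> ` C = C"
proof
  show "C \<subseteq> \<iota> ` C"
  proof
    fix p assume "p \<in> C"
    then show "p \<in> \<iota> ` C" using imageI[OF \<iota>_mem, of p \<iota>] involution by simp
  qed
qed (use \<iota>_mem in blast)

lemmas generic_\<iota> = generic_surj[OF \<iota> \<iota>_surj variety]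
lemmas has_val_\<iota> = has_val_compose[OF \<iota> \<iota>_surj variety]
lemmas rational_\<iota> = rational_compose[OF \<iota> \<iota>_surj variety]

text \<open>
  The difference of a function and its conjugate, for a function that separates two conjugate
  points.
\<close>

lemma antiinvariant_exists:
  "\<exists>y. rational C y \<and> (\<forall>\<^sub>F x in generic C. y x \<noteq> 0) \<and> (\<forall>x\<in>C. y (\<iota> x) = - y x)"
proof -
  obtain p where p: "p \<in> C" "\<iota> p \<noteq> p" using nontrivial by blast
  have "finite {p, \<iota> p}" "{p, \<iota> p} \<subseteq> C" using p \<iota>_mem by auto
  from separating_function[OF this]
  obtain g val where g: "inj_on val {p, \<iota> p}" "\<forall>q\<in>{p, \<iota> p}. has_val C q g (val q)"
    by (elim exE conjE)
  define y where "y x = g x - g (\<iota> x)" for x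
  have y: "has_val C p y (val p - val (\<iota> p))"
    unfolding y_def[abs_def] using g(2) by (intro has_val_diff has_val_\<iota> p(1)) simp_all
  have "val p - val (\<iota> p) \<noteq> 0" using g(1) p by (auto simp: inj_on_def)
  show ?thesis
  proof (intro exI[of _ y] conjI ballI)
    show "rational C y" by (rule has_val_rational[OF y p(1)])
    show "\<forall>\<^sub>F x in generic C. y x \<noteq> 0" by (rule has_val_generic_nonzero[OF y _ p(1)]) fact
  qed (simp add: y_def involution)
qed

definition base_functions :: "('n ppoint \<Rightarrow> complex) set" where
  "base_functions = {form_quotient F G \<circ> \<pi> | d F G. form d F \<and> form d G \<and> (\<exists>q\<in>proj_space. \<not> vanishes_at G q)}"

lemma spanned_by_two:
  "\<exists>v v'. \<forall>e. rational C e \<longrightarrow> (\<exists>k\<in>base_functions. \<exists>k'\<in>base_functions.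
    \<forall>\<^sub>F x in generic C. e x = k x * v x + k' x * v' x)"
proof -
  interpret domain "function_field C" by (rule function_field_domain)
  let ?L = "{rat_class C (form_quotient F G \<circ> \<pi>) | d F G. form d F \<and> form d G \<and> (\<exists>q\<in>proj_space. \<not> vanishes_at G q)}"
  note R = function_field_eq fun_classes_simps
  have L: "?L = rat_class C ` base_functions" unfolding base_functions_def by blast
  have "dimension (Suc (Suc 0)) ?L (carrier (function_field C))"
    using degree unfolding has_degree_def by (simp add: numeral_2_eq_2)
  then obtain a E where a: "a \<in> carrier (function_field C)" "dimension (Suc 0) ?L E"
    "carrier (function_field C) = line_extension ?L a E"
    by (rule dimension.cases) auto
  from a(2) obtain b where b: "b \<in> carrier (function_field C)" "E = line_extension ?L b {\<zero>\<^bsub>function_field C\<^esub>}"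
    by (rule dimension.cases) (auto elim: dimension.cases)
  obtain v v' where v: "a = rat_class C v" "b = rat_class C v'"
    using a(1) b(1) unfolding R by blast
  show ?thesis
  proof (rule exI[of _ v], rule exI[of _ v'], intro allI impI)
    fix e assume "rational C e"
    then have "rat_class C e \<in> line_extension ?L a (line_extension ?L b {\<zero>\<^bsub>function_field C\<^esub>})"
      unfolding a(3)[symmetric] b(2)[symmetric] unfolding R by blast
    then obtain k h where k: "k \<in> base_functions" and h: "h \<in> line_extension ?L b {\<zero>\<^bsub>function_field C\<^esub>}"
      and eq_k: "rat_class C e = rat_class C k \<otimes>\<^bsub>function_field C\<^esub> a \<oplus>\<^bsub>function_field C\<^esub> h"
      unfolding line_extension_mem_iff[of "rat_class C e"] L by blast
    from h obtain k' where k': "k' \<in> base_functions"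
      and "h = rat_class C k' \<otimes>\<^bsub>function_field C\<^esub> b \<oplus>\<^bsub>function_field C\<^esub> \<zero>\<^bsub>function_field C\<^esub>"
      unfolding line_extension_mem_iff[of h] L by blast
    with eq_k have eq: "rat_class C e = rat_class C k \<otimes>\<^bsub>function_field C\<^esub> a \<oplus>\<^bsub>function_field C\<^esub>
        (rat_class C k' \<otimes>\<^bsub>function_field C\<^esub> b \<oplus>\<^bsub>function_field C\<^esub> \<zero>\<^bsub>function_field C\<^esub>)" by simp
    have "\<forall>\<^sub>F x in generic C. e x = k x * v x + k' x * v' x"
      using eq unfolding v R rat_class_eq by simp
    then show "\<exists>k\<in>base_functions. \<exists>k'\<in>base_functions. \<forall>\<^sub>F x in generic C. e x = k x * v x + k' x * v' x"
      using k k' by blast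
  qed
qed

text \<open>
  If \<open>\<pi>\<close> were constant, all pullbacks would be constants, and an antiinvariant function \<open>y\<close>
  would satisfy a quadratic equation over the complex numbers. It would then be constant,
  contradicting \<open>y \<circ> \<iota> = - y\<close>.
\<close>

lemma not_constant:
  assumes "q \<in> proj_space"
  shows "\<exists>x\<in>C. \<pi> x \<noteq> q"
proof (rule ccontr)
  assume "\<not> ?thesis"
  then have const: "\<pi> x = q" if "x \<in> C" for x using that by blast
  obtain v v' where span: "\<And>e. rational C e \<Longrightarrow> \<exists>k\<in>base_functions. \<exists>k'\<in>base_functions.
    \<forall>\<^sub>F x in generic C. e x = k x * v x + k' x * v' x" using spanned_by_two by auto
  have base: "\<exists>c. \<forall>\<^sub>F x in generic C. k x = c" if k: "k \<in> base_functions" for k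
  proof -
    obtain F G where "k = form_quotient F G \<circ> \<pi>" using k unfolding base_functions_def by blast
    then have "\<forall>\<^sub>F x in generic C. k x = form_quotient F G q"
      using generic_mem by (auto elim!: eventually_mono simp: const)
    then show ?thesis by blast
  qed
  obtain y where y: "rational C y" "\<forall>\<^sub>F x in generic C. y x \<noteq> 0" "\<And>x. x \<in> C \<Longrightarrow> y (\<iota> x) = - y x"
    using antiinvariant_exists by blast
  let ?S = "range (\<lambda>c. [:c:]) :: complex poly set"
  have "\<exists>c0\<in>?S. \<exists>c1\<in>?S. \<exists>c2\<in>?S. \<not> (c0 = 0 \<and> c1 = 0 \<and> c2 = 0) \<and>
    (\<forall>\<^sub>F x in generic C. poly c0 0 * y x ^ 0 + poly c1 0 * y x ^ 1 + poly c2 0 * y x ^ 2 = 0)"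
  proof (rule rational_functions_dependent[where t = "\<lambda>_. 0" and e = "\<lambda>i x. y x ^ i" and v = v and v' = v'])
    show "0 \<in> ?S" "1 \<in> ?S" by (auto simp: one_pCons intro: image_eqI[of _ _ 0])
    show "a * b \<in> ?S" "a - b \<in> ?S" if "a \<in> ?S" "b \<in> ?S" for a b using that by auto
    fix i :: nat
    obtain k k' where k: "k \<in> base_functions" "k' \<in> base_functions"
      and ev: "\<forall>\<^sub>F x in generic C. y x ^ i = k x * v x + k' x * v' x"
      using span[OF rational_power[OF y(1)]] by blast
    obtain c c' where c: "\<forall>\<^sub>F x in generic C. k x = c" "\<forall>\<^sub>F x in generic C. k' x = c'" using base k by blast
    show "\<exists>P\<in>?S. \<exists>Q\<in>?S. \<exists>P'\<in>?S. \<exists>Q'\<in>?S. \<forall>\<^sub>F x in generic C. poly Q 0 \<noteq> 0 \<and> poly Q' 0 \<noteq> 0 \<and>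
        y x ^ i = poly P 0 / poly Q 0 * v x + poly P' 0 / poly Q' 0 * v' x"
    proof (rule bexI[of _ "[:c:]"], rule bexI[of _ "[:1:]"], rule bexI[of _ "[:c':]"], rule bexI[of _ "[:1:]"])
      show "\<forall>\<^sub>F x in generic C. poly [:1:] 0 \<noteq> (0::complex) \<and> poly [:1:] 0 \<noteq> (0::complex) \<and>
        y x ^ i = poly [:c:] 0 / poly [:1:] 0 * v x + poly [:c':] 0 / poly [:1:] 0 * v' x"
        using ev c by eventually_elim simp
    qed auto
  qed
  then obtain c0 c1 c2 where c: "\<not> (c0 = 0 \<and> c1 = 0 \<and> c2 = 0)"
    "\<forall>\<^sub>F x in generic C. c0 + c1 * y x + c2 * y x ^ 2 = 0" by auto
  have c': "\<forall>\<^sub>F x in generic C. c0 - c1 * y x + c2 * y x ^ 2 = 0"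
    using generic_\<iota>[OF c(2)] generic_mem by eventually_elim (simp add: y(3))
  have "\<forall>\<^sub>F x in generic C. c1 = 0"
    using c(2) c' y(2)
  proof eventually_elim
    case (elim x)
    have "2 * (c1 * y x) = (c0 + c1 * y x + c2 * y x ^ 2) - (c0 - c1 * y x + c2 * y x ^ 2)" by simp
    then show ?case unfolding elim(1,2) using elim(3) by simp
  qed
  then have c1: "c1 = 0" using generic_exists by blast
  have c2: "c2 \<noteq> 0"
  proof
    assume "c2 = 0"
    then have "\<forall>\<^sub>F x in generic C. c0 = 0" using c(2) c1 by simp
    then show False using c(1) c1 \<open>c2 = 0\<close> generic_exists by blast
  qed
  define r where "r = csqrt (- c0 / c2)"
  have r2: "r\<^sup>2 = - c0 / c2" by (simp add: r_def)
  have prod: "\<forall>\<^sub>F x in generic C. (y x - r) * (y x + r) = 0"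
    using c(2)
  proof eventually_elim
    case (elim x)
    have "c2 * (y x)\<^sup>2 = c2 * r\<^sup>2" using elim c1 c2 by (simp add: r2 add_eq_0_iff)
    then have "(y x)\<^sup>2 = r\<^sup>2" using c2 by simp
    then show ?case by (simp add: power2_eq_square algebra_simps)
  qed
  have "rational C (\<lambda>x. y x - r)" by (rule rational_diff[OF y(1) rational_const])
  then consider "\<forall>\<^sub>F x in generic C. y x - r = 0" | "\<forall>\<^sub>F x in generic C. y x - r \<noteq> 0"
    using rational_dichotomy by blast
  then have "(\<forall>\<^sub>F x in generic C. y x = r) \<or> (\<forall>\<^sub>F x in generic C. y x = - r)"
  proof cases
    case 2
    from 2 prod have "\<forall>\<^sub>F x in generic C. y x = - r"
      by eventually_elim (simp add: eq_neg_iff_add_eq_0)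
    then show ?thesis ..
  qed simp
  then obtain r' where r': "\<forall>\<^sub>F x in generic C. y x = r'" by blast
  have "\<forall>\<^sub>F x in generic C. False"
    using r' generic_\<iota>[OF r'] generic_mem y(2)
  proof eventually_elim
    case (elim x)
    have "y x = - y x" using elim(1,2) y(3)[OF elim(3)] by simp
    then show ?case using elim(4) by simp
  qed
  then show False by simp
qed

lemma generic_lin_nonzero:
  assumes "a \<noteq> 0"
  shows "\<forall>\<^sub>F x in generic C. lin a (rep (\<pi> x)) \<noteq> 0"
proof -
  have "\<exists>x\<in>C. lin a (rep (\<pi> x)) \<noteq> 0"
  proof (rule ccontr)
    assume "\<not> ?thesis"
    then have 0: "lin a (rep (\<pi> x)) = 0" if "x \<in> C" for x using that by blast
    obtain x0 where x0: "x0 \<in> C" using nonempty by blast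
    obtain x1 where x1: "x1 \<in> C" "\<pi> x1 \<noteq> \<pi> x0" using not_constant[OF \<pi>_mem[OF x0]] by blast
    obtain c where "rep (\<pi> x1) = c *s rep (\<pi> x0)"
      using plane_kernel[OF assms 0[OF x1(1)] 0[OF x0]] rep_props(2)[OF \<pi>_mem[OF x0]] by blast
    then show False using rep_inj[OF \<pi>_mem[OF x1(1)] \<pi>_mem[OF x0]] x1(2) by blast
  qed
  then obtain x where "x \<in> C" "lin a (rep (\<pi> x)) \<noteq> 0" by blast
  then show ?thesis by (rule generic_form_compose_nonzero[OF \<pi> _ form_lin])
qed

text \<open>
  The coordinate of the line with zero \<open>q0\<close> and pole \<open>q1\<close>, pulled back to the curve.
\<close>

definition coordinate :: "2 ppoint \<Rightarrow> 2 ppoint \<Rightarrow> 'n ppoint \<Rightarrow> complex" where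
  "coordinate q0 q1 x = lin (line_form q0) (rep (\<pi> x)) / lin (line_form q1) (rep (\<pi> x))"

lemma coordinate_invariant: "x \<in> C \<Longrightarrow> coordinate q0 q1 (\<iota> x) = coordinate q0 q1 x"
  by (simp add: coordinate_def invariant)

lemma coordinate_inverse: "coordinate q0 q1 x = inverse (coordinate q1 q0 x)"
  by (simp add: coordinate_def)

context
  fixes q0 q1 :: "2 ppoint"
  assumes q: "q0 \<in> proj_space" "q1 \<in> proj_space" "q0 \<noteq> q1"
begin

lemma coordinate_has_val:
  assumes "x \<in> C" "\<pi> x \<noteq> q1"
  shows "has_val C x (coordinate q0 q1) (coordinate q0 q1 x)"
  unfolding coordinate_def[abs_def]
  by (rule has_val_form_compose[OF \<pi> assms(1) form_lin form_lin])
    (use assms line_form_eq_0_iff[OF q(2) \<pi>_mem] in simp)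

lemma coordinate_eq_0_iff:
  assumes "x \<in> C" "\<pi> x \<noteq> q1"
  shows "coordinate q0 q1 x = 0 \<longleftrightarrow> \<pi> x = q0"
  unfolding coordinate_def
  using assms line_form_eq_0_iff[OF q(2) \<pi>_mem] line_form_eq_0_iff[OF q(1) \<pi>_mem] by simp

lemma generic_coordinate_ne: "\<forall>\<^sub>F x in generic C. coordinate q0 q1 x \<noteq> c"
proof -
  have "line_form q0 - c *s line_form q1 \<noteq> 0"
  proof
    assume "line_form q0 - c *s line_form q1 = 0"
    then have "lin (line_form q0 - c *s line_form q1) (rep q1) = 0" by (simp add: lin_simps)
    then have "lin (line_form q0) (rep q1) = 0" by (simp add: lin_simps lin_line_form)
    then show False using line_form_eq_0_iff[OF q(1,2)] q(3) by simp
  qed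
  from generic_lin_nonzero[OF this] generic_lin_nonzero[OF line_form_nonzero[OF q(2)]]
  show ?thesis by eventually_elim (simp add: coordinate_def lin_simps field_simps)
qed

lemma coordinate_rational: "rational C (coordinate q0 q1)"
proof -
  obtain x where "x \<in> C" "\<pi> x \<noteq> q1" using not_constant q(2) by blast
  then show ?thesis using has_val_rational coordinate_has_val by blast
qed

lemma generic_poly_coordinate_nonzero:
  assumes "P \<noteq> 0"
  shows "\<forall>\<^sub>F x in generic C. poly P (coordinate q0 q1 x) \<noteq> 0"
proof -
  have "\<forall>\<^sub>F x in generic C. \<forall>c\<in>{c. poly P c = 0}. coordinate q0 q1 x \<noteq> c"
    by (intro eventually_ball_finite poly_roots_finite assms ballI generic_coordinate_ne)
  then show ?thesis by eventually_elim auto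
qed

lemma base_function_fraction:
  assumes "k \<in> base_functions"
  shows "\<exists>P Q. Q \<noteq> 0 \<and> (\<forall>\<^sub>F x in generic C. k x = poly P (coordinate q0 q1 x) / poly Q (coordinate q0 q1 x))"
proof -
  obtain d F G where k: "k = form_quotient F G \<circ> \<pi>" "form d F" "form d G"
    using assms unfolding base_functions_def by blast
  obtain P where P: "\<And>v. lin (line_form q1) v \<noteq> 0 \<Longrightarrow>
    F v = lin (line_form q1) v ^ d * poly P (lin (line_form q0) v / lin (line_form q1) v)"
    using binary_form_dehomogenize[OF q k(2)] by blast
  obtain Q where Q: "\<And>v. lin (line_form q1) v \<noteq> 0 \<Longrightarrow>
    G v = lin (line_form q1) v ^ d * poly Q (lin (line_form q0) v / lin (line_form q1) v)"
    using binary_form_dehomogenize[OF q k(3)] by blast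
  have ev: "\<forall>\<^sub>F x in generic C. k x = poly P (coordinate q0 q1 x) / poly Q (coordinate q0 q1 x)"
    using generic_lin_nonzero[OF line_form_nonzero[OF q(2)]]
    by eventually_elim (simp add: k(1) form_quotient_rep P Q coordinate_def)
  show ?thesis
  proof (cases "Q = 0")
    case True
    with ev have "\<forall>\<^sub>F x in generic C. k x = poly 0 (coordinate q0 q1 x) / poly 1 (coordinate q0 q1 x)"
      by simp
    then show ?thesis using one_neq_zero by blast
  qed (use ev in blast)
qed

text \<open>
  A common factor of the coefficients that vanishes at zero can be divided out.
\<close>

lemma three_dependent_aux:
  assumes "\<forall>\<^sub>F x in generic C. poly c0 (coordinate q0 q1 x) * e0 x + poly c1 (coordinate q0 q1 x) * e1 x
      + poly c2 (coordinate q0 q1 x) * e2 x = 0"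
    "\<not> (c0 = 0 \<and> c1 = 0 \<and> c2 = 0)"
  shows "\<exists>c0 c1 c2. \<not> (poly c0 0 = 0 \<and> poly c1 0 = 0 \<and> poly c2 0 = 0) \<and>
    (\<forall>\<^sub>F x in generic C. poly c0 (coordinate q0 q1 x) * e0 x + poly c1 (coordinate q0 q1 x) * e1 x
      + poly c2 (coordinate q0 q1 x) * e2 x = 0)"
  using assms
proof (induction "degree c0 + degree c1 + degree c2" arbitrary: c0 c1 c2 rule: less_induct)
  case less
  show ?case
  proof (cases "poly c0 0 = 0 \<and> poly c1 0 = 0 \<and> poly c2 0 = 0")
    case True
    have "\<exists>d. c = pCons 0 d" if "poly c 0 = 0" for c :: "complex poly"
      using that by (cases c) auto
    then obtain d0 d1 d2 where d: "c0 = pCons 0 d0" "c1 = pCons 0 d1" "c2 = pCons 0 d2"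
      using True by blast
    show ?thesis
    proof (rule less.hyps)
      show "degree d0 + degree d1 + degree d2 < degree c0 + degree c1 + degree c2"
        using less.prems(2) unfolding d by (auto simp: degree_pCons_eq_if)
      show "\<not> (d0 = 0 \<and> d1 = 0 \<and> d2 = 0)" using less.prems(2) unfolding d by auto
      show "\<forall>\<^sub>F x in generic C. poly d0 (coordinate q0 q1 x) * e0 x + poly d1 (coordinate q0 q1 x) * e1 x
        + poly d2 (coordinate q0 q1 x) * e2 x = 0"
        using less.prems(1) generic_coordinate_ne[of 0]
      proof eventually_elim
        case (elim x)
        have "coordinate q0 q1 x * (poly d0 (coordinate q0 q1 x) * e0 x + poly d1 (coordinate q0 q1 x) * e1 x
          + poly d2 (coordinate q0 q1 x) * e2 x) = 0"
          using elim(1) unfolding d by (simp add: algebra_simps)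
        then show ?case using elim(2) by simp
      qed
    qed
  qed (use less.prems in blast)
qed

text \<open>
  Since \<open>\<pi>\<close> has degree two, all functions are combinations of two of them over the functions
  of the line, and these are fractions of polynomials in the coordinate.
\<close>

lemma three_dependent:
  assumes e: "rational C e0" "rational C e1" "rational C e2"
  obtains c0 c1 c2 where "\<not> (poly c0 0 = 0 \<and> poly c1 0 = 0 \<and> poly c2 0 = 0)"
    "\<forall>\<^sub>F x in generic C. poly c0 (coordinate q0 q1 x) * e0 x + poly c1 (coordinate q0 q1 x) * e1 x
      + poly c2 (coordinate q0 q1 x) * e2 x = 0"
proof -
  obtain v v' where span: "\<And>e. rational C e \<Longrightarrow> \<exists>k\<in>base_functions. \<exists>k'\<in>base_functions.
    \<forall>\<^sub>F x in generic C. e x = k x * v x + k' x * v' x" using spanned_by_two by auto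
  define e where "e i = (if i = 0 then e0 else if i = 1 then e1 else e2)" for i :: nat
  have "\<exists>c0\<in>UNIV. \<exists>c1\<in>UNIV. \<exists>c2\<in>UNIV. \<not> (c0 = 0 \<and> c1 = 0 \<and> c2 = 0) \<and>
    (\<forall>\<^sub>F x in generic C. poly c0 (coordinate q0 q1 x) * e 0 x + poly c1 (coordinate q0 q1 x) * e 1 x
      + poly c2 (coordinate q0 q1 x) * e 2 x = 0)"
  proof (rule rational_functions_dependent[where t = "coordinate q0 q1" and v = v and v' = v'])
    fix i :: nat
    have "rational C (e i)" using assms by (simp add: e_def)
    then obtain k k' where k: "k \<in> base_functions" "k' \<in> base_functions"
      and ev: "\<forall>\<^sub>F x in generic C. e i x = k x * v x + k' x * v' x"
      using span by blast
    obtain P Q where PQ: "Q \<noteq> 0" "\<forall>\<^sub>F x in generic C. k x = poly P (coordinate q0 q1 x) / poly Q (coordinate q0 q1 x)"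
      using base_function_fraction[OF k(1)] by blast
    obtain P' Q' where PQ': "Q' \<noteq> 0" "\<forall>\<^sub>F x in generic C. k' x = poly P' (coordinate q0 q1 x) / poly Q' (coordinate q0 q1 x)"
      using base_function_fraction[OF k(2)] by blast
    show "\<exists>P\<in>UNIV. \<exists>Q\<in>UNIV. \<exists>P'\<in>UNIV. \<exists>Q'\<in>UNIV. \<forall>\<^sub>F x in generic C.
      poly Q (coordinate q0 q1 x) \<noteq> 0 \<and> poly Q' (coordinate q0 q1 x) \<noteq> 0 \<and>
      e i x = poly P (coordinate q0 q1 x) / poly Q (coordinate q0 q1 x) * v x
        + poly P' (coordinate q0 q1 x) / poly Q' (coordinate q0 q1 x) * v' x"
    proof (rule bexI[of _ P], rule bexI[of _ Q], rule bexI[of _ P'], rule bexI[of _ Q'])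
      show "\<forall>\<^sub>F x in generic C.
      poly Q (coordinate q0 q1 x) \<noteq> 0 \<and> poly Q' (coordinate q0 q1 x) \<noteq> 0 \<and>
      e i x = poly P (coordinate q0 q1 x) / poly Q (coordinate q0 q1 x) * v x
        + poly P' (coordinate q0 q1 x) / poly Q' (coordinate q0 q1 x) * v' x"
        using ev PQ(2) PQ'(2) generic_poly_coordinate_nonzero[OF PQ(1)] generic_poly_coordinate_nonzero[OF PQ'(1)]
        by eventually_elim simp
    qed auto
  qed auto
  then obtain c0 c1 c2 where "\<not> (c0 = 0 \<and> c1 = 0 \<and> c2 = 0)"
    "\<forall>\<^sub>F x in generic C. poly c0 (coordinate q0 q1 x) * e0 x + poly c1 (coordinate q0 q1 x) * e1 x
      + poly c2 (coordinate q0 q1 x) * e2 x = 0"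
    by (auto simp: e_def)
  from three_dependent_aux[OF this(2,1)] show ?thesis using that by blast
qed

end

end

section \<open>Orders of vanishing on a double cover\<close>

context double_cover
begin

lemma has_val_eq_0:
  assumes "has_val C p f c" "p \<in> C" "\<forall>\<^sub>F x in generic C. f x = 0"
  shows "c = 0"
proof -
  have "has_val C p f 0" by (rule has_val_cong[OF has_val_const assms(3)])
  then show ?thesis using has_val_unique assms by blast
qed

lemma poly_split_root:
  assumes "poly c 0 = (0::complex)"
  obtains d where "\<And>t. poly c t = t * poly d t"
proof -
  obtain d where "c = pCons 0 d" using assms by (cases c) auto
  then show ?thesis using that[of d] by simp
qed

lemma coordinate_has_val_0:
  assumes q: "q0 \<in> proj_space" "q1 \<in> proj_space" "q0 \<noteq> q1" and x: "x \<in> C" "\<pi> x = q0"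
  shows "has_val C x (coordinate q0 q1) 0"
proof -
  have ne: "\<pi> x \<noteq> q1" using x(2) q(3) by simp
  have "coordinate q0 q1 x = 0" using coordinate_eq_0_iff[OF q x(1) ne] x(2) by blast
  then show ?thesis using coordinate_has_val[OF q x(1) ne] by simp
qed

text \<open>
  Otherwise consider a relation between \<open>1, z, z\<^sup>2\<close>. Modulo \<open>z\<^sup>3\<close> its
  coefficients are constants, so each of them vanishes at zero.
\<close>

lemma coordinate_not_cubic:
  assumes p: "p \<in> C" and q: "q1 \<in> proj_space" "\<pi> p \<noteq> q1"
    and z: "has_val C p z 0" "\<forall>\<^sub>F x in generic C. z x \<noteq> 0"
    and r: "has_val C p r \<rho>" "\<forall>\<^sub>F x in generic C. coordinate (\<pi> p) q1 x = z x ^ 3 * r x"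
  shows False
proof -
  let ?s = "coordinate (\<pi> p) q1"
  note q' = \<pi>_mem[OF p] q
  have s: "has_val C p ?s 0" by (rule coordinate_has_val_0[OF q' p refl])
  have zr: "rational C z" by (rule has_val_rational[OF z(1) p])
  obtain c0 c1 c2 where c: "\<not> (poly c0 0 = 0 \<and> poly c1 0 = 0 \<and> poly c2 0 = 0)"
    and ev: "\<forall>\<^sub>F x in generic C. poly c0 (?s x) * 1 + poly c1 (?s x) * z x + poly c2 (?s x) * z x ^ 2 = 0"
    by (rule three_dependent[OF q' rational_const[of 1] zr rational_power[OF zr, of 2]])
  note hv = has_val_poly[OF s p]
  have "has_val C p (\<lambda>x. poly c0 (?s x) * 1 + poly c1 (?s x) * z x + poly c2 (?s x) * z x ^ 2)
      (poly c0 0 * 1 + poly c1 0 * 0 + poly c2 0 * 0 ^ 2)"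
    by (intro has_val_add has_val_mult has_val_power has_val_const hv z p)
  from has_val_eq_0[OF this p ev] have c0: "poly c0 0 = 0" by simp
  then obtain d0 where d0: "\<And>t. poly c0 t = t * poly d0 t" by (rule poly_split_root) blast
  have ev1: "\<forall>\<^sub>F x in generic C. z x ^ 2 * r x * poly d0 (?s x) + poly c1 (?s x) + poly c2 (?s x) * z x = 0"
    using ev r(2) z(2)
  proof eventually_elim
    case (elim x)
    have "z x * (z x ^ 2 * r x * poly d0 (?s x) + poly c1 (?s x) + poly c2 (?s x) * z x) =
      (z x ^ 3 * r x) * poly d0 (?s x) + poly c1 (?s x) * z x + poly c2 (?s x) * z x ^ 2"
      by (simp add: algebra_simps power2_eq_square power3_eq_cube)
    also have "\<dots> = 0" using elim(1) unfolding elim(2)[symmetric] by (simp add: d0)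
    finally show ?case using elim(3) by simp
  qed
  have "has_val C p (\<lambda>x. z x ^ 2 * r x * poly d0 (?s x) + poly c1 (?s x) + poly c2 (?s x) * z x)
      (0 ^ 2 * \<rho> * poly d0 0 + poly c1 0 + poly c2 0 * 0)"
    by (intro has_val_add has_val_mult has_val_power has_val_const hv z r p)
  from has_val_eq_0[OF this p ev1] have c1: "poly c1 0 = 0" by simp
  then obtain d1 where d1: "\<And>t. poly c1 t = t * poly d1 t" by (rule poly_split_root) blast
  have ev2: "\<forall>\<^sub>F x in generic C. z x * r x * poly d0 (?s x) + z x ^ 2 * r x * poly d1 (?s x) + poly c2 (?s x) = 0"
    using ev1 r(2) z(2)
  proof eventually_elim
    case (elim x)
    have "z x * (z x * r x * poly d0 (?s x) + z x ^ 2 * r x * poly d1 (?s x) + poly c2 (?s x)) =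
      z x ^ 2 * r x * poly d0 (?s x) + (z x ^ 3 * r x) * poly d1 (?s x) + poly c2 (?s x) * z x"
      by (simp add: algebra_simps power2_eq_square power3_eq_cube)
    also have "\<dots> = 0" using elim(1) unfolding elim(2)[symmetric] by (simp add: d1)
    finally show ?case using elim(3) by simp
  qed
  have "has_val C p (\<lambda>x. z x * r x * poly d0 (?s x) + z x ^ 2 * r x * poly d1 (?s x) + poly c2 (?s x))
      (0 * \<rho> * poly d0 0 + 0 ^ 2 * \<rho> * poly d1 0 + poly c2 0)"
    by (intro has_val_add has_val_mult has_val_power has_val_const hv z r p)
  from has_val_eq_0[OF this p ev2] have "poly c2 0 = 0" by simp
  with c c0 c1 show False by simp
qed

text \<open>
  A relation between \<open>1, a, a\<^sup>2\<close>, with the lowest nonzero coefficient isolated, exhibits \<open>a\<close> as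
  a divisor of that coefficient.
\<close>

lemma divides_base_polynomial:
  assumes p: "p \<in> C" and q: "q1 \<in> proj_space" "\<pi> p \<noteq> q1"
    and a: "has_val C p a \<alpha>" "\<forall>\<^sub>F x in generic C. a x \<noteq> 0"
  shows "\<exists>c r \<rho>. c \<noteq> 0 \<and> has_val C p r \<rho> \<and> (\<forall>\<^sub>F x in generic C. poly c (coordinate (\<pi> p) q1 x) = a x * r x)"
proof -
  let ?s = "coordinate (\<pi> p) q1"
  note q' = \<pi>_mem[OF p] q
  have s: "has_val C p ?s 0" by (rule coordinate_has_val_0[OF q' p refl])
  note hv = has_val_poly[OF s p]
  have ar: "rational C a" by (rule has_val_rational[OF a(1) p])
  obtain c0 c1 c2 where c: "\<not> (poly c0 0 = 0 \<and> poly c1 0 = 0 \<and> poly c2 0 = 0)"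
    and ev: "\<forall>\<^sub>F x in generic C. poly c0 (?s x) * 1 + poly c1 (?s x) * a x + poly c2 (?s x) * a x ^ 2 = 0"
    by (rule three_dependent[OF q' rational_const[of 1] ar rational_power[OF ar, of 2]])
  have r: "has_val C p (\<lambda>x. - (poly c1 (?s x) + poly c2 (?s x) * a x)) (- (poly c1 0 + poly c2 0 * \<alpha>))"
    by (intro has_val_minus has_val_add has_val_mult hv a p)
  have ev0: "\<forall>\<^sub>F x in generic C. poly c0 (?s x) = a x * (- (poly c1 (?s x) + poly c2 (?s x) * a x))"
    using ev
  proof eventually_elim
    case (elim x)
    have "poly c0 (?s x) - a x * (- (poly c1 (?s x) + poly c2 (?s x) * a x)) =
      poly c0 (?s x) * 1 + poly c1 (?s x) * a x + poly c2 (?s x) * a x ^ 2"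
      by (simp add: algebra_simps power2_eq_square)
    from trans[OF this elim] show ?case by (simp only: right_minus_eq)
  qed
  show ?thesis
  proof (cases "c0 = 0")
    case False
    then show ?thesis using r ev0 by blast
  next
    case True
    have ev1: "\<forall>\<^sub>F x in generic C. poly c1 (?s x) = a x * (- poly c2 (?s x))"
      using ev0 a(2)
    proof eventually_elim
      case (elim x)
      then have "- poly c1 (?s x) = poly c2 (?s x) * a x" using True by simp
      from arg_cong[OF this, of uminus] show ?case by (simp add: mult.commute)
    qed
    show ?thesis
    proof (cases "c1 = 0")
      case False
      then show ?thesis using has_val_minus[OF hv[of c2]] ev1 by blast
    next
      case c1: True
      then have c2: "c2 \<noteq> 0" using c True by auto
      have "\<forall>\<^sub>F x in generic C. False"
        using ev1 a(2) generic_poly_coordinate_nonzero[OF q' c2] by eventually_elim (simp add: c1)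
      then show ?thesis by simp
    qed
  qed
qed

text \<open>
  The generator \<open>z\<close> of the maximal ideal is a uniformizer once no nonzero element is divisible
  by all its powers. Every element divides a polynomial in the coordinate \<open>s\<close> of the line, hence a unit times a
  power of \<open>s\<close>, and \<open>s\<close> is a unit times a power of \<open>z\<close> because it is not divisible by \<open>z\<^sup>3\<close>.
\<close>

lemma uniformizer_exists:
  assumes p: "p \<in> C"
  shows "\<exists>z. uniformizer C p z"
proof -
  obtain q1 where q: "q1 \<in> proj_space" "q1 \<noteq> \<pi> p" using line_point_exists[OF \<pi>_mem[OF p]] by blast
  then have q1: "\<pi> p \<noteq> q1" by simp
  note q' = \<pi>_mem[OF p] q(1) q1
  let ?s = "coordinate (\<pi> p) q1"
  have s: "has_val C p ?s 0" by (rule coordinate_has_val_0[OF q' p refl])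
  obtain z where z: "has_val C p z 0"
    and div: "\<And>a. has_val C p a 0 \<Longrightarrow> \<exists>b c. has_val C p b c \<and> (\<forall>\<^sub>F q in generic C. a q = z q * b q)"
    using maximal_ideal_principal[OF smooth dim p] by blast
  obtain b1 \<beta>1 where b1: "has_val C p b1 \<beta>1" "\<forall>\<^sub>F x in generic C. ?s x = z x * b1 x" using div[OF s] by blast
  have znz: "\<forall>\<^sub>F x in generic C. z x \<noteq> 0"
    using b1(2) generic_coordinate_ne[OF q', of 0] by eventually_elim auto
  have "\<exists>i::nat. \<exists>w. unit_at C p w \<and> (\<forall>\<^sub>F x in generic C. ?s x = z x ^ i * w x)"
  proof (cases "\<beta>1 = 0")
    case False
    have "\<forall>\<^sub>F x in generic C. ?s x = z x ^ 1 * b1 x" using b1(2) by simp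
    then show ?thesis using b1(1) False unfolding unit_at_def by blast
  next
    case True
    then obtain b2 \<beta>2 where b2: "has_val C p b2 \<beta>2" "\<forall>\<^sub>F x in generic C. b1 x = z x * b2 x"
      using div b1(1) by blast
    have e2: "\<forall>\<^sub>F x in generic C. ?s x = z x ^ 2 * b2 x"
      using b1(2) b2(2) by eventually_elim (simp add: power2_eq_square)
    show ?thesis
    proof (cases "\<beta>2 = 0")
      case False
      then show ?thesis using b2(1) e2 unfolding unit_at_def by blast
    next
      case True
      then obtain b3 \<beta>3 where b3: "has_val C p b3 \<beta>3" "\<forall>\<^sub>F x in generic C. b2 x = z x * b3 x"
        using div b2(1) by blast
      have "\<forall>\<^sub>F x in generic C. ?s x = z x ^ 3 * b3 x"
        using e2 b3(2) by eventually_elim (simp add: power2_eq_square power3_eq_cube)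
      from coordinate_not_cubic[OF p q(1) q1 z znz b3(1) this] show ?thesis ..
    qed
  qed
  then obtain i :: nat and w where w: "unit_at C p w" "\<forall>\<^sub>F x in generic C. ?s x = z x ^ i * w x" by blast
  have regular: "\<exists>n::nat. \<exists>u. unit_at C p u \<and> (\<forall>\<^sub>F x in generic C. a x = z x ^ n * u x)"
    if a: "has_val C p a \<alpha>" "\<forall>\<^sub>F x in generic C. a x \<noteq> 0" for a \<alpha>
  proof -
    obtain c r \<rho> where c: "c \<noteq> 0" and r: "has_val C p r \<rho>"
      and cr: "\<forall>\<^sub>F x in generic C. poly c (?s x) = a x * r x"
      using divides_base_polynomial[OF p q(1) q1 a] by blast
    obtain d where d: "c = [:- 0, 1:] ^ Polynomial.order 0 c * d" "\<not> [:- 0, 1:] dvd d"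
      using order_decomp[OF c, of 0] by blast
    from d(2) have d0: "poly d 0 \<noteq> 0" by (simp only: poly_eq_0_iff_dvd not_False_eq_True)
    define m where "m = Polynomial.order 0 c"
    have "c = [:- 0, 1:] ^ m * d" using d(1) unfolding m_def .
    then have cm: "poly c t = t ^ m * poly d t" for t by simp
    obtain \<omega> where \<omega>: "has_val C p w \<omega>" "\<omega> \<noteq> 0" using w(1) unfolding unit_at_def by blast
    have v: "has_val C p (\<lambda>x. w x ^ m * poly d (?s x)) (\<omega> ^ m * poly d 0)"
      by (intro has_val_mult has_val_power \<omega> has_val_poly s p)
    let ?P = "\<lambda>n. \<exists>b \<beta>. has_val C p b \<beta> \<and> (\<forall>\<^sub>F x in generic C. a x = z x ^ n * b x)"
    (* The multiple c(s) of a is a unit times the power i * m of z, which bounds the exponent for a. *)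
    have "\<not> ?P (Suc (i * m))"
    proof
      assume "?P (Suc (i * m))"
      then obtain b \<beta> where b: "has_val C p b \<beta>" "\<forall>\<^sub>F x in generic C. a x = z x ^ Suc (i * m) * b x" by blast
      have "has_val C p (\<lambda>x. z x * b x * r x) (0 * \<beta> * \<rho>)" by (intro has_val_mult z b r)
      moreover have "\<forall>\<^sub>F x in generic C. w x ^ m * poly d (?s x) = z x * b x * r x"
        using cr w(2) b(2) znz
      proof eventually_elim
        case (elim x)
        have "z x ^ (i * m) * (w x ^ m * poly d (?s x)) = (z x ^ i * w x) ^ m * poly d (?s x)"
          by (simp add: power_mult_distrib power_mult)
        also have "\<dots> = poly c (?s x)" unfolding elim(2)[symmetric] cm ..
        also have "\<dots> = z x ^ (i * m) * (z x * b x * r x)"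
          unfolding elim(1) elim(3) by simp
        finally show ?case using elim(4) by simp
      qed
      ultimately have "has_val C p (\<lambda>x. w x ^ m * poly d (?s x)) (0 * \<beta> * \<rho>)" by (rule has_val_cong)
      from has_val_unique[OF this v p] show False using \<omega>(2) d0 by simp
    qed
    moreover have "?P 0" by (rule exI[of _ a], rule exI[of _ \<alpha>]) (use a in simp)
    ultimately obtain n where n: "?P n" "\<not> ?P (Suc n)"
    proof -
      assume 1: "\<not> ?P (Suc (i * m))" and 0: "?P 0"
        and t: "\<And>n. ?P n \<Longrightarrow> \<not> ?P (Suc n) \<Longrightarrow> thesis"
      show thesis
      proof (rule ccontr)
        assume "\<not> thesis"
        then have step: "?P (Suc n)" if "?P n" for n using t that by blast
        have "?P n" for n
        proof (induction n)
          case 0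
          show ?case by (rule \<open>?P 0\<close>)
        next
          case (Suc n)
          then show ?case by (rule step)
        qed
        then show False using 1 by blast
      qed
    qed
    then obtain b \<beta> where b: "has_val C p b \<beta>" "\<forall>\<^sub>F x in generic C. a x = z x ^ n * b x" by blast
    have "\<beta> \<noteq> 0"
    proof
      assume "\<beta> = 0"
      then obtain b' \<beta>' where b': "has_val C p b' \<beta>'" "\<forall>\<^sub>F x in generic C. b x = z x * b' x"
        using div b(1) by blast
      have "\<forall>\<^sub>F x in generic C. a x = z x ^ Suc n * b' x"
        using b(2) b'(2) by eventually_elim simp
      then show False using n(2) b'(1) by blast
    qed
    then show ?thesis using b unfolding unit_at_def by blast
  qed
  show ?thesis
  proof (intro exI[of _ z], unfold uniformizer_def, intro conjI allI impI z znz)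
    fix r assume r: "rational C r" "\<forall>\<^sub>F x in generic C. r x \<noteq> 0"
    obtain a b \<alpha> \<beta> where ab: "has_val C p a \<alpha>" "has_val C p b \<beta>"
      "\<forall>\<^sub>F x in generic C. b x \<noteq> 0" "\<forall>\<^sub>F x in generic C. r x = a x / b x"
      by (rule rational_local_fraction[OF r(1) p])
    have a0: "\<forall>\<^sub>F x in generic C. a x \<noteq> 0" using r(2) ab(4) by eventually_elim auto
    obtain n :: nat and u where u: "unit_at C p u" "\<forall>\<^sub>F x in generic C. a x = z x ^ n * u x"
      using regular[OF ab(1) a0] by blast
    obtain k :: nat and v where v: "unit_at C p v" "\<forall>\<^sub>F x in generic C. b x = z x ^ k * v x"
      using regular[OF ab(2,3)] by blast
    have "\<forall>\<^sub>F x in generic C. r x = z x powi (int n - int k) * (u x / v x)"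
      using u(2) v(2) ab(4) znz
      by eventually_elim (simp add: power_int_diff)
    then show "\<exists>k u. unit_at C p u \<and> (\<forall>\<^sub>F x in generic C. r x = z x powi k * u x)"
      using unit_at_divide[OF u(1) v(1)] by blast
  qed
qed

text \<open>
  The choice is immaterial: orders of vanishing do not depend on it.
\<close>

definition unif :: "'n ppoint \<Rightarrow> 'n ppoint \<Rightarrow> complex" where
  "unif p = (SOME z. uniformizer C p z)"

lemma unif: "p \<in> C \<Longrightarrow> uniformizer C p (unif p)"
  unfolding unif_def using uniformizer_exists by (rule someI_ex)

lemma unif_val: "p \<in> C \<Longrightarrow> has_val C p (unif p) 0"
  and unif_nonzero: "p \<in> C \<Longrightarrow> \<forall>\<^sub>F x in generic C. unif p x \<noteq> 0"
  using unif unfolding uniformizer_def by blast+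

abbreviation nonzero :: "('n ppoint \<Rightarrow> complex) \<Rightarrow> bool" where
  "nonzero r \<equiv> rational C r \<and> (\<forall>\<^sub>F x in generic C. r x \<noteq> 0)"

lemma vord_repr:
  assumes "p \<in> C" "nonzero r"
  shows "\<exists>u. unit_at C p u \<and> (\<forall>\<^sub>F x in generic C. r x = unif p x powi (vord C p r) * u x)"
proof -
  obtain u where "unit_at C p u" "\<forall>\<^sub>F x in generic C. r x = unif p x powi (vord C p r) * u x"
    by (rule vord_decomp[OF unif[OF assms(1)] assms(1)]) (use assms in auto)
  then show ?thesis by blast
qed

lemma vord_mult:
  assumes p: "p \<in> C" and r: "nonzero r" "nonzero r'"
  shows "vord C p (\<lambda>x. r x * r' x) = vord C p r + vord C p r'"
proof -
  obtain u where u: "unit_at C p u" "\<forall>\<^sub>F x in generic C. r x = unif p x powi (vord C p r) * u x"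
    using vord_repr[OF p r(1)] by blast
  obtain u' where u': "unit_at C p u'" "\<forall>\<^sub>F x in generic C. r' x = unif p x powi (vord C p r') * u' x"
    using vord_repr[OF p r(2)] by blast
  show ?thesis
  proof (rule vord_eq[OF unif[OF p] p unit_at_mult[OF u(1) u'(1)]])
    show "\<forall>\<^sub>F x in generic C. r x * r' x = unif p x powi (vord C p r + vord C p r') * (u x * u' x)"
      using u(2) u'(2) unif_nonzero[OF p]
    proof eventually_elim
      case (elim x)
      have "r x * r' x = (unif p x powi vord C p r * unif p x powi vord C p r') * (u x * u' x)"
        unfolding elim(1,2) by (simp only: mult_ac)
      then show ?case using elim(3) by (simp add: power_int_add)
    qed
  qed
qed

lemma vord_inverse:
  assumes p: "p \<in> C" and r: "nonzero r"
  shows "vord C p (\<lambda>x. inverse (r x)) = - vord C p r"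
proof -
  obtain u where u: "unit_at C p u" "\<forall>\<^sub>F x in generic C. r x = unif p x powi (vord C p r) * u x"
    using vord_repr[OF p r(1)] by blast
  show ?thesis
  proof (rule vord_eq[OF unif[OF p] p unit_at_inverse[OF u(1)]])
    show "\<forall>\<^sub>F x in generic C. inverse (r x) = unif p x powi (- vord C p r) * inverse (u x)"
      using u(2)
    proof eventually_elim
      case (elim x)
      show ?case by (subst elim) (simp add: power_int_minus inverse_mult_distrib)
    qed
  qed
qed

lemma vord_unit: "p \<in> C \<Longrightarrow> unit_at C p u \<Longrightarrow> vord C p u = 0"
  by (rule vord_eq[OF unif]) auto

lemma vord_ge_imp:
  assumes p: "p \<in> C" and r: "nonzero r" and n: "int n \<le> vord C p r"
  shows "\<exists>b \<beta>. has_val C p b \<beta> \<and> (\<forall>\<^sub>F x in generic C. r x = unif p x ^ n * b x)"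
proof -
  obtain u where u: "unit_at C p u" "\<forall>\<^sub>F x in generic C. r x = unif p x powi (vord C p r) * u x"
    using vord_repr[OF p r(1)] by blast
  obtain \<mu> where \<mu>: "has_val C p u \<mu>" using u(1) unfolding unit_at_def by blast
  define k where "k = nat (vord C p r - int n)"
  have k: "vord C p r = int (n + k)" using n by (simp add: k_def)
  have "has_val C p (\<lambda>x. unif p x ^ k * u x) (0 ^ k * \<mu>)"
    by (intro has_val_mult has_val_power unif_val p \<mu>)
  moreover have "\<forall>\<^sub>F x in generic C. r x = unif p x ^ n * (unif p x ^ k * u x)"
    using u(2)
  proof eventually_elim
    case (elim x)
    show ?case by (subst elim) (simp only: k power_int_of_nat power_add mult.assoc)
  qed
  ultimately show ?thesis by blast
qed

lemma vord_pos:
  assumes p: "p \<in> C" and r: "has_val C p r 0" "\<forall>\<^sub>F x in generic C. r x \<noteq> 0"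
  shows "1 \<le> vord C p r"
proof (rule ccontr)
  assume neg: "\<not> 1 \<le> vord C p r"
  have rn: "nonzero r" using has_val_rational[OF r(1) p] r(2) by simp
  obtain u where u: "unit_at C p u" "\<forall>\<^sub>F x in generic C. r x = unif p x powi (vord C p r) * u x"
    using vord_repr[OF p rn] by blast
  define k where "k = nat (- vord C p r)"
  have k: "vord C p r = - int k" using neg by (simp add: k_def)
  have "has_val C p (\<lambda>x. unif p x ^ k * r x) (0 ^ k * 0)"
    by (intro has_val_mult has_val_power unif_val p r)
  moreover have "\<forall>\<^sub>F x in generic C. u x = unif p x ^ k * r x"
    using u(2) unif_nonzero[OF p]
  proof eventually_elim
    case (elim x)
    have "r x = inverse (unif p x ^ k) * u x" unfolding elim(1) k by (simp add: power_int_minus)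
    then show ?case using elim(2) by simp
  qed
  ultimately have "has_val C p u (0 ^ k * 0)" by (rule has_val_cong)
  then show False using u(1) has_val_unique[OF _ _ p] unfolding unit_at_def by fastforce
qed

sublocale iota: variety_iso C C \<iota> \<iota>
  by standard (use closed \<iota> involution in auto)

lemma vord_\<iota>:
  assumes "p \<in> C" "nonzero r"
  shows "vord C (\<iota> p) (\<lambda>x. r (\<iota> x)) = vord C p r"
  using iota.vord_transport[OF assms(1) unif[OF assms(1)]] assms(2) by simp

lemma coordinate_nonzero:
  assumes "q0 \<in> proj_space" "q1 \<in> proj_space" "q0 \<noteq> q1"
  shows "nonzero (coordinate q0 q1)"
  using coordinate_rational[OF assms] generic_coordinate_ne[OF assms] by simp

lemma vord_coordinate_le_2:
  assumes p: "p \<in> C" and q: "q1 \<in> proj_space" "\<pi> p \<noteq> q1"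
  shows "vord C p (coordinate (\<pi> p) q1) \<le> 2"
proof (rule ccontr)
  assume "\<not> ?thesis"
  then have "int 3 \<le> vord C p (coordinate (\<pi> p) q1)" by simp
  from vord_ge_imp[OF p coordinate_nonzero[OF \<pi>_mem[OF p] q] this]
  obtain b \<beta> where "has_val C p b \<beta>" "\<forall>\<^sub>F x in generic C. coordinate (\<pi> p) q1 x = unif p x ^ 3 * b x" by blast
  then show False by (rule coordinate_not_cubic[OF p q unif_val[OF p] unif_nonzero[OF p]])
qed

lemma vord_coordinate_ge_1:
  assumes p: "p \<in> C" and q: "q1 \<in> proj_space" "\<pi> p \<noteq> q1"
  shows "1 \<le> vord C p (coordinate (\<pi> p) q1)"
proof (rule vord_pos[OF p])
  note q' = \<pi>_mem[OF p] q
  show "has_val C p (coordinate (\<pi> p) q1) 0" by (rule coordinate_has_val_0[OF q' p refl])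
  show "\<forall>\<^sub>F x in generic C. coordinate (\<pi> p) q1 x \<noteq> 0" by (rule generic_coordinate_ne[OF q'])
qed

text \<open>
  If \<open>s\<close> were itself a uniformizer at a fixed point, an antiinvariant function would be
  \<open>s\<^sup>k * v\<close> with a unit \<open>v\<close>, and \<open>v\<close> would be antiinvariant as well. Its value at the fixed point would be
  zero.
\<close>

lemma vord_coordinate_fixed:
  assumes p: "p \<in> C" and q: "q1 \<in> proj_space" "\<pi> p \<noteq> q1" and fixed: "\<iota> p = p"
  shows "vord C p (coordinate (\<pi> p) q1) = 2"
proof -
  let ?s = "coordinate (\<pi> p) q1"
  have "vord C p ?s \<noteq> 1"
  proof
    assume 1: "vord C p ?s = 1"
    obtain w where w: "unit_at C p w" "\<forall>\<^sub>F x in generic C. ?s x = unif p x powi 1 * w x"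
      using vord_repr[OF p coordinate_nonzero[OF \<pi>_mem[OF p] q]] unfolding 1 by blast
    obtain y where y: "rational C y" "\<forall>\<^sub>F x in generic C. y x \<noteq> 0" "\<And>x. x \<in> C \<Longrightarrow> y (\<iota> x) = - y x"
      using antiinvariant_exists by blast
    define k where "k = vord C p y"
    obtain u where u: "unit_at C p u" "\<forall>\<^sub>F x in generic C. y x = unif p x powi k * u x"
      using vord_repr[OF p, of y] y unfolding k_def by blast
    define v where "v x = u x / w x powi k" for x
    have v: "unit_at C p v" unfolding v_def[abs_def] by (rule unit_at_divide[OF u(1) unit_at_powi[OF w(1)]])
    have yv: "\<forall>\<^sub>F x in generic C. y x = ?s x powi k * v x"
      using u(2) w(2) unit_at_nonzero[OF w(1) p]
    proof eventually_elim
      case (elim x)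
      have "?s x powi k = unif p x powi k * w x powi k" unfolding elim(2) by (simp add: power_int_mult_distrib)
      then show ?case unfolding elim(1) v_def using elim(3) by simp
    qed
    have ev: "\<forall>\<^sub>F x in generic C. v (\<iota> x) = - v x"
      using yv generic_\<iota>[OF yv] generic_mem generic_coordinate_ne[OF \<pi>_mem[OF p] q, of 0]
    proof eventually_elim
      case (elim x)
      have "?s x powi k * v (\<iota> x) = y (\<iota> x)" using elim(2) coordinate_invariant[OF elim(3)] by simp
      also have "\<dots> = ?s x powi k * (- v x)" using elim(1) y(3)[OF elim(3)] by simp
      finally have eq: "?s x powi k * v (\<iota> x) = ?s x powi k * (- v x)" .
      have nz: "?s x powi k \<noteq> 0" using elim(4) by simp
      show ?case by (rule iffD1[OF mult_left_cancel[OF nz] eq])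
    qed
    obtain c where c: "has_val C p v c" "c \<noteq> 0" using v unfolding unit_at_def by blast
    have "has_val C p (\<lambda>x. v (\<iota> x)) c" using has_val_\<iota>[OF p] c(1) fixed by simp
    moreover have "has_val C p (\<lambda>x. v (\<iota> x)) (- c)" by (rule has_val_cong[OF has_val_minus[OF c(1)] ev])
    ultimately have "c = - c" by (rule has_val_unique[OF _ _ p])
    then show False using c(2) by simp
  qed
  then show ?thesis using vord_coordinate_le_2[OF p q] vord_coordinate_ge_1[OF p q] by linarith
qed

text \<open>
  A numerator of the uniformizer is regular at both points and a parameter at \<open>p\<close>. Adding a
  multiple of the square of a function that is zero at \<open>p\<close> and one at \<open>p'\<close> adjusts the value at \<open>p'\<close> without
  affecting the first order at \<open>p\<close>.
\<close>

lemma parameter_with_value: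
  assumes p: "p \<in> C" and p': "p' \<in> C" "p' \<noteq> p"
  shows "\<exists>g u. has_val C p' g 1 \<and> unit_at C p u \<and> (\<forall>\<^sub>F x in generic C. g x = unif p x * u x)"
proof -
  have pr: "p \<in> proj_space" "p' \<in> proj_space" using p p' in_proj_space by auto
  obtain d F G where F: "form d F" "form d G" "G (rep p) \<noteq> 0" "F (rep p) = 0 * G (rep p)"
    "\<forall>\<^sub>F x in generic C. unif p x = F (rep x) / G (rep x)"
    using unif_val[OF p] unfolding has_val_def by blast
  obtain m where m: "\<forall>u\<in>{rep p, rep p'}. lin m u \<noteq> 0"
    using exists_lin_nonzero[of "{rep p, rep p'}"] rep_props(2) pr by auto
  have m1: "lin m (rep p) ^ d \<noteq> 0" and m2: "lin m (rep p') ^ d \<noteq> 0" using m by auto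
  have M: "form d (\<lambda>u. lin m u ^ d)" using form_power[OF form_lin, of d m] by simp
  define g1 where "g1 x = F (rep x) / lin m (rep x) ^ d" for x
  define e where "e x = G (rep x) / lin m (rep x) ^ d" for x
  have g1: "has_val C p' g1 (g1 p')"
    unfolding g1_def[abs_def] by (rule has_val_form[OF F(1) M m2])
  have e: "has_val C p e (e p)" unfolding e_def[abs_def] by (rule has_val_form[OF F(2) M m1])
  have e0: "e p \<noteq> 0" using F(3) m1 by (simp add: e_def)
  have g1e: "\<forall>\<^sub>F x in generic C. g1 x = unif p x * e x"
    using F(5) generic_form_nonzero[OF F(2) p F(3)] generic_form_nonzero[OF M p m1]
    by eventually_elim (simp add: g1_def e_def)
  have "finite {p, p'}" "{p, p'} \<subseteq> C" using p p' by auto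
  from separating_function[OF this]
  obtain h val where h: "inj_on val {p, p'}" "\<forall>q\<in>{p, p'}. has_val C q h (val q)" by (elim exE conjE)
  have hp: "has_val C p h (val p)" "has_val C p' h (val p')" using h(2) by auto
  have hne: "val p' - val p \<noteq> 0" using h(1) p'(2) by (auto simp: inj_on_def)
  define k where "k x = (h x - val p) / (val p' - val p)" for x
  have kp: "has_val C p k 0"
    unfolding k_def[abs_def] using has_val_divide[OF has_val_diff[OF hp(1) has_val_const p] has_val_const hne, of "val p"] by simp
  have kp': "has_val C p' k 1"
    unfolding k_def[abs_def] using has_val_divide[OF has_val_diff[OF hp(2) has_val_const p'(1)] has_val_const hne, of "val p"] hne by simp
  have kne: "\<forall>\<^sub>F x in generic C. k x \<noteq> 0" by (rule has_val_generic_nonzero[OF kp' _ p'(1)]) simp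
  have "nonzero k" using has_val_rational[OF kp p] kne by simp
  moreover have "int 1 \<le> vord C p k" using vord_pos[OF p kp kne] by simp
  ultimately obtain b \<beta> where b: "has_val C p b \<beta>" "\<forall>\<^sub>F x in generic C. k x = unif p x ^ 1 * b x"
    using vord_ge_imp[OF p] by blast
  (* The square vanishes to second order at p. *)
  define g where "g x = g1 x + (1 - g1 p') * k x ^ 2" for x
  have "has_val C p' g (g1 p' + (1 - g1 p') * 1 ^ 2)"
    unfolding g_def[abs_def] by (intro has_val_add has_val_mult has_val_power has_val_const g1 kp' p')
  then have g: "has_val C p' g 1" by simp
  define u where "u x = e x + (1 - g1 p') * (unif p x * b x ^ 2)" for x
  have "has_val C p u (e p + (1 - g1 p') * (0 * \<beta> ^ 2))"
    unfolding u_def[abs_def] by (intro has_val_add has_val_mult has_val_power has_val_const e b unif_val p)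
  then have u: "unit_at C p u" using e0 unfolding unit_at_def by (intro exI[of _ "e p"]) simp
  have "\<forall>\<^sub>F x in generic C. g x = unif p x * u x"
    using g1e b(2) by eventually_elim (simp add: g_def u_def algebra_simps power2_eq_square)
  then show ?thesis using g u by blast
qed

text \<open>
  A double point and a further point would exceed the degree. Take \<open>g\<close> vanishing to first
  order at \<open>p\<close> with value one at \<open>p'\<close>, and constants \<open>c0, c1, c2\<close> from a relation between
  \<open>1, g, g\<^sup>2\<close> at \<open>s = 0\<close>. Expanding at \<open>p\<close> modulo second order gives \<open>c0 = c1 = 0\<close>, and
  evaluation at \<open>p'\<close> gives \<open>c0 + c1 + c2 = 0\<close>.
\<close>

lemma fiber_double_point:
  assumes p: "p \<in> C" and q: "q1 \<in> proj_space" "\<pi> p \<noteq> q1" and two: "2 \<le> vord C p (coordinate (\<pi> p) q1)"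
    and p': "p' \<in> C" "\<pi> p' = \<pi> p"
  shows "p' = p"
proof (rule ccontr)
  assume ne: "p' \<noteq> p"
  let ?s = "coordinate (\<pi> p) q1"
  note q' = \<pi>_mem[OF p] q
  have s: "has_val C p ?s 0" "has_val C p' ?s 0"
    by (rule coordinate_has_val_0[OF q' p refl], rule coordinate_has_val_0[OF q' p'])
  obtain g u where g: "has_val C p' g 1" and u: "unit_at C p u"
    and gu: "\<forall>\<^sub>F x in generic C. g x = unif p x * u x"
    using parameter_with_value[OF p p'(1) ne] by blast
  obtain \<mu> where \<mu>: "has_val C p u \<mu>" "\<mu> \<noteq> 0" using u unfolding unit_at_def by blast
  have gr: "rational C g" by (rule has_val_rational[OF g p'(1)])
  obtain c0 c1 c2 where c: "\<not> (poly c0 0 = 0 \<and> poly c1 0 = 0 \<and> poly c2 0 = 0)"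
    and ev: "\<forall>\<^sub>F x in generic C. poly c0 (?s x) * 1 + poly c1 (?s x) * g x + poly c2 (?s x) * g x ^ 2 = 0"
    by (rule three_dependent[OF q' rational_const[of 1] gr rational_power[OF gr, of 2]])
  have "has_val C p' (\<lambda>x. poly c0 (?s x) * 1 + poly c1 (?s x) * g x + poly c2 (?s x) * g x ^ 2)
      (poly c0 0 * 1 + poly c1 0 * 1 + poly c2 0 * 1 ^ 2)"
    by (intro has_val_add has_val_mult has_val_power has_val_const has_val_poly s g p')
  from has_val_eq_0[OF this p'(1) ev] have sum: "poly c0 0 + poly c1 0 + poly c2 0 = 0" by simp
  note z = unif_val[OF p] unif_nonzero[OF p]
  have "int 2 \<le> vord C p ?s" using two by simp
  from vord_ge_imp[OF p coordinate_nonzero[OF q'] this]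
  obtain b \<beta> where b: "has_val C p b \<beta>" "\<forall>\<^sub>F x in generic C. ?s x = unif p x ^ 2 * b x" by blast
  have gp: "has_val C p g 0" using has_val_cong[OF has_val_mult[OF z(1) \<mu>(1)] gu] by simp
  have "has_val C p (\<lambda>x. poly c0 (?s x) * 1 + poly c1 (?s x) * g x + poly c2 (?s x) * g x ^ 2)
      (poly c0 0 * 1 + poly c1 0 * 0 + poly c2 0 * 0 ^ 2)"
    by (intro has_val_add has_val_mult has_val_power has_val_const has_val_poly s gp p)
  from has_val_eq_0[OF this p ev] have c0: "poly c0 0 = 0" by simp
  then obtain d0 where d0: "\<And>t. poly c0 t = t * poly d0 t" by (rule poly_split_root) blast
  have ev1: "\<forall>\<^sub>F x in generic C. unif p x * b x * poly d0 (?s x) + poly c1 (?s x) * u x + poly c2 (?s x) * (unif p x * u x ^ 2) = 0"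
    using ev b(2) gu z(2)
  proof eventually_elim
    case (elim x)
    have "unif p x * (unif p x * b x * poly d0 (?s x) + poly c1 (?s x) * u x + poly c2 (?s x) * (unif p x * u x ^ 2)) =
      (unif p x ^ 2 * b x) * poly d0 (?s x) + poly c1 (?s x) * (unif p x * u x) + poly c2 (?s x) * (unif p x * u x) ^ 2"
      by (simp add: algebra_simps power2_eq_square)
    also have "\<dots> = 0" using elim(1) unfolding elim(2)[symmetric] elim(3)[symmetric] by (simp add: d0)
    finally show ?case using elim(4) by simp
  qed
  have "has_val C p (\<lambda>x. unif p x * b x * poly d0 (?s x) + poly c1 (?s x) * u x + poly c2 (?s x) * (unif p x * u x ^ 2))
      (0 * \<beta> * poly d0 0 + poly c1 0 * \<mu> + poly c2 0 * (0 * \<mu> ^ 2))"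
    by (intro has_val_add has_val_mult has_val_power has_val_const has_val_poly s b \<mu> z p)
  from has_val_eq_0[OF this p ev1] have c1: "poly c1 0 = 0" using \<mu>(2) by simp
  show False using c c0 c1 sum by simp
qed

text \<open>
  A function separating the three points would have three distinct roots of a nonzero
  polynomial of degree at most two as its values.
\<close>

lemma fiber_three_points:
  assumes p: "p1 \<in> C" "p2 \<in> C" "p3 \<in> C" "\<pi> p2 = \<pi> p1" "\<pi> p3 = \<pi> p1"
    and ne: "p1 \<noteq> p2" "p1 \<noteq> p3" "p2 \<noteq> p3"
  shows False
proof -
  obtain q1 where "q1 \<in> proj_space" "q1 \<noteq> \<pi> p1" using line_point_exists[OF \<pi>_mem[OF p(1)]] by blast
  then have q': "\<pi> p1 \<in> proj_space" "q1 \<in> proj_space" "\<pi> p1 \<noteq> q1" using \<pi>_mem[OF p(1)] by auto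
  let ?s = "coordinate (\<pi> p1) q1"
  have s: "has_val C p1 ?s 0" "has_val C p2 ?s 0" "has_val C p3 ?s 0"
    by (rule coordinate_has_val_0[OF q' p(1) refl], rule coordinate_has_val_0[OF q' p(2,4)],
        rule coordinate_has_val_0[OF q' p(3,5)])
  have "finite {p1, p2, p3}" "{p1, p2, p3} \<subseteq> C" using p by auto
  from separating_function[OF this]
  obtain g val where g: "inj_on val {p1, p2, p3}" "\<forall>q\<in>{p1, p2, p3}. has_val C q g (val q)" by (elim exE conjE)
  have gp: "has_val C p1 g (val p1)" "has_val C p2 g (val p2)" "has_val C p3 g (val p3)" using g(2) by auto
  have gr: "rational C g" by (rule has_val_rational[OF gp(1) p(1)])
  obtain c0 c1 c2 where c: "\<not> (poly c0 0 = 0 \<and> poly c1 0 = 0 \<and> poly c2 0 = 0)"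
    and ev: "\<forall>\<^sub>F x in generic C. poly c0 (?s x) * 1 + poly c1 (?s x) * g x + poly c2 (?s x) * g x ^ 2 = 0"
    by (rule three_dependent[OF q' rational_const[of 1] gr rational_power[OF gr, of 2]])
  have root: "poly c0 0 + poly c1 0 * \<gamma> + poly c2 0 * \<gamma> ^ 2 = 0"
    if x: "x \<in> C" and hs: "has_val C x ?s 0" and hg: "has_val C x g \<gamma>" for x \<gamma>
  proof -
    have "has_val C x (\<lambda>x. poly c0 (?s x) * 1 + poly c1 (?s x) * g x + poly c2 (?s x) * g x ^ 2)
      (poly c0 0 * 1 + poly c1 0 * \<gamma> + poly c2 0 * \<gamma> ^ 2)"
      by (intro has_val_add has_val_mult has_val_power has_val_const has_val_poly hs hg x)
    from has_val_eq_0[OF this x ev] show ?thesis by simp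
  qed
  have val: "val p1 \<noteq> val p2" "val p1 \<noteq> val p3" "val p2 \<noteq> val p3" using g(1) ne by (auto simp: inj_on_def)
  let ?P = "[: poly c0 0, poly c1 0, poly c2 0 :]"
  have roots: "poly ?P (val p1) = 0" "poly ?P (val p2) = 0" "poly ?P (val p3) = 0"
    using root[OF p(1) s(1) gp(1)] root[OF p(2) s(2) gp(2)] root[OF p(3) s(3) gp(3)]
    by (simp_all add: algebra_simps power2_eq_square)
  have "?P = 0"
  proof (rule ccontr)
    assume nz: "?P \<noteq> 0"
    have "card {val p1, val p2, val p3} \<le> card {x. poly ?P x = 0}"
      using roots by (intro card_mono poly_roots_finite nz) auto
    also have "\<dots> \<le> degree ?P" by (rule card_poly_roots_bound[OF nz])
    also have "\<dots> \<le> 2" by simp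
    finally show False using val by simp
  qed
  then show False using c by (simp add: pCons_eq_0_iff)
qed

text \<open>
  The ramification index of \<open>\<pi>\<close>.
\<close>

definition ramification :: "'n ppoint \<Rightarrow> int" where
  "ramification p = (if \<iota> p = p then 2 else 1)"

lemma fiber:
  assumes p: "p \<in> C" "p' \<in> C"
  shows "\<pi> p' = \<pi> p \<longleftrightarrow> p' = p \<or> p' = \<iota> p"
proof
  assume eq: "\<pi> p' = \<pi> p"
  show "p' = p \<or> p' = \<iota> p"
  proof (cases "\<iota> p = p")
    case True
    obtain q1 where "q1 \<in> proj_space" "q1 \<noteq> \<pi> p" using line_point_exists[OF \<pi>_mem[OF p(1)]] by blast
    then have q: "q1 \<in> proj_space" "\<pi> p \<noteq> q1" by auto
    have "2 \<le> vord C p (coordinate (\<pi> p) q1)" using vord_coordinate_fixed[OF p(1) q True] by simp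
    then show ?thesis using fiber_double_point[OF p(1) q _ p(2) eq] by blast
  next
    case False
    then show ?thesis
      using fiber_three_points[OF p(1) \<iota>_mem[OF p(1)] p(2) invariant[OF p(1)] eq]
      by (cases "p' = p"; cases "p' = \<iota> p") auto
  qed
qed (use invariant p in auto)

lemma vord_coordinate_zero:
  assumes p: "p \<in> C" and q: "q1 \<in> proj_space" "\<pi> p \<noteq> q1"
  shows "vord C p (coordinate (\<pi> p) q1) = ramification p"
proof (cases "\<iota> p = p")
  case True
  then show ?thesis using vord_coordinate_fixed[OF p q] by (simp add: ramification_def)
next
  case False
  then have "\<not> 2 \<le> vord C p (coordinate (\<pi> p) q1)"
    using fiber_double_point[OF p q _ \<iota>_mem[OF p] invariant[OF p]] by blast
  then show ?thesis using False vord_coordinate_ge_1[OF p q] by (simp add: ramification_def)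
qed

lemma vord_coordinate:
  assumes q: "q0 \<in> proj_space" "q1 \<in> proj_space" "q0 \<noteq> q1" and p: "p \<in> C"
  shows "vord C p (coordinate q0 q1) =
    (if \<pi> p = q0 then ramification p else if \<pi> p = q1 then - ramification p else 0)"
proof -
  consider "\<pi> p = q0" | "\<pi> p = q1" | "\<pi> p \<noteq> q0" "\<pi> p \<noteq> q1" by blast
  then show ?thesis
  proof cases
    case 1
    then show ?thesis using vord_coordinate_zero[OF p q(2)] q(3) by auto
  next
    case 2
    have "coordinate q0 q1 = (\<lambda>x. inverse (coordinate q1 q0 x))" by (rule ext) (rule coordinate_inverse)
    then have "vord C p (coordinate q0 q1) = - vord C p (coordinate q1 q0)"
      using vord_inverse[OF p coordinate_nonzero[OF q(2,1) q(3)[symmetric]]] by simp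
    then show ?thesis using 2 vord_coordinate_zero[OF p q(1)] q(3) by auto
  next
    case 3
    have "unit_at C p (coordinate q0 q1)"
      unfolding unit_at_def using coordinate_has_val[OF q p 3(2)] coordinate_eq_0_iff[OF q p 3(2)] 3(1) by blast
    from vord_unit[OF p this] show ?thesis using 3 by simp
  qed
qed

end

section \<open>Coordinates of the line are norms\<close>

text \<open>
  The polynomials of this form are the norms from the quadratic extension by a square root of
  \<open>- X\<close>, hence closed under products. They contain the constants and the linear polynomials
  \<open>X - a\<close>, and so all polynomials over an algebraically closed field.
\<close>

lemma poly_norm_form:
  fixes f :: "complex poly"
  shows "\<exists>V U. f = V ^ 2 + [:0, 1:] * U ^ 2"
proof (induction "degree f" arbitrary: f rule: less_induct)
  case less
  show ?case
  proof (cases "degree f = 0")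
    case True
    then obtain c where c: "f = [:c:]" by (rule degree_eq_zeroE)
    have "csqrt c * csqrt c = c" using power2_csqrt[of c] by (simp only: power2_eq_square)
    then have "f = [:csqrt c:] ^ 2 + [:0, 1:] * 0 ^ 2" unfolding c by (simp add: power2_eq_square)
    then show ?thesis by blast
  next
    case False
    then have "\<not> constant (poly f)" by (simp add: constant_degree)
    then obtain a where a: "poly f a = 0" using fundamental_theorem_of_algebra by blast
    then obtain g where g: "f = [:- a, 1:] * g" by (auto simp: poly_eq_0_iff_dvd dvd_def)
    have "g \<noteq> 0" using False g by auto
    then have "degree g < degree f" unfolding g by (subst degree_mult_eq) auto
    then obtain V U where VU: "g = V ^ 2 + [:0, 1:] * U ^ 2" using less.hyps by blast
    (* The linear factor as a norm: X - a = A^2 + X * 1^2. *)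
    define A where "A = [:csqrt (- a):]"
    have "csqrt (- a) * csqrt (- a) = - a" using power2_csqrt[of "- a"] by (simp only: power2_eq_square)
    then have A: "[:- a, 1:] = A ^ 2 + [:0, 1:]" unfolding A_def by (simp add: power2_eq_square)
    have "f = (A * V - [:0, 1:] * U) ^ 2 + [:0, 1:] * (A * U + V) ^ 2"
      unfolding g VU A by (simp add: power2_eq_square algebra_simps)
    then show ?thesis by blast
  qed
qed

context double_cover
begin

context
  fixes q0 q1 :: "2 ppoint"
  assumes q: "q0 \<in> proj_space" "q1 \<in> proj_space" "q0 \<noteq> q1"
begin

abbreviation s :: "'n ppoint \<Rightarrow> complex" where "s \<equiv> coordinate q0 q1"

text \<open>
  In a relation between \<open>1, y, y\<^sup>2\<close> for an antiinvariant \<open>y\<close> the linear term is killed by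
  conjugation; multiplying \<open>y\<close> by the leading coefficient makes its square a polynomial.
\<close>

lemma square_root_of_polynomial:
  "\<exists>Y f. nonzero Y \<and> (\<forall>x\<in>C. Y (\<iota> x) = - Y x) \<and> (\<forall>\<^sub>F x in generic C. Y x ^ 2 = poly f (s x))"
proof -
  obtain y where y: "rational C y" "\<forall>\<^sub>F x in generic C. y x \<noteq> 0" "\<forall>x\<in>C. y (\<iota> x) = - y x"
    using antiinvariant_exists by blast
  obtain c0 c1 c2 where c: "\<not> (poly c0 0 = 0 \<and> poly c1 0 = 0 \<and> poly c2 0 = 0)"
    and ev: "\<forall>\<^sub>F x in generic C. poly c0 (s x) * 1 + poly c1 (s x) * y x + poly c2 (s x) * y x ^ 2 = 0"
    by (rule three_dependent[OF q rational_const[of 1] y(1) rational_power[OF y(1), of 2]])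
  have ev': "\<forall>\<^sub>F x in generic C. poly c0 (s x) * 1 - poly c1 (s x) * y x + poly c2 (s x) * y x ^ 2 = 0"
    using generic_\<iota>[OF ev] generic_mem by eventually_elim (use y(3) in \<open>simp add: coordinate_invariant\<close>)
  have c1: "c1 = 0"
  proof (rule ccontr)
    assume "c1 \<noteq> 0"
    from generic_poly_coordinate_nonzero[OF q this] ev ev' y(2)
    have "\<forall>\<^sub>F x in generic C. False"
    proof eventually_elim
      case (elim x)
      have "2 * (poly c1 (s x) * y x) = (poly c0 (s x) * 1 + poly c1 (s x) * y x + poly c2 (s x) * y x ^ 2)
        - (poly c0 (s x) * 1 - poly c1 (s x) * y x + poly c2 (s x) * y x ^ 2)" by simp
      then have "poly c1 (s x) * y x = 0" unfolding elim(2,3) by simp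
      then show ?case using elim(1,4) by simp
    qed
    then show False by simp
  qed
  have ev0: "\<forall>\<^sub>F x in generic C. poly c0 (s x) = - (poly c2 (s x) * y x ^ 2)"
    using ev by eventually_elim (simp add: c1 eq_neg_iff_add_eq_0)
  have c2: "c2 \<noteq> 0"
  proof
    assume c2: "c2 = 0"
    then have c0: "c0 \<noteq> 0" using c c1 by auto
    have "\<forall>\<^sub>F x in generic C. False"
      using ev0 generic_poly_coordinate_nonzero[OF q c0] by eventually_elim (simp add: c2)
    then show False by simp
  qed
  let ?Y = "\<lambda>x. poly c2 (s x) * y x"
  have "rational C ?Y" by (intro rational_mult rational_poly coordinate_rational q y)
  moreover have "\<forall>\<^sub>F x in generic C. ?Y x \<noteq> 0"
    using generic_poly_coordinate_nonzero[OF q c2] y(2) by eventually_elim simp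
  moreover have "\<forall>x\<in>C. ?Y (\<iota> x) = - ?Y x" using y(3) by (simp add: coordinate_invariant)
  moreover have "\<forall>\<^sub>F x in generic C. ?Y x ^ 2 = poly (- (c0 * c2)) (s x)"
    using ev0 by eventually_elim (simp add: power2_eq_square)
  ultimately show ?thesis by blast
qed

text \<open>
  Here \<open>h = (Y - V) / U\<close> with \<open>Y\<^sup>2 = V\<^sup>2 + s * U\<^sup>2\<close>. The denominator is nonzero since
  otherwise the antiinvariant \<open>Y\<close> would equal the invariant \<open>V\<close> up to sign. The quadratic equation for \<open>h\<close>
  bounds its poles.
\<close>

lemma coordinate_is_norm:
  "\<exists>h V U. nonzero h \<and> U \<noteq> 0 \<and> (\<forall>\<^sub>F x in generic C. h x * h (\<iota> x) = - s x) \<and>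
    (\<forall>\<^sub>F x in generic C. poly U (s x) * h x ^ 2 + 2 * poly V (s x) * h x - s x * poly U (s x) = 0)"
proof -
  obtain Y f where Y: "nonzero Y" "\<forall>x\<in>C. Y (\<iota> x) = - Y x" "\<forall>\<^sub>F x in generic C. Y x ^ 2 = poly f (s x)"
    using square_root_of_polynomial by blast
  obtain V U where f: "f = V ^ 2 + [:0, 1:] * U ^ 2" using poly_norm_form by blast
  have Y2: "\<forall>\<^sub>F x in generic C. Y x ^ 2 = poly V (s x) ^ 2 + s x * poly U (s x) ^ 2"
    using Y(3) by eventually_elim (simp add: f)
  have not_V: "\<not> (\<forall>\<^sub>F x in generic C. Y x = poly W (s x))" for W
  proof
    assume *: "\<forall>\<^sub>F x in generic C. Y x = poly W (s x)"
    have "\<forall>\<^sub>F x in generic C. False"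
      using * generic_\<iota>[OF *] generic_mem conjunct2[OF Y(1)]
    proof eventually_elim
      case (elim x)
      have "Y x = - Y x" using elim(1,2) Y(2) elim(3) by (simp add: coordinate_invariant)
      then show ?case using elim(4) by simp
    qed
    then show False by simp
  qed
  have Vr: "rational C (\<lambda>x. poly V (s x))" "rational C (\<lambda>x. poly U (s x))"
    by (intro rational_poly coordinate_rational q)+
  have U: "U \<noteq> 0"
  proof
    assume U: "U = 0"
    have prod: "\<forall>\<^sub>F x in generic C. (Y x - poly V (s x)) * (Y x + poly V (s x)) = 0"
      using Y2 by eventually_elim (simp add: U power2_eq_square algebra_simps)
    have "rational C (\<lambda>x. Y x - poly V (s x))" using Y(1) Vr by (intro rational_diff) auto
    from rational_dichotomy[OF this] show False
    proof
      assume "\<forall>\<^sub>F x in generic C. Y x - poly V (s x) = 0"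
      then show False using not_V[of V] by simp
    next
      assume "\<forall>\<^sub>F x in generic C. Y x - poly V (s x) \<noteq> 0"
      from this prod have "\<forall>\<^sub>F x in generic C. Y x = poly (- V) (s x)"
        by eventually_elim (simp add: eq_neg_iff_add_eq_0)
      then show False using not_V[of "- V"] by blast
    qed
  qed
  define h where "h x = (Y x - poly V (s x)) / poly U (s x)" for x
  note Unz = generic_poly_coordinate_nonzero[OF q U]
  have norm: "\<forall>\<^sub>F x in generic C. h x * h (\<iota> x) = - s x"
    using Y2 Unz generic_mem
  proof eventually_elim
    case (elim x)
    have "h (\<iota> x) = (- Y x - poly V (s x)) / poly U (s x)"
      using elim(3) Y(2) by (simp add: h_def coordinate_invariant)
    then have "h x * h (\<iota> x) = (poly V (s x) ^ 2 - Y x ^ 2) / poly U (s x) ^ 2"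
      by (simp add: h_def power2_eq_square algebra_simps)
    then show ?case unfolding elim(1) using elim(2) by simp
  qed
  have "rational C h" unfolding h_def[abs_def] using Y(1) Vr by (intro rational_divide rational_diff) auto
  moreover have "\<forall>\<^sub>F x in generic C. h x \<noteq> 0"
    using norm generic_coordinate_ne[OF q, of 0] by eventually_elim auto
  moreover have "\<forall>\<^sub>F x in generic C. poly U (s x) * h x ^ 2 + 2 * poly V (s x) * h x - s x * poly U (s x) = 0"
    using Y2 Unz
  proof eventually_elim
    case (elim x)
    have hU: "poly U (s x) * h x = Y x - poly V (s x)" using elim(2) by (simp add: h_def)
    have "poly U (s x) * (poly U (s x) * h x ^ 2 + 2 * poly V (s x) * h x - s x * poly U (s x)) =
      (poly U (s x) * h x) ^ 2 + 2 * poly V (s x) * (poly U (s x) * h x) - s x * poly U (s x) ^ 2"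
      by (simp add: power2_eq_square algebra_simps)
    also have "\<dots> = Y x ^ 2 - (poly V (s x) ^ 2 + s x * poly U (s x) ^ 2)"
      unfolding hU by (simp add: power2_eq_square algebra_simps)
    also have "\<dots> = 0" unfolding elim(1) by simp
    finally show ?case using elim(2) by simp
  qed
  ultimately show ?thesis using U norm by blast
qed

lemma finite_fiber: "finite {p \<in> C. \<pi> p = q'}"
proof (cases "\<exists>p\<in>C. \<pi> p = q'")
  case True
  then obtain p where p: "p \<in> C" "\<pi> p = q'" by blast
  have "{p \<in> C. \<pi> p = q'} \<subseteq> {p, \<iota> p}" using fiber[OF p(1)] p(2) by auto
  then show ?thesis by (rule finite_subset) simp
next
  case False
  then have "{p \<in> C. \<pi> p = q'} = {}" by blast
  then show ?thesis by (simp only: finite.emptyI)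
qed

lemma coordinate_inj:
  assumes p: "p \<in> C" "p' \<in> C" "\<pi> p \<noteq> q1" "\<pi> p' \<noteq> q1" and eq: "s p = s p'"
  shows "\<pi> p = \<pi> p'"
proof -
  define a where "a = line_form q0 - s p *s line_form q1"
  have nz: "lin (line_form q1) (rep (\<pi> p)) \<noteq> 0" "lin (line_form q1) (rep (\<pi> p')) \<noteq> 0"
    using line_form_eq_0_iff[OF q(2) \<pi>_mem] p by auto
  have a0: "a \<noteq> 0"
  proof
    assume "a = 0"
    then have "lin a (rep q1) = 0" by (simp add: lin_simps)
    then have "lin (line_form q0) (rep q1) = 0" by (simp add: a_def lin_simps lin_line_form)
    then show False using line_form_eq_0_iff[OF q(1,2)] q(3) by simp
  qed
  have s_eq: "s p = lin (line_form q0) (rep (\<pi> p)) / lin (line_form q1) (rep (\<pi> p))"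
    by (rule coordinate_def)
  have s_eq': "s p = lin (line_form q0) (rep (\<pi> p')) / lin (line_form q1) (rep (\<pi> p'))"
    unfolding eq by (rule coordinate_def)
  have "lin a (rep (\<pi> p)) = 0" unfolding a_def lin_simps by (subst s_eq) (simp add: nz)
  moreover have "lin a (rep (\<pi> p')) = 0" unfolding a_def lin_simps by (subst s_eq') (simp add: nz)
  ultimately obtain c where "rep (\<pi> p) = c *s rep (\<pi> p')"
    using plane_kernel[OF a0] rep_props(2)[OF \<pi>_mem[OF p(2)]] by blast
  then show ?thesis by (rule rep_inj[OF \<pi>_mem[OF p(1)] \<pi>_mem[OF p(2)]])
qed

text \<open>
  The quadratic equation shows that \<open>h\<close> has no pole away from the pole of \<open>s\<close> and the
  zeros of \<open>U(s)\<close>. As \<open>h * (h \<circ> \<iota>) = - s\<close> there are no zeros outside these fibres and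
  the zeros of \<open>s\<close> either, and fibres are finite.
\<close>

lemma norm_function:
  "\<exists>h. nonzero h \<and> (\<forall>p\<in>C. vord C p h + vord C (\<iota> p) h = vord C p s) \<and> finite {p \<in> C. vord C p h \<noteq> 0}"
proof -
  obtain h V U where h: "nonzero h" and U: "U \<noteq> 0"
    and norm: "\<forall>\<^sub>F x in generic C. h x * h (\<iota> x) = - s x"
    and quad: "\<forall>\<^sub>F x in generic C. poly U (s x) * h x ^ 2 + 2 * poly V (s x) * h x - s x * poly U (s x) = 0"
    using coordinate_is_norm by blast
  have h\<iota>: "nonzero (\<lambda>x. h (\<iota> x))"
    using rational_\<iota>[OF conjunct1[OF h]] generic_\<iota>[OF conjunct2[OF h]] by simp
  have sum: "vord C p h + vord C (\<iota> p) h = vord C p s" if p: "p \<in> C" for p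
  proof -
    have "vord C p (\<lambda>x. h (\<iota> x)) = vord C (\<iota> p) h"
      using vord_\<iota>[OF \<iota>_mem[OF p] h] involution[OF p] by simp
    then have "vord C p h + vord C (\<iota> p) h = vord C p (\<lambda>x. h x * h (\<iota> x))"
      using vord_mult[OF p h h\<iota>] by simp
    also have "\<dots> = vord C p (\<lambda>x. (- 1) * s x)" by (rule vord_cong) (use norm in simp)
    also have "\<dots> = vord C p (\<lambda>x. - 1) + vord C p s"
      by (rule vord_mult[OF p _ coordinate_nonzero[OF q]]) (simp add: rational_const)
    also have "vord C p (\<lambda>x. - 1) = 0"
      by (rule vord_unit[OF p]) (auto simp: unit_at_def intro!: exI[of _ "-1"] has_val_const)
    finally show ?thesis by simp
  qed
  have nonneg: "0 \<le> vord C p h" if p: "p \<in> C" and ne: "\<pi> p \<noteq> q1" and Up: "poly U (s p) \<noteq> 0" for p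
  proof (rule ccontr)
    assume "\<not> ?thesis"
    then have "int 1 \<le> vord C p (\<lambda>x. inverse (h x))" using vord_inverse[OF p h] by simp
    moreover have "nonzero (\<lambda>x. inverse (h x))"
      using rational_inverse[OF conjunct1[OF h]] conjunct2[OF h] by simp
    ultimately obtain b \<beta> where b: "has_val C p b \<beta>" "\<forall>\<^sub>F x in generic C. inverse (h x) = unif p x ^ 1 * b x"
      using vord_ge_imp[OF p] by blast
    have g: "has_val C p (\<lambda>x. inverse (h x)) (0 ^ 1 * \<beta>)"
      by (rule has_val_cong[OF has_val_mult[OF has_val_power[OF unif_val[OF p]] b(1)] b(2)])
    note hs = coordinate_has_val[OF q p ne]
    have v: "has_val C p (\<lambda>x. s x * poly U (s x) * inverse (h x) ^ 2 - 2 * poly V (s x) * inverse (h x) - poly U (s x))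
      (s p * poly U (s p) * (0 ^ 1 * \<beta>) ^ 2 - 2 * poly V (s p) * (0 ^ 1 * \<beta>) - poly U (s p))"
      by (intro has_val_diff has_val_mult has_val_power has_val_const has_val_poly hs g p)
    have "\<forall>\<^sub>F x in generic C. s x * poly U (s x) * inverse (h x) ^ 2 - 2 * poly V (s x) * inverse (h x) - poly U (s x) = 0"
      using quad conjunct2[OF h]
    proof eventually_elim
      case (elim x)
      have "s x * poly U (s x) * inverse (h x) ^ 2 - 2 * poly V (s x) * inverse (h x) - poly U (s x) =
        - ((poly U (s x) * h x ^ 2 + 2 * poly V (s x) * h x - s x * poly U (s x)) * inverse (h x) ^ 2)"
        using elim(2) by (simp add: field_simps power2_eq_square)
      then show ?case unfolding elim(1) by simp
    qed
    from has_val_eq_0[OF v p this] show False using Up by simp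
  qed
  have "{p \<in> C. vord C p h \<noteq> 0} \<subseteq> {p \<in> C. \<pi> p = q0} \<union> {p \<in> C. \<pi> p = q1} \<union>
      (\<Union>c\<in>{c. poly U c = 0}. {p \<in> C. \<pi> p \<noteq> q1 \<and> s p = c})"
  proof
    fix p assume "p \<in> {p \<in> C. vord C p h \<noteq> 0}"
    then have p: "p \<in> C" "vord C p h \<noteq> 0" by auto
    show "p \<in> {p \<in> C. \<pi> p = q0} \<union> {p \<in> C. \<pi> p = q1} \<union>
      (\<Union>c\<in>{c. poly U c = 0}. {p \<in> C. \<pi> p \<noteq> q1 \<and> s p = c})"
    proof (rule ccontr)
      assume "\<not> ?thesis"
      then have ne: "\<pi> p \<noteq> q0" "\<pi> p \<noteq> q1" "poly U (s p) \<noteq> 0" using p by auto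
      have "0 \<le> vord C p h" using nonneg[OF p(1) ne(2,3)] .
      moreover have "0 \<le> vord C (\<iota> p) h"
        using nonneg[OF \<iota>_mem[OF p(1)]] ne invariant[OF p(1)] coordinate_invariant[OF p(1)] by simp
      moreover have "vord C p s = 0" using vord_coordinate[OF q p(1)] ne by simp
      ultimately show False using sum[OF p(1)] p(2) by simp
    qed
  qed
  moreover have "finite {p \<in> C. \<pi> p \<noteq> q1 \<and> s p = c}" for c
  proof (cases "\<exists>p\<in>C. \<pi> p \<noteq> q1 \<and> s p = c")
    case True
    then obtain p where p: "p \<in> C" "\<pi> p \<noteq> q1" "s p = c" by blast
    have "{p \<in> C. \<pi> p \<noteq> q1 \<and> s p = c} \<subseteq> {p' \<in> C. \<pi> p' = \<pi> p}"
    proof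
      fix p' assume "p' \<in> {p \<in> C. \<pi> p \<noteq> q1 \<and> s p = c}"
      then have p': "p' \<in> C" "\<pi> p' \<noteq> q1" "s p' = s p" using p(3) by auto
      then show "p' \<in> {p' \<in> C. \<pi> p' = \<pi> p}" using coordinate_inj[OF p'(1) p(1) p'(2) p(2) p'(3)] by simp
    qed
    then show ?thesis by (rule finite_subset) (rule finite_fiber)
  next
    case False
    then have "{p \<in> C. \<pi> p \<noteq> q1 \<and> s p = c} = {}" by blast
    then show ?thesis by (simp only: finite.emptyI)
  qed
  ultimately have "finite {p \<in> C. vord C p h \<noteq> 0}"
    using finite_fiber poly_roots_finite[OF U] by (auto intro: finite_subset)
  then show ?thesis using h sum by blast
qed

end

end

section \<open>Curves in the product\<close>

text \<open>
  The Segre map on vectors.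
\<close>

definition tensor :: "complex ^ ('n::finite) \<Rightarrow> complex ^ ('m::finite) \<Rightarrow> complex ^ ('n \<times> 'm)" where
  "tensor u v = (\<chi> ij. u $ fst ij * v $ snd ij)"

lemma tensor_scale: "tensor (c *s u) v = c *s tensor u v" "tensor u (c *s v) = c *s tensor u v"
  by (simp_all add: tensor_def vec_eq_iff mult_ac)

lemma segre_eq:
  assumes "p \<in> proj_space" "q \<in> proj_space"
  shows "segre p q = vec.span {tensor (rep p) (rep q)}"
proof -
  have "{(\<chi> ij. u $ fst ij * v $ snd ij) | u v. u \<in> p \<and> v \<in> q} = {tensor u v | u v. u \<in> p \<and> v \<in> q}"
    by (simp add: tensor_def)
  moreover have "vec.span {tensor u v | u v. u \<in> p \<and> v \<in> q} = vec.span {tensor (rep p) (rep q)}"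
    unfolding vec.span_eq
  proof
    show "{tensor u v | u v. u \<in> p \<and> v \<in> q} \<subseteq> vec.span {tensor (rep p) (rep q)}"
    proof
      fix t assume "t \<in> {tensor u v | u v. u \<in> p \<and> v \<in> q}"
      then obtain u v where uv: "u \<in> p" "v \<in> q" "t = tensor u v" by blast
      obtain c d where "u = c *s rep p" "v = d *s rep q" 
        using uv mem_point[OF assms(1), of u] mem_point[OF assms(2), of v] by blast
      then have "t = d *s (c *s tensor (rep p) (rep q))" using uv(3) by (simp only: tensor_scale)
      moreover have "tensor (rep p) (rep q) \<in> vec.span {tensor (rep p) (rep q)}" by (rule vec.span_base) simp
      ultimately show "t \<in> vec.span {tensor (rep p) (rep q)}" by (simp only: vec.span_scale)
    qed
    have "tensor (rep p) (rep q) \<in> {tensor u v | u v. u \<in> p \<and> v \<in> q}"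
      using rep_props(1)[OF assms(1)] rep_props(1)[OF assms(2)] by (intro CollectI, intro exI[of _ "rep p"], intro exI[of _ "rep q"]) simp
    then have "tensor (rep p) (rep q) \<in> vec.span {tensor u v | u v. u \<in> p \<and> v \<in> q}"
      by (rule vec.span_base)
    then show "{tensor (rep p) (rep q)} \<subseteq> vec.span {tensor u v | u v. u \<in> p \<and> v \<in> q}"
      by (simp only: insert_subset empty_subsetI simp_thms)
  qed
  ultimately show ?thesis unfolding segre_def by simp
qed

lemma span_singleton_scale:
  assumes "c \<noteq> (0::complex)"
  shows "vec.span {c *s u} = vec.span {u}"
  unfolding vec.span_eq
proof
  have u: "u \<in> vec.span {u}" and cu: "c *s u \<in> vec.span {c *s u}" by (rule vec.span_base, simp)+
  from vec.span_scale[OF u, of c] show "{c *s u} \<subseteq> vec.span {u}" by simp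
  have "inverse c *s (c *s u) \<in> vec.span {c *s u}"
    by (rule vec.span_scale[OF cu])
  then show "{u} \<subseteq> vec.span {c *s u}" using assms by simp
qed

text \<open>
  The diagonal and the two kinds of slices of the Segre product are images of a map \<open>T\<close> on vectors
  for which selected coordinates of \<open>T u\<close> (a slice, indexed by \<open>\<sigma> k\<close>) form a multiple of \<open>u\<close>. Reading off a
  nonzero slice inverts the map. The image is closed: it is cut out by the equations \<open>E\<close> of the image of
  the whole space together with the equations of \<open>X\<close> imposed on each slice.
\<close>

lemma closed_iso_by_slices:
  fixes X :: "('n::finite) ppoint set" and T :: "complex ^ 'n \<Rightarrow> complex ^ ('m::finite)"
    and \<sigma> :: "'k \<Rightarrow> 'n \<Rightarrow> 'm" and \<phi> :: "'k \<Rightarrow> complex ^ 'n \<Rightarrow> complex"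
  assumes X: "proj_closed X"
    and T: "\<And>j. form e (\<lambda>u. T u $ j)"
    and slice: "\<And>k u. (\<chi> i. T u $ \<sigma> k i) = \<phi> k u *s u"
    and slice_nz: "\<And>u. u \<noteq> 0 \<Longrightarrow> \<exists>k. \<phi> k u \<noteq> 0"
    and E: "\<And>F. F \<in> E \<Longrightarrow> \<exists>d. form d F" "\<And>F u. F \<in> E \<Longrightarrow> F (T u) = 0"
    and E_imp: "\<And>z. z \<noteq> 0 \<Longrightarrow> (\<And>F. F \<in> E \<Longrightarrow> F z = 0) \<Longrightarrow> \<exists>c u. c \<noteq> 0 \<and> u \<noteq> 0 \<and> z = c *s T u"
  shows "\<exists>\<psi>. closed_iso X ((\<lambda>p. vec.span {T (rep p)}) ` X) (\<lambda>p. vec.span {T (rep p)}) \<psi>"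
proof -
  let ?j = "\<lambda>p. vec.span {T (rep p)}" and ?s = "\<lambda>k z. (\<chi> i. z $ \<sigma> k i)"
  have sub: "X \<subseteq> proj_space" using X by (rule proj_closed_subset)
  have Tscale: "T (c *s u) = c ^ e *s T u" for c u
    using form_scale[OF T] by (simp add: vec_eq_iff)
  have Tnz: "T u \<noteq> 0" if "u \<noteq> 0" for u
  proof
    assume "T u = 0"
    obtain k where "\<phi> k u \<noteq> 0" using slice_nz[OF \<open>u \<noteq> 0\<close>] by blast
    moreover have "\<phi> k u *s u = 0" unfolding slice[symmetric] \<open>T u = 0\<close> by (simp add: vec_eq_iff)
    ultimately show False using \<open>u \<noteq> 0\<close> by simp
  qed
  have rep_nz: "rep p \<noteq> 0" if "p \<in> X" for p using rep_props(2) that sub by blast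
  have jproj: "?j p \<in> proj_space" if "p \<in> X" for p by (rule span_in_proj_space[OF Tnz[OF rep_nz[OF that]]])
  have rep_j: "\<exists>c. c \<noteq> 0 \<and> rep (?j p) = c *s T (rep p)" if p: "p \<in> X" for p
  proof -
    obtain c where c: "c \<noteq> 0" "T (rep p) = c *s rep (?j p)" using rep_span[OF Tnz[OF rep_nz[OF p]]] by blast
    from arg_cong[OF c(2), of "\<lambda>v. inverse c *s v"] have "inverse c *s T (rep p) = rep (?j p)" using c(1) by simp
    then have "rep (?j p) = inverse c *s T (rep p)" by (rule sym)
    then show ?thesis using c(1) by (intro exI[of _ "inverse c"]) simp
  qed
  have slice_j: "vec.span {?s k (rep (?j p))} = p" if p: "p \<in> X" and nz: "?s k (rep (?j p)) \<noteq> 0" for p k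
  proof -
    obtain c where c: "c \<noteq> 0" "rep (?j p) = c *s T (rep p)" using rep_j[OF p] by blast
    have "?s k (rep (?j p)) = c *s ?s k (T (rep p))" unfolding c(2) by (simp add: vec_eq_iff)
    also have "\<dots> = (c * \<phi> k (rep p)) *s rep p" unfolding slice by simp
    finally have eq: "?s k (rep (?j p)) = (c * \<phi> k (rep p)) *s rep p" .
    then have "c * \<phi> k (rep p) \<noteq> 0" using nz by auto
    then have "vec.span {?s k (rep (?j p))} = vec.span {rep p}" unfolding eq by (rule span_singleton_scale)
    also have "\<dots> = p" using rep_props(3) p sub by blast
    finally show ?thesis .
  qed
  have slice_ex: "\<exists>k. ?s k (rep (?j p)) \<noteq> 0" if p: "p \<in> X" for p
  proof -
    obtain c where c: "c \<noteq> 0" "rep (?j p) = c *s T (rep p)" using rep_j[OF p] by blast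
    obtain k where k: "\<phi> k (rep p) \<noteq> 0" using slice_nz[OF rep_nz[OF p]] by blast
    have "?s k (rep (?j p)) = c *s ?s k (T (rep p))" unfolding c(2) by (simp add: vec_eq_iff)
    also have "\<dots> = (c * \<phi> k (rep p)) *s rep p" unfolding slice by simp
    also have "\<dots> \<noteq> 0" using c(1) k rep_nz[OF p] by simp
    finally show ?thesis by blast
  qed
  have inj: "inj_on ?j X"
  proof (rule inj_onI)
    fix p p' assume p: "p \<in> X" "p' \<in> X" and eq: "?j p = ?j p'"
    obtain k where k: "?s k (rep (?j p)) \<noteq> 0" using slice_ex[OF p(1)] by blast
    have "p = vec.span {?s k (rep (?j p))}" using slice_j[OF p(1) k] by simp
    also have "\<dots> = p'" unfolding eq by (rule slice_j[OF p(2)]) (use k eq in simp)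
    finally show "p = p'" .
  qed
  define \<psi> where "\<psi> = inv_into X ?j"
  have \<psi>: "\<psi> (?j p) = p" if "p \<in> X" for p unfolding \<psi>_def using inj that by (rule inv_into_f_f)
  obtain S where S: "\<And>F. F \<in> S \<Longrightarrow> \<exists>d. form d F"
    "\<And>p. p \<in> X \<longleftrightarrow> p \<in> proj_space \<and> (\<forall>F\<in>S. F (rep p) = 0)" by (rule proj_closedE[OF X]) blast
  let ?S' = "(\<lambda>(F, k) z. F (?s k z)) ` (S \<times> UNIV)"
  have W: "proj_closed (?j ` X)"
  proof (rule proj_closedI[of "E \<union> ?S'"])
    fix F assume "F \<in> E \<union> ?S'"
    then show "\<exists>d. form d F"
    proof
      assume "F \<in> ?S'"
      then obtain G k where G: "G \<in> S" "F = (\<lambda>z. G (\<chi> i. z $ \<sigma> k i))" by auto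
      then obtain d where "form d G" using S(1) by blast
      from form_compose[OF this form_coord] show ?thesis unfolding G(2) by blast
    qed (use E in blast)
  next
    fix z
    show "z \<in> ?j ` X \<longleftrightarrow> z \<in> proj_space \<and> (\<forall>F\<in>E \<union> ?S'. F (rep z) = 0)"
    proof
      assume "z \<in> ?j ` X"
      then obtain p where p: "p \<in> X" "z = ?j p" by blast
      obtain c where c: "c \<noteq> 0" "rep z = c *s T (rep p)" using rep_j[OF p(1)] p(2) by blast
      have "F (rep z) = 0" if F: "F \<in> E" for F
      proof -
        obtain d where d: "form d F" using E(1)[OF F] by blast
        show ?thesis unfolding c(2) form_scale[OF d] E(2)[OF F] by simp
      qed
      moreover have "F (?s k (rep z)) = 0" if F: "F \<in> S" for F k
      proof -
        obtain d where d: "form d F" using S(1)[OF F] by blast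
        have "?s k (rep z) = c *s ?s k (T (rep p))" unfolding c(2) by (simp add: vec_eq_iff)
        also have "\<dots> = (c * \<phi> k (rep p)) *s rep p" unfolding slice by simp
        finally have "F (?s k (rep z)) = (c * \<phi> k (rep p)) ^ d * F (rep p)" by (simp only: form_scale[OF d])
        also have "F (rep p) = 0" using S(2)[of p] p(1) F by blast
        finally show ?thesis by simp
      qed
      ultimately show "z \<in> proj_space \<and> (\<forall>F\<in>E \<union> ?S'. F (rep z) = 0)" using jproj[OF p(1)] p(2) by auto
    next
      assume z: "z \<in> proj_space \<and> (\<forall>F\<in>E \<union> ?S'. F (rep z) = 0)"
      then have zE: "F (rep z) = 0" if "F \<in> E" for F using that by blast
      have zS: "F (?s k (rep z)) = 0" if F: "F \<in> S" for F k
      proof -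
        have "(\<lambda>z. F (?s k z)) \<in> E \<union> ?S'" using F by (intro UnI2 image_eqI[of _ _ "(F, k)"]) auto
        from bspec[OF conjunct2[OF z] this] show ?thesis .
      qed
      have "rep z \<noteq> 0" using rep_props(2) z by blast
      then have "\<exists>c u. c \<noteq> 0 \<and> u \<noteq> 0 \<and> rep z = c *s T u" by (rule E_imp) (rule zE)
      then obtain c u where cu: "c \<noteq> 0" "u \<noteq> 0" "rep z = c *s T u" by blast
      define p where "p = vec.span {u}"
      obtain a where a: "a \<noteq> 0" "u = a *s rep p" using rep_span[OF cu(2)] unfolding p_def by blast
      obtain k where k: "\<phi> k u \<noteq> 0" using slice_nz[OF cu(2)] by blast
      have "F (rep p) = 0" if F: "F \<in> S" for F
      proof -
        obtain d where d: "form d F" using S(1)[OF F] by blast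
        have "?s k (rep z) = c *s ?s k (T u)" unfolding cu(3) by (simp add: vec_eq_iff)
        also have "\<dots> = (c * \<phi> k u) *s u" unfolding slice by simp
        also have "\<dots> = (c * \<phi> k u * a) *s rep p" by (subst a(2)) simp
        finally have "F (?s k (rep z)) = (c * \<phi> k u * a) ^ d * F (rep p)" by (simp only: form_scale[OF d])
        then show ?thesis using zS[OF F, of k] cu(1) k a(1) by simp
      qed
      then have p: "p \<in> X" using S(2)[of p] span_in_proj_space[OF cu(2)] unfolding p_def by blast
      have "z = vec.span {rep z}" using rep_props(3) z by blast
      also have "rep z = (c * a ^ e) *s T (rep p)" unfolding cu(3) by (subst a(2)) (simp add: Tscale)
      also have "vec.span {\<dots>} = ?j p" by (rule span_singleton_scale) (use cu a in simp)
      finally show "z \<in> ?j ` X" using p by blast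
    qed
  qed
  have "closed_iso X (?j ` X) ?j \<psi>"
  proof
    show "proj_closed X" "proj_closed (?j ` X)" by (rule X, rule W)
    show "\<psi> (?j p) = p" if "p \<in> X" for p using \<psi>[OF that] .
    show "?j (\<psi> q) = q" if "q \<in> ?j ` X" for q using that \<psi> by auto
    show "morphism X (?j ` X) ?j"
      unfolding morphism_iff[OF sub]
    proof (intro conjI ballI)
      fix p assume p: "p \<in> X"
      have "represents X ?j e (\<lambda>j u. T u $ j)" unfolding represents_def using T by simp
      moreover have "(\<chi> j. T (rep p) $ j) \<noteq> 0" using Tnz[OF rep_nz[OF p]] by simp
      ultimately show "\<exists>e \<Phi>. represents X ?j e \<Phi> \<and> (\<chi> j. \<Phi> j (rep p)) \<noteq> 0" by blast
    qed simp
    have subW: "?j ` X \<subseteq> proj_space" using jproj by blast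
    show "morphism (?j ` X) X \<psi>"
      unfolding morphism_iff[OF subW]
    proof (intro conjI ballI)
      show "\<psi> ` ?j ` X \<subseteq> X" using \<psi> by auto
      fix z assume "z \<in> ?j ` X"
      then obtain p where p: "p \<in> X" "z = ?j p" by blast
      obtain k where k: "?s k (rep z) \<noteq> 0" using slice_ex[OF p(1)] p(2) by blast
      have "represents (?j ` X) \<psi> 1 (\<lambda>i z. z $ \<sigma> k i)"
        unfolding represents_def
      proof (intro conjI allI ballI impI form_coord)
        fix z' assume "z' \<in> ?j ` X" and nz: "?s k (rep z') \<noteq> 0"
        then obtain p' where p': "p' \<in> X" "z' = ?j p'" by blast
        show "\<psi> z' = vec.span {?s k (rep z')}"
          using slice_j[OF p'(1)] nz \<psi>[OF p'(1)] unfolding p'(2) by simp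
      qed
      then show "\<exists>e \<Phi>. represents (?j ` X) \<psi> e \<Phi> \<and> (\<chi> j. \<Phi> j (rep z)) \<noteq> 0" using k by blast
    qed
  qed
  then show ?thesis by blast
qed

lemma closed_iso_cong:
  assumes "closed_iso X Y \<phi> \<psi>" "\<And>p. p \<in> X \<Longrightarrow> \<phi>' p = \<phi> p"
  shows "closed_iso X Y \<phi>' \<psi>"
proof -
  interpret closed_iso X Y \<phi> \<psi> by fact
  have "represents X \<phi>' e \<Phi> = represents X \<phi> e \<Phi>" for e and \<Phi> :: "'b \<Rightarrow> complex ^ 'a \<Rightarrow> complex"
    by (auto simp: represents_def assms(2))
  moreover have "\<phi>' ` X = \<phi> ` X" by (rule image_cong[OF refl assms(2)])
  ultimately have "morphism X Y \<phi>'"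
    using morph(1) unfolding morphism_iff[OF proj_closed_subset[OF closed_X]] by simp
  then show ?thesis
  proof (intro closed_iso.intro)
    show "\<phi>' (\<psi> q) = q" if "q \<in> Y" for q using inverse(2)[OF that] assms(2)[of "\<psi> q"] maps(2) that by blast
  qed (use closed_X closed_Y morph inverse assms(2) in auto)
qed

text \<open>
  The diagonal consists of the symmetric tensors of rank one.
\<close>

lemma diagonal_iso:
  fixes X :: "('n::finite) ppoint set"
  assumes X: "proj_closed X"
  shows "\<exists>\<psi>. closed_iso X ((\<lambda>p. segre p p) ` X) (\<lambda>p. segre p p) \<psi>"
proof -
  define E :: "(complex ^ ('n \<times> 'n) \<Rightarrow> complex) set" where
    "E = range (\<lambda>(i, j) z. z $ (i, j) - z $ (j, i)) \<union>
         range (\<lambda>(i, j, k, l) z. z $ (i, j) * z $ (k, l) - z $ (i, l) * z $ (k, j))"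
  have "\<exists>\<psi>. closed_iso X ((\<lambda>p. vec.span {tensor (rep p) (rep p)}) ` X) (\<lambda>p. vec.span {tensor (rep p) (rep p)}) \<psi>"
  proof (rule closed_iso_by_slices[where T = "\<lambda>u. tensor u u" and e = 2 and \<sigma> = "\<lambda>k i. (i, k)"
        and \<phi> = "\<lambda>k u. u $ k" and E = E, OF X])
    show "form 2 (\<lambda>u. tensor u u $ j)" for j :: "'n \<times> 'n"
      using form_mult[OF form_coord[of "fst j"] form_coord[of "snd j"]] by (simp add: tensor_def numeral_2_eq_2)
    show "(\<chi> i. tensor u u $ (i, k)) = u $ k *s u" for k and u :: "complex ^ 'n"
      by (simp add: tensor_def vec_eq_iff)
    show "\<exists>k. u $ k \<noteq> 0" if "u \<noteq> 0" for u :: "complex ^ 'n" using that by (auto simp: vec_eq_iff)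
    show "\<exists>d. form d F" if F: "F \<in> E" for F
    proof -
      have f1: "form 1 (\<lambda>z. z $ (i, j) - z $ (j, i))" for i j :: 'n by (intro form_diff form_coord)
      have f2: "form (1 + 1) (\<lambda>z. z $ (i, j) * z $ (k, l) - z $ (i, l) * z $ (k, j))" for i j k l :: 'n
        by (intro form_diff form_mult form_coord)
      consider i j where "F = (\<lambda>z. z $ (i, j) - z $ (j, i))"
        | i j k l where "F = (\<lambda>z. z $ (i, j) * z $ (k, l) - z $ (i, l) * z $ (k, j))"
        using F unfolding E_def by auto
      then show ?thesis
      proof cases
        case (1 i j)
        show ?thesis unfolding 1 by (rule exI, rule f1)
      next
        case (2 i j k l)
        show ?thesis unfolding 2 by (rule exI, rule f2)
      qed
    qed
    show "F (tensor u u) = 0" if "F \<in> E" for F u using that unfolding E_def by (auto simp: tensor_def mult_ac)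
    fix z :: "complex ^ ('n \<times> 'n)" assume z: "z \<noteq> 0" and zE: "\<And>F. F \<in> E \<Longrightarrow> F z = 0"
    have sym: "z $ (i, j) = z $ (j, i)" for i j
    proof -
      have "(\<lambda>z. z $ (i, j) - z $ (j, i)) \<in> E" unfolding E_def by (intro UnI1 image_eqI[of _ _ "(i, j)"]) auto
      from zE[OF this] show ?thesis by simp
    qed
    have rank: "z $ (i, j) * z $ (k, l) = z $ (i, l) * z $ (k, j)" for i j k l
    proof -
      have "(\<lambda>z. z $ (i, j) * z $ (k, l) - z $ (i, l) * z $ (k, j)) \<in> E"
        unfolding E_def by (intro UnI2 image_eqI[of _ _ "(i, j, k, l)"]) auto
      from zE[OF this] show ?thesis by simp
    qed
    obtain a b where ab: "z $ (a, b) \<noteq> 0" using z by (auto simp: vec_eq_iff)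
    have aa: "z $ (a, a) \<noteq> 0"
    proof
      assume "z $ (a, a) = 0"
      then have "z $ (a, b) * z $ (b, a) = 0" using rank[of a b b a] by simp
      then show False using ab sym[of a b] by simp
    qed
    define u where "u = (\<chi> i. z $ (i, a))"
    have "u $ a \<noteq> 0" using aa by (simp add: u_def)
    then have "u \<noteq> 0" by auto
    moreover have "z = inverse (z $ (a, a)) *s tensor u u"
    proof -
      have "z $ (a, a) * z $ ij = u $ fst ij * u $ snd ij" for ij
        using rank[of "fst ij" a a "snd ij"] sym[of a "snd ij"] by (simp add: u_def mult.commute)
      then show ?thesis using aa by (simp add: vec_eq_iff tensor_def flip: \<open>\<And>ij. z $ (a, a) * z $ ij = u $ fst ij * u $ snd ij\<close>)
    qed
    ultimately show "\<exists>c u. c \<noteq> 0 \<and> u \<noteq> 0 \<and> z = c *s tensor u u"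
      using aa by (intro exI[of _ "inverse (z $ (a, a))"] exI[of _ u]) simp
  qed
  moreover have eq: "segre p p = vec.span {tensor (rep p) (rep p)}" if "p \<in> X" for p
    using segre_eq proj_closed_subset[OF X] that by blast
  moreover have "(\<lambda>p. segre p p) ` X = (\<lambda>p. vec.span {tensor (rep p) (rep p)}) ` X"
    by (rule image_cong[OF refl eq])
  ultimately obtain \<psi> where "closed_iso X ((\<lambda>p. segre p p) ` X) (\<lambda>p. vec.span {tensor (rep p) (rep p)}) \<psi>" by auto
  from closed_iso_cong[OF this eq] have "closed_iso X ((\<lambda>p. segre p p) ` X) (\<lambda>p. segre p p) \<psi>" by simp
  then show ?thesis by (rule exI[of _ \<psi>])
qed

lemma horizontal_iso:
  fixes X :: "('n::finite) ppoint set" and q :: "('m::finite) ppoint"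
  assumes X: "proj_closed X" and q: "q \<in> proj_space"
  shows "\<exists>\<psi>. closed_iso X ((\<lambda>p. segre p q) ` X) (\<lambda>p. segre p q) \<psi>"
proof -
  define v where "v = rep q"
  have "v \<noteq> 0" using rep_props(2)[OF q] by (simp add: v_def)
  then obtain b where b: "v $ b \<noteq> 0" by (auto simp: vec_eq_iff)
  define E :: "(complex ^ ('n \<times> 'm) \<Rightarrow> complex) set" where
    "E = range (\<lambda>(i, j) z. v $ b * z $ (i, j) - v $ j * z $ (i, b))"
  have "\<exists>\<psi>. closed_iso X ((\<lambda>p. vec.span {tensor (rep p) v}) ` X) (\<lambda>p. vec.span {tensor (rep p) v}) \<psi>"
  proof (rule closed_iso_by_slices[where T = "\<lambda>u. tensor u v" and e = 1 and \<sigma> = "\<lambda>k i. (i, k)"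
        and \<phi> = "\<lambda>k u. v $ k" and E = E, OF X])
    show "form 1 (\<lambda>u. tensor u v $ j)" for j :: "'n \<times> 'm"
      using form_cmult[OF form_coord[of "fst j"], of "v $ snd j"] by (simp add: tensor_def mult.commute)
    show "(\<chi> i. tensor u v $ (i, k)) = v $ k *s u" for k and u :: "complex ^ 'n"
      by (simp add: tensor_def vec_eq_iff mult.commute)
    show "\<exists>k. v $ k \<noteq> 0" using b by blast
    show "\<exists>d. form d F" if F: "F \<in> E" for F
    proof -
      obtain i j where "F = (\<lambda>z. v $ b * z $ (i, j) - v $ j * z $ (i, b))" using F unfolding E_def by auto
      then show ?thesis by (auto simp only: intro!: exI[of _ 1] form_diff form_cmult form_coord)
    qed
    show "F (tensor u v) = 0" if "F \<in> E" for F u using that unfolding E_def by (auto simp: tensor_def mult_ac)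
    fix z :: "complex ^ ('n \<times> 'm)" assume z: "z \<noteq> 0" and zE: "\<And>F. F \<in> E \<Longrightarrow> F z = 0"
    have rel: "v $ b * z $ (i, j) = v $ j * z $ (i, b)" for i j
    proof -
      have "(\<lambda>z. v $ b * z $ (i, j) - v $ j * z $ (i, b)) \<in> E"
        unfolding E_def by (intro image_eqI[of _ _ "(i, j)"]) auto
      from zE[OF this] show ?thesis by simp
    qed
    define u where "u = (\<chi> i. z $ (i, b) / v $ b)"
    have zu: "z = tensor u v"
    proof -
      have "z $ (i, j) = u $ i * v $ j" for i j using rel[of i j] b by (simp add: u_def field_simps)
      then show ?thesis by (simp add: vec_eq_iff tensor_def)
    qed
    have "u \<noteq> 0" using z unfolding zu by (auto simp: tensor_def vec_eq_iff)
    then show "\<exists>c u. c \<noteq> 0 \<and> u \<noteq> 0 \<and> z = c *s tensor u v"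
      using zu by (intro exI[of _ 1] exI[of _ u]) simp
  qed
  moreover have eq: "segre p q = vec.span {tensor (rep p) v}" if "p \<in> X" for p
    using segre_eq[OF _ q] proj_closed_subset[OF X] that unfolding v_def by blast
  moreover have "(\<lambda>p. segre p q) ` X = (\<lambda>p. vec.span {tensor (rep p) v}) ` X"
    by (rule image_cong[OF refl eq])
  ultimately obtain \<psi> where "closed_iso X ((\<lambda>p. segre p q) ` X) (\<lambda>p. vec.span {tensor (rep p) v}) \<psi>" by auto
  from closed_iso_cong[OF this eq] have "closed_iso X ((\<lambda>p. segre p q) ` X) (\<lambda>p. segre p q) \<psi>" by simp
  then show ?thesis by (rule exI[of _ \<psi>])
qed

lemma vertical_iso:
  fixes X :: "('n::finite) ppoint set" and q :: "('m::finite) ppoint"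
  assumes X: "proj_closed X" and q: "q \<in> proj_space"
  shows "\<exists>\<psi>. closed_iso X ((\<lambda>p. segre q p) ` X) (\<lambda>p. segre q p) \<psi>"
proof -
  define v where "v = rep q"
  have "v \<noteq> 0" using rep_props(2)[OF q] by (simp add: v_def)
  then obtain b where b: "v $ b \<noteq> 0" by (auto simp: vec_eq_iff)
  define E :: "(complex ^ ('m \<times> 'n) \<Rightarrow> complex) set" where
    "E = range (\<lambda>(i, j) z. v $ b * z $ (j, i) - v $ j * z $ (b, i))"
  have "\<exists>\<psi>. closed_iso X ((\<lambda>p. vec.span {tensor v (rep p)}) ` X) (\<lambda>p. vec.span {tensor v (rep p)}) \<psi>"
  proof (rule closed_iso_by_slices[where T = "\<lambda>u. tensor v u" and e = 1 and \<sigma> = "\<lambda>k i. (k, i)"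
        and \<phi> = "\<lambda>k u. v $ k" and E = E, OF X])
    show "form 1 (\<lambda>u. tensor v u $ j)" for j :: "'m \<times> 'n"
      using form_cmult[OF form_coord[of "snd j"], of "v $ fst j"] by (simp add: tensor_def)
    show "(\<chi> i. tensor v u $ (k, i)) = v $ k *s u" for k and u :: "complex ^ 'n"
      by (simp add: tensor_def vec_eq_iff)
    show "\<exists>k. v $ k \<noteq> 0" using b by blast
    show "\<exists>d. form d F" if F: "F \<in> E" for F
    proof -
      obtain i j where "F = (\<lambda>z. v $ b * z $ (j, i) - v $ j * z $ (b, i))" using F unfolding E_def by auto
      then show ?thesis by (auto simp only: intro!: exI[of _ 1] form_diff form_cmult form_coord)
    qed
    show "F (tensor v u) = 0" if "F \<in> E" for F u using that unfolding E_def by (auto simp: tensor_def mult_ac)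
    fix z :: "complex ^ ('m \<times> 'n)" assume z: "z \<noteq> 0" and zE: "\<And>F. F \<in> E \<Longrightarrow> F z = 0"
    have rel: "v $ b * z $ (j, i) = v $ j * z $ (b, i)" for i j
    proof -
      have "(\<lambda>z. v $ b * z $ (j, i) - v $ j * z $ (b, i)) \<in> E"
        unfolding E_def by (intro image_eqI[of _ _ "(i, j)"]) auto
      from zE[OF this] show ?thesis by simp
    qed
    define u where "u = (\<chi> i. z $ (b, i) / v $ b)"
    have zu: "z = tensor v u"
    proof -
      have "z $ (j, i) = v $ j * u $ i" for i j using rel[of j i] b by (simp add: u_def field_simps)
      then show ?thesis by (simp add: vec_eq_iff tensor_def)
    qed
    have "u \<noteq> 0" using z unfolding zu by (auto simp: tensor_def vec_eq_iff)
    then show "\<exists>c u. c \<noteq> 0 \<and> u \<noteq> 0 \<and> z = c *s tensor v u"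
      using zu by (intro exI[of _ 1] exI[of _ u]) simp
  qed
  moreover have eq: "segre q p = vec.span {tensor v (rep p)}" if "p \<in> X" for p
    using segre_eq[OF q] proj_closed_subset[OF X] that unfolding v_def by blast
  moreover have "(\<lambda>p. segre q p) ` X = (\<lambda>p. vec.span {tensor v (rep p)}) ` X"
    by (rule image_cong[OF refl eq])
  ultimately obtain \<psi> where "closed_iso X ((\<lambda>p. segre q p) ` X) (\<lambda>p. vec.span {tensor v (rep p)}) \<psi>" by auto
  from closed_iso_cong[OF this eq] have "closed_iso X ((\<lambda>p. segre q p) ` X) (\<lambda>p. segre q p) \<psi>" by simp
  then show ?thesis by (rule exI[of _ \<psi>])
qed

text \<open>
  An isomorphism carries the divisor of \<open>r\<close> to the divisor of \<open>r \<circ> \<psi>\<close>, point by point.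
\<close>

lemma pushforward_principal:
  assumes iso: "closed_iso X W \<phi> \<psi>" and X: "proj_curve X" and W: "W \<subseteq> S"
    and unif: "\<And>p. p \<in> X \<Longrightarrow> \<exists>z. uniformizer X p z"
    and r: "rational X r" "\<forall>\<^sub>F q in generic X. r q \<noteq> 0"
    and D: "Poly_Mapping.keys D \<subseteq> X" "\<And>p. p \<in> X \<Longrightarrow> Poly_Mapping.lookup D p = vord X p r"
  shows "frag_extend (\<lambda>p. frag_of (\<phi> p)) D \<in> principal_cycles S"
proof -
  interpret closed_iso X W \<phi> \<psi> by fact
  have WC: "proj_curve W" using proj_curve_image X .
  interpret variety_iso X W \<phi> \<psi>
    by (intro variety_iso.intro iso variety.intro) (use X WC in \<open>simp_all add: proj_curve_def\<close>)
  have lookup: "Poly_Mapping.lookup (frag_extend (\<lambda>p. frag_of (\<phi> p)) D) w =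
      (\<Sum>p\<in>Poly_Mapping.keys D. Poly_Mapping.lookup D p * (if w = \<phi> p then 1 else 0))" for w
    by (simp add: frag_extend_def lookup_sum lookup_frag_of)
  show ?thesis
  proof (rule principal_cycleI[OF WC W])
    show "rational W (\<lambda>q. r (\<psi> q))" by (rule Y.rational_compose[OF morph(2) maps(2) X.variety r(1)])
    show "\<forall>\<^sub>F q in generic W. r (\<psi> q) \<noteq> 0" by (rule Y.generic_surj[OF morph(2) maps(2) X.variety r(2)])
  next
    fix w assume "w \<in> W"
    then obtain p where p: "p \<in> X" "w = \<phi> p" using maps(1) by blast
    have "w = \<phi> p' \<longleftrightarrow> p' = p" if p': "p' \<in> Poly_Mapping.keys D" for p'
    proof
      assume "w = \<phi> p'"
      then have "\<psi> (\<phi> p') = \<psi> (\<phi> p)" using p(2) by simp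
      then show "p' = p" using inverse(1) p(1) p' D(1) by auto
    qed (use p in simp)
    then have "Poly_Mapping.lookup (frag_extend (\<lambda>p. frag_of (\<phi> p)) D) w =
      (\<Sum>p'\<in>Poly_Mapping.keys D. if p' = p then Poly_Mapping.lookup D p' else 0)"
      unfolding lookup by (intro sum.cong) auto
    also have "\<dots> = Poly_Mapping.lookup D p" by (simp add: sum.delta in_keys_iff)
    also have "\<dots> = vord W w (\<lambda>q. r (\<psi> q))"
    proof -
      obtain z where "uniformizer X p z" using unif[OF p(1)] by blast
      then show ?thesis using vord_transport[OF p(1) _ r] D(2)[OF p(1)] p(2) by simp
    qed
    finally show "Poly_Mapping.lookup (frag_extend (\<lambda>p. frag_of (\<phi> p)) D) w = vord W w (\<lambda>q. r (\<psi> q))" .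
  next
    fix w assume "w \<notin> W"
    then have "w \<noteq> \<phi> p" if "p \<in> Poly_Mapping.keys D" for p using that D(1) maps(1) by blast
    then show "Poly_Mapping.lookup (frag_extend (\<lambda>p. frag_of (\<phi> p)) D) w = 0"
      unfolding lookup by (simp cong: sum.cong)
  qed
qed

section \<open>Zero-cycles on the square of the curve\<close>

lemma principal_cycles_carrier: "principal_cycles S \<subseteq> carrier (free_Abelian_group S)"
proof
  fix D assume "D \<in> principal_cycles S"
  then obtain W f where "W \<subseteq> S" "\<forall>p. Poly_Mapping.lookup D p = (if p \<in> W then ord_at W p f else 0)"
    unfolding principal_cycles_def by blast
  then have "Poly_Mapping.keys D \<subseteq> S" by (auto simp: in_keys_iff split: if_splits)
  then show "D \<in> carrier (free_Abelian_group S)" by simp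
qed

lemma rat_equiv_zero_subgroup: "subgroup (rat_equiv_zero S) (free_Abelian_group S)"
  unfolding rat_equiv_zero_def
  by (rule group.generate_is_subgroup[OF group_free_Abelian_group principal_cycles_carrier])

lemma rat_equiv_zero_principal: "D \<in> principal_cycles S \<Longrightarrow> D \<in> rat_equiv_zero S"
  unfolding rat_equiv_zero_def by (rule generate.incl)

lemma rat_equiv_zero_0: "0 \<in> rat_equiv_zero S"
  using subgroup.one_closed[OF rat_equiv_zero_subgroup, of S] by simp

lemma rat_equiv_zero_add:
  "x \<in> rat_equiv_zero S \<Longrightarrow> y \<in> rat_equiv_zero S \<Longrightarrow> x + y \<in> rat_equiv_zero S"
  using subgroup.m_closed[OF rat_equiv_zero_subgroup, of x S y] by simp

lemma rat_equiv_zero_uminus: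
  assumes "x \<in> rat_equiv_zero S"
  shows "- x \<in> rat_equiv_zero S"
proof -
  have "Poly_Mapping.keys x \<subseteq> S" using subgroup.mem_carrier[OF rat_equiv_zero_subgroup assms] by simp
  then show ?thesis using subgroup.m_inv_closed[OF rat_equiv_zero_subgroup assms] by simp
qed

lemma rat_equiv_zero_diff:
  "x \<in> rat_equiv_zero S \<Longrightarrow> y \<in> rat_equiv_zero S \<Longrightarrow> x - y \<in> rat_equiv_zero S"
  using rat_equiv_zero_add[OF _ rat_equiv_zero_uminus, of x S y] by simp

lemma rat_equiv_zero_cmul:
  assumes "x \<in> rat_equiv_zero S"
  shows "frag_cmul n x \<in> rat_equiv_zero S"
proof -
  have nat: "frag_cmul (int k) x \<in> rat_equiv_zero S" for k
  proof (induction k)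
    case (Suc k)
    have "frag_cmul (int (Suc k)) x = frag_cmul (int k) x + x"
      using frag_cmul_distrib[of "int k" 1 x] by (simp add: add.commute)
    then show ?case using rat_equiv_zero_add[OF Suc assms] by simp
  qed (simp add: rat_equiv_zero_0)
  show ?thesis
  proof (cases "n \<ge> 0")
    case True
    then show ?thesis using nat[of "nat n"] by simp
  next
    case False
    then have "frag_cmul n x = - frag_cmul (int (nat (- n))) x" by simp
    then show ?thesis using rat_equiv_zero_uminus[OF nat[of "nat (- n)"]] by (simp only:)
  qed
qed

locale double_cover_square = double_cover C \<iota> \<pi> for C :: "('n::finite) ppoint set" and \<iota> \<pi> +
  fixes w :: "'n ppoint"
  assumes w: "w \<in> C" "\<iota> w = w"
begin

abbreviation trivial :: "(('n \<times> 'n) ppoint \<Rightarrow>\<^sub>0 int) set" where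
  "trivial \<equiv> rat_equiv_zero (segre_product C C)"

abbreviation pt :: "'n ppoint \<Rightarrow> 'n ppoint \<Rightarrow> ('n \<times> 'n) ppoint \<Rightarrow>\<^sub>0 int" where
  "pt p q \<equiv> frag_of (segre p q)"

lemma curve: "proj_curve C"
  using variety dim by (simp add: proj_curve_def)

lemma push:
  assumes iso: "\<exists>\<psi>. closed_iso C (\<phi> ` C) \<phi> \<psi>" and sub: "\<phi> ` C \<subseteq> segre_product C C"
    and r: "nonzero r" and D: "Poly_Mapping.keys D \<subseteq> C" "\<And>p. p \<in> C \<Longrightarrow> Poly_Mapping.lookup D p = vord C p r"
  shows "frag_extend (\<lambda>p. frag_of (\<phi> p)) D \<in> trivial"
proof -
  obtain \<psi> where "closed_iso C (\<phi> ` C) \<phi> \<psi>" using iso by blast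
  from pushforward_principal[OF this curve sub uniformizer_exists conjunct1[OF r] conjunct2[OF r] D]
  show ?thesis by (rule rat_equiv_zero_principal)
qed

lemma push_diagonal:
  assumes "nonzero r" "Poly_Mapping.keys D \<subseteq> C" "\<And>p. p \<in> C \<Longrightarrow> Poly_Mapping.lookup D p = vord C p r"
  shows "frag_extend (\<lambda>p. pt p p) D \<in> trivial"
  by (rule push[OF diagonal_iso[OF closed] _ assms]) (auto simp: segre_product_def)

lemma push_horizontal:
  assumes "q \<in> C" "nonzero r" "Poly_Mapping.keys D \<subseteq> C" "\<And>p. p \<in> C \<Longrightarrow> Poly_Mapping.lookup D p = vord C p r"
  shows "frag_extend (\<lambda>p. pt p q) D \<in> trivial"
  by (rule push[OF horizontal_iso[OF closed in_proj_space[OF assms(1)]] _ assms(2-4)])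
    (use assms(1) in \<open>auto simp: segre_product_def\<close>)

lemma push_vertical:
  assumes "q \<in> C" "nonzero r" "Poly_Mapping.keys D \<subseteq> C" "\<And>p. p \<in> C \<Longrightarrow> Poly_Mapping.lookup D p = vord C p r"
  shows "frag_extend (\<lambda>p. pt q p) D \<in> trivial"
  by (rule push[OF vertical_iso[OF closed in_proj_space[OF assms(1)]] _ assms(2-4)])
    (use assms(1) in \<open>auto simp: segre_product_def\<close>)

lemma fiber_w:
  assumes "p \<in> C"
  shows "\<pi> p = \<pi> w \<longleftrightarrow> p = w"
  using fiber[OF w(1) assms] w(2) by simp

definition pair_divisor :: "'n ppoint \<Rightarrow> 'n ppoint \<Rightarrow>\<^sub>0 int" where
  "pair_divisor p = frag_of p + frag_of (\<iota> p) - frag_of w - frag_of w"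

lemma frag_extend_pair_divisor: "frag_extend f (pair_divisor p) = f p + f (\<iota> p) - f w - f w"
  by (simp only: pair_divisor_def frag_extend_diff frag_extend_add frag_extend_of)

lemma pair_divisor_principal:
  assumes p: "p \<in> C" "p \<noteq> w"
  shows "nonzero (coordinate (\<pi> p) (\<pi> w))" "Poly_Mapping.keys (pair_divisor p) \<subseteq> C"
    "\<And>x. x \<in> C \<Longrightarrow> Poly_Mapping.lookup (pair_divisor p) x = vord C x (coordinate (\<pi> p) (\<pi> w))"
proof -
  have ne: "\<pi> p \<noteq> \<pi> w" using fiber_w p by blast
  note q = \<pi>_mem[OF p(1)] \<pi>_mem[OF w(1)] ne
  show "nonzero (coordinate (\<pi> p) (\<pi> w))" by (rule coordinate_nonzero[OF q])
  have lookup: "Poly_Mapping.lookup (pair_divisor p) x =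
      (if x = p then 1 else 0) + (if x = \<iota> p then 1 else 0) - (if x = w then 1 else 0) - (if x = w then 1 else 0)" for x
    by (simp only: pair_divisor_def lookup_add lookup_minus lookup_frag_of)
  show "Poly_Mapping.keys (pair_divisor p) \<subseteq> C"
  proof
    fix x assume "x \<in> Poly_Mapping.keys (pair_divisor p)"
    then have "Poly_Mapping.lookup (pair_divisor p) x \<noteq> 0" by (simp only: in_keys_iff not_False_eq_True)
    then have "x = p \<or> x = \<iota> p \<or> x = w"
      unfolding lookup by (cases "x = p"; cases "x = \<iota> p"; cases "x = w") simp_all
    then show "x \<in> C" using p(1) \<iota>_mem w(1) by blast
  qed
  fix x assume x: "x \<in> C"
  have "\<iota> p \<noteq> w"
  proof
    assume "\<iota> p = w"
    then have "p = w" using involution[OF p(1)] w(2) by simp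
    then show False using p(2) by simp
  qed
  then show "Poly_Mapping.lookup (pair_divisor p) x = vord C x (coordinate (\<pi> p) (\<pi> w))"
    unfolding lookup vord_coordinate[OF q x] fiber[OF p(1) x] fiber_w[OF x] ramification_def
    using p(2) w(2) involution[OF p(1)] by (cases "x = p"; cases "x = \<iota> p"; cases "x = w") auto
qed

lemma horizontal_relation:
  assumes p: "p \<in> C" and q: "q \<in> C"
  shows "pt p q + pt (\<iota> p) q - pt w q - pt w q \<in> trivial"
proof (cases "p = w")
  case True
  then show ?thesis by (simp add: w rat_equiv_zero_0)
next
  case False
  show ?thesis
    by (rule push_horizontal[OF q pair_divisor_principal[OF p False], unfolded frag_extend_pair_divisor])
qed

lemma vertical_relation:
  assumes p: "p \<in> C" and q: "q \<in> C"
  shows "pt q p + pt q (\<iota> p) - pt q w - pt q w \<in> trivial"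
proof (cases "p = w")
  case True
  then show ?thesis by (simp add: w rat_equiv_zero_0)
next
  case False
  show ?thesis
    by (rule push_vertical[OF q pair_divisor_principal[OF p False], unfolded frag_extend_pair_divisor])
qed

definition sq_cycle :: "'n ppoint \<Rightarrow> ('n \<times> 'n) ppoint \<Rightarrow>\<^sub>0 int" where
  "sq_cycle p = pt p p - pt p w - pt w p + pt w w"

lemma sq_cycle_w: "sq_cycle w = 0"
  by (simp add: sq_cycle_def)

text \<open>
  The difference is a combination of the relations \<open>p + \<iota> p - 2 w\<close> on the four curves
  \<open>{\<iota> p} \<times> C\<close>, \<open>C \<times> {p}\<close>, \<open>C \<times> {w}\<close> and \<open>{w} \<times> C\<close>.
\<close>

lemma sq_cycle_\<iota>:
  assumes p: "p \<in> C"
  shows "sq_cycle (\<iota> p) - sq_cycle p \<in> trivial"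
proof -
  have "sq_cycle (\<iota> p) - sq_cycle p =
    (pt (\<iota> p) p + pt (\<iota> p) (\<iota> p) - pt (\<iota> p) w - pt (\<iota> p) w)
    - (pt p p + pt (\<iota> p) p - pt w p - pt w p)
    + (pt p w + pt (\<iota> p) w - pt w w - pt w w) - (pt w p + pt w (\<iota> p) - pt w w - pt w w)"
    by (rule poly_mapping_eqI, unfold sq_cycle_def lookup_minus lookup_add, linarith)
  moreover have "\<dots> \<in> trivial"
    using p w(1) \<iota>_mem[OF p]
    by (intro rat_equiv_zero_add rat_equiv_zero_diff horizontal_relation vertical_relation)
  ultimately show ?thesis by (simp only:)
qed

text \<open>
  Transporting the divisor \<open>N\<close> of a function \<open>h\<close> with \<open>h * (h \<circ> \<iota>) = - s\<close> to the diagonal, to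
  \<open>C \<times> {w}\<close> and to \<open>{w} \<times> C\<close> shows that the cycles \<open>A p = sq_cycle p\<close>, weighted by \<open>N p\<close>, add up
  to \<open>deg N\<close> times \<open>(w,w)\<close>. Outside \<open>x, \<iota> x, w\<close> the multiplicities of conjugate points are opposite, so
  they contribute nothing to the degree and, as \<open>A (\<iota> p) = A p\<close>, nothing to the cycle. What remains is
  \<open>A x\<close>, since \<open>A w = 0\<close> and the multiplicities at \<open>x\<close> and \<open>\<iota> x\<close> add up to one (the
  multiplicity at \<open>x\<close> is one if \<open>x\<close> is fixed).
\<close>

lemma sq_cycle_relation:
  assumes x: "x \<in> C"
  shows "sq_cycle x \<in> trivial"
proof (cases "x = w")
  case True
  then show ?thesis by (simp add: sq_cycle_w rat_equiv_zero_0)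
next
  case False
  then have ne: "\<pi> x \<noteq> \<pi> w" using fiber_w x by blast
  note q = \<pi>_mem[OF x] \<pi>_mem[OF w(1)] ne
  obtain h where h: "nonzero h" "\<forall>p\<in>C. vord C p h + vord C (\<iota> p) h = vord C p (coordinate (\<pi> x) (\<pi> w))"
    "finite {p \<in> C. vord C p h \<noteq> 0}" using norm_function[OF q] by blast
  define N where "N p = vord C p h" for p
  have N_sum: "N p + N (\<iota> p) = (if p = x \<or> p = \<iota> x then ramification p else if p = w then - ramification p else 0)"
    if "p \<in> C" for p
    using h(2) that vord_coordinate[OF q that] fiber[OF x that] fiber_w[OF that] unfolding N_def by auto
  define D where "D = Abs_poly_mapping (\<lambda>p. if p \<in> C then N p else 0)"
  have "{p. (if p \<in> C then N p else 0) \<noteq> 0} = {p \<in> C. vord C p h \<noteq> 0}" by (auto simp: N_def)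
  then have D: "Poly_Mapping.lookup D = (\<lambda>p. if p \<in> C then N p else 0)"
    unfolding D_def using h(3) by simp
  have keys: "Poly_Mapping.keys D \<subseteq> C" by (auto simp: in_keys_iff D split: if_splits)
  have lookup: "\<And>p. p \<in> C \<Longrightarrow> Poly_Mapping.lookup D p = vord C p h" by (simp add: D N_def)
  (* A finite set of points that is stable under conjugation and contains the divisor. *)
  define T where "T = Poly_Mapping.keys D \<union> \<iota> ` Poly_Mapping.keys D \<union> {x, \<iota> x, w}"
  have T: "finite T" "T \<subseteq> C" "\<And>p. p \<in> T \<Longrightarrow> \<iota> p \<in> T"
    unfolding T_def using keys \<iota>_mem x w involution by auto
  have extend: "frag_extend f D = (\<Sum>p\<in>T. frag_cmul (N p) (f p))" for f :: "'n ppoint \<Rightarrow> ('n \<times> 'n) ppoint \<Rightarrow>\<^sub>0 int"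
  proof -
    have "frag_extend f D = (\<Sum>p\<in>Poly_Mapping.keys D. frag_cmul (N p) (f p))"
      unfolding frag_extend_def using keys by (intro sum.cong) (auto simp: D)
    also have "\<dots> = (\<Sum>p\<in>T. frag_cmul (N p) (f p))"
    proof (rule sum.mono_neutral_left[OF T(1)])
      show "Poly_Mapping.keys D \<subseteq> T" by (auto simp: T_def)
      show "\<forall>p\<in>T - Poly_Mapping.keys D. frag_cmul (N p) (f p) = 0"
        using T(2) by (auto simp: in_keys_iff D)
    qed
    finally show ?thesis .
  qed
  (* Linear extension of sq_cycle to the divisor of h. *)
  have total: "(\<Sum>p\<in>T. frag_cmul (N p) (sq_cycle p)) - frag_cmul (\<Sum>p\<in>T. N p) (pt w w) \<in> trivial"
  proof -
    have "(\<Sum>p\<in>T. frag_cmul (N p) (sq_cycle p)) - frag_cmul (\<Sum>p\<in>T. N p) (pt w w) =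
      (\<Sum>p\<in>T. frag_cmul (N p) (pt p p)) - (\<Sum>p\<in>T. frag_cmul (N p) (pt p w)) - (\<Sum>p\<in>T. frag_cmul (N p) (pt w p))"
      using T(1)
    proof (induction T rule: finite_induct)
      case (insert p T)
      have "frag_cmul (N p) (sq_cycle p) = frag_cmul (N p) (pt p p) - frag_cmul (N p) (pt p w)
          - frag_cmul (N p) (pt w p) + frag_cmul (N p) (pt w w)"
        unfolding sq_cycle_def by (intro poly_mapping_eqI) (simp add: lookup_add lookup_minus algebra_simps)
      then show ?case using insert by (simp add: frag_cmul_distrib algebra_simps del: minus_frag_cmul)
    qed simp
    then show ?thesis
      using push_diagonal[OF h(1) keys lookup] push_horizontal[OF w(1) h(1) keys lookup]
        push_vertical[OF w(1) h(1) keys lookup] unfolding extend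
      by (simp only: rat_equiv_zero_diff)
  qed
  define T0 where "T0 = T - {x, \<iota> x, w}"
  (* Conjugation-stable sets with opposite multiplicities contribute nothing. *)
  have zero: "(\<Sum>p\<in>A. frag_cmul (N p) (sq_cycle p)) \<in> trivial \<and> (\<Sum>p\<in>A. N p) = 0"
    if "finite A" "A \<subseteq> C" "\<And>p. p \<in> A \<Longrightarrow> \<iota> p \<in> A" "\<And>p. p \<in> A \<Longrightarrow> N p + N (\<iota> p) = 0" for A
    using that
  proof (induction "card A" arbitrary: A rule: less_induct)
    case less
    show ?case
    proof (cases "A = {}")
      case False
      then obtain p where p: "p \<in> A" by blast
      define B where "B = A - {p, \<iota> p}"
      have pC: "p \<in> C" "\<iota> p \<in> A" using p less.prems(2) less.prems(3)[OF p] by blast+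
      have "B \<subset> A" using p by (auto simp: B_def)
      then have card: "card B < card A" using less.prems(1) by (rule psubset_card_mono[rotated])
      have stable: "\<iota> p' \<in> B" if p': "p' \<in> B" for p'
      proof -
        have p'A: "p' \<in> A" "p' \<noteq> p" "p' \<noteq> \<iota> p" using p' by (simp_all add: B_def)
        have p'C: "p' \<in> C" using p'A(1) less.prems(2) by blast
        have "\<iota> p' \<noteq> p" "\<iota> p' \<noteq> \<iota> p" using p'A involution[OF p'C] involution[OF pC(1)] by metis+
        then show ?thesis using less.prems(3)[OF p'A(1)] by (simp add: B_def)
      qed
      have finB: "finite B" using less.prems(1) by (simp add: B_def)
      have BC: "B \<subseteq> C" using \<open>B \<subset> A\<close> less.prems(2) by (meson order.trans psubset_imp_subset)
      have anti: "N p' + N (\<iota> p') = 0" if p': "p' \<in> B" for p'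
        by (rule less.prems(4)) (use p' in \<open>simp add: B_def\<close>)
      note IH = conjunct1[OF less.hyps[OF card finB BC stable anti]] conjunct2[OF less.hyps[OF card finB BC stable anti]]
      have A: "A = insert p (insert (\<iota> p) B)" using p pC by (auto simp: B_def)
      have Np: "N (\<iota> p) = - N p" using less.prems(4)[OF p] by simp
      show ?thesis
      proof (cases "\<iota> p = p")
        case True
        then have N0: "N p = 0" using Np by simp
        have "A = insert p B" "p \<notin> B" using A True by (auto simp: B_def)
        then show ?thesis using IH N0 finB by simp
      next
        case False
        have notin: "p \<notin> insert (\<iota> p) B" "\<iota> p \<notin> B" using False by (auto simp: B_def)
        have "(\<Sum>p\<in>A. frag_cmul (N p) (sq_cycle p)) =
          frag_cmul (N (\<iota> p)) (sq_cycle (\<iota> p) - sq_cycle p) + (\<Sum>p\<in>B. frag_cmul (N p) (sq_cycle p))"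
          unfolding A using finB notin
          by (simp add: Np) (intro poly_mapping_eqI, simp add: lookup_add lookup_minus algebra_simps)
        moreover have "(\<Sum>p\<in>A. N p) = 0" unfolding A using finB notin IH(2) Np by simp
        moreover note rat_equiv_zero_add[OF rat_equiv_zero_cmul[OF sq_cycle_\<iota>[OF pC(1)]] IH(1), of "N (\<iota> p)"]
        ultimately show ?thesis by (simp only: simp_thms)
      qed
    qed (simp add: rat_equiv_zero_0)
  qed
  have T0: "(\<Sum>p\<in>T0. frag_cmul (N p) (sq_cycle p)) \<in> trivial" "(\<Sum>p\<in>T0. N p) = 0"
  proof -
    have "\<iota> p \<in> T0" if p: "p \<in> T0" for p
    proof -
      have pT: "p \<in> T" "p \<noteq> x" "p \<noteq> \<iota> x" "p \<noteq> w" using p by (simp_all add: T0_def)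
      have pC: "p \<in> C" using pT(1) T(2) by blast
      have "\<iota> p \<noteq> x" "\<iota> p \<noteq> \<iota> x" "\<iota> p \<noteq> w" using pT(2-4) involution[OF pC] involution[OF x] w(2) by metis+
      then show ?thesis using T(3)[OF pT(1)] by (simp add: T0_def)
    qed
    moreover have "N p + N (\<iota> p) = 0" if p: "p \<in> T0" for p
    proof -
      have "p \<in> T" "p \<noteq> x" "p \<noteq> \<iota> x" "p \<noteq> w" using p by (simp_all add: T0_def)
      then show ?thesis using N_sum[OF subsetD[OF T(2)]] by simp
    qed
    moreover have "finite T0" "T0 \<subseteq> C" using T(1,2) unfolding T0_def by (simp, blast)
    ultimately have "(\<Sum>p\<in>T0. frag_cmul (N p) (sq_cycle p)) \<in> trivial \<and> (\<Sum>p\<in>T0. N p) = 0"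
      by (intro zero)
    then show "(\<Sum>p\<in>T0. frag_cmul (N p) (sq_cycle p)) \<in> trivial" "(\<Sum>p\<in>T0. N p) = 0"
      by (rule conjunct1, rule conjunct2)
  qed
  have \<iota>x_w: "\<iota> x \<noteq> w" using False involution[OF x] w(2) by metis
  have Nw: "N w = - 1" using N_sum[OF w(1)] w(2) False \<iota>x_w by (simp add: ramification_def)
  have finT0: "finite T0" using T(1) by (simp add: T0_def)
  have notin: "x \<notin> T0" "\<iota> x \<notin> T0" "w \<notin> T0" by (auto simp: T0_def)
  have T_eq: "T = insert w (insert x (insert (\<iota> x) T0))" by (auto simp: T0_def T_def)
  show ?thesis
  proof (cases "\<iota> x = x")
    case True
    have Nx: "N x = 1" using N_sum[OF x] True by (simp add: ramification_def)
    have "(\<Sum>p\<in>T. frag_cmul (N p) (sq_cycle p)) = sq_cycle x + (\<Sum>p\<in>T0. frag_cmul (N p) (sq_cycle p))"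
      "(\<Sum>p\<in>T. N p) = 0"
      unfolding T_eq using True finT0 notin False Nx Nw T0(2) by (simp_all add: sq_cycle_w)
    then have "sq_cycle x + (\<Sum>p\<in>T0. frag_cmul (N p) (sq_cycle p)) \<in> trivial" using total by simp
    from rat_equiv_zero_diff[OF this T0(1)] show ?thesis by simp
  next
    case nf: False
    have distinct: "w \<notin> insert x (insert (\<iota> x) T0)" "x \<notin> insert (\<iota> x) T0" "\<iota> x \<notin> T0"
      using nf notin False[symmetric] \<iota>x_w[symmetric] by (simp_all add: nf[symmetric])
    have sums: "sum g (insert w (insert x (insert (\<iota> x) T0))) = g w + (g x + (g (\<iota> x) + sum g T0))"
      for g :: "'n ppoint \<Rightarrow> 'm::comm_monoid_add"
      using finT0 by (simp only: sum.insert finite_insert distinct not_False_eq_True)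
    have Nx: "N x = 1 - N (\<iota> x)" using N_sum[OF x] nf by (simp add: ramification_def)
    have "(\<Sum>p\<in>T. N p) = 0"
      unfolding T_eq using sums[of N] Nx Nw T0(2) by linarith
    moreover have "(\<Sum>p\<in>T. frag_cmul (N p) (sq_cycle p)) =
      frag_cmul (N x) (sq_cycle x) + (frag_cmul (N (\<iota> x)) (sq_cycle (\<iota> x)) + (\<Sum>p\<in>T0. frag_cmul (N p) (sq_cycle p)))"
      unfolding T_eq sums by (simp add: sq_cycle_w)
    moreover have "frag_cmul (N x) (sq_cycle x) + frag_cmul (N (\<iota> x)) (sq_cycle (\<iota> x)) =
      sq_cycle x + frag_cmul (N (\<iota> x)) (sq_cycle (\<iota> x) - sq_cycle x)"
      unfolding Nx by (intro poly_mapping_eqI) (simp add: lookup_add lookup_minus algebra_simps)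
    ultimately have "(\<Sum>p\<in>T. frag_cmul (N p) (sq_cycle p)) - frag_cmul (\<Sum>p\<in>T. N p) (pt w w)
        - (\<Sum>p\<in>T0. frag_cmul (N p) (sq_cycle p)) - frag_cmul (N (\<iota> x)) (sq_cycle (\<iota> x) - sq_cycle x)
        = sq_cycle x"
      by (simp add: add.assoc[symmetric] del: minus_frag_cmul)
    with rat_equiv_zero_diff[OF rat_equiv_zero_diff[OF total T0(1)] rat_equiv_zero_cmul[OF sq_cycle_\<iota>[OF x], of "N (\<iota> x)"]]
    show ?thesis by (simp only:)
  qed
qed

end

lemma CH0_square_class:
  fixes S :: "('k::finite) ppoint set"
  assumes mem: "a \<in> S" "b \<in> S" "c \<in> S" "d \<in> S"
    and rel: "frag_of a - frag_of b - frag_of c + frag_of d \<in> rat_equiv_zero S"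
  shows "point_class S a \<otimes>\<^bsub>CH0 S\<^esub> inv\<^bsub>CH0 S\<^esub> point_class S b
    \<otimes>\<^bsub>CH0 S\<^esub> inv\<^bsub>CH0 S\<^esub> point_class S c \<otimes>\<^bsub>CH0 S\<^esub> point_class S d = \<one>\<^bsub>CH0 S\<^esub>"
proof -
  let ?F = "free_Abelian_group S" and ?H = "rat_equiv_zero S"
  interpret F: comm_group ?F by (rule abelian_free_Abelian_group)
  interpret N: normal ?H ?F by (rule F.subgroup_imp_normal[OF rat_equiv_zero_subgroup])
  interpret Q: group "CH0 S" unfolding CH0_def by (rule N.factorgroup_is_group)
  interpret h: group_hom ?F "CH0 S" "\<lambda>x. ?H #>\<^bsub>?F\<^esub> x"
    by (intro group_hom.intro group_hom_axioms.intro F.is_group Q.is_group)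
      (unfold CH0_def, rule N.r_coset_hom_Mod)
  have m: "frag_of a \<in> carrier ?F" "frag_of b \<in> carrier ?F" "frag_of c \<in> carrier ?F" "frag_of d \<in> carrier ?F"
    using mem by (simp_all add: frag_of_in_free_Abelian_group del: carrier_free_Abelian_group_iff)
  have inv: "inv\<^bsub>CH0 S\<^esub> (?H #>\<^bsub>?F\<^esub> frag_of p) = ?H #>\<^bsub>?F\<^esub> (- frag_of p)" if p: "p \<in> S" for p
  proof -
    have "frag_of p \<in> carrier ?F" using p by (simp add: frag_of_in_free_Abelian_group del: carrier_free_Abelian_group_iff)
    from h.hom_inv[OF this] show ?thesis using p by (simp add: keys_frag_of)
  qed
  have neg: "- frag_of p \<in> carrier ?F" if "p \<in> S" for p using that by (simp add: keys_frag_of)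
  have mult: "(?H #>\<^bsub>?F\<^esub> x) \<otimes>\<^bsub>CH0 S\<^esub> (?H #>\<^bsub>?F\<^esub> y) = ?H #>\<^bsub>?F\<^esub> (x + y)"
    if "x \<in> carrier ?F" "y \<in> carrier ?F" for x y
    using h.hom_mult[OF that] by simp
  have plus: "x + y \<in> carrier ?F" if "x \<in> carrier ?F" "y \<in> carrier ?F" for x y
    using F.m_closed[OF that] by simp
  have "point_class S a \<otimes>\<^bsub>CH0 S\<^esub> inv\<^bsub>CH0 S\<^esub> point_class S b
    \<otimes>\<^bsub>CH0 S\<^esub> inv\<^bsub>CH0 S\<^esub> point_class S c \<otimes>\<^bsub>CH0 S\<^esub> point_class S d =
    ?H #>\<^bsub>?F\<^esub> (frag_of a + - frag_of b + - frag_of c + frag_of d)"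
    unfolding point_class_def inv[OF mem(2)] inv[OF mem(3)]
    using m neg[OF mem(2)] neg[OF mem(3)]
    by (simp only: mult plus)
  also have "\<dots> = ?H #>\<^bsub>?F\<^esub> (frag_of a - frag_of b - frag_of c + frag_of d)"
    by (simp only: diff_conv_add_uminus)
  also have "\<dots> = ?H" by (rule N.rcos_const[OF F.is_group rel])
  also have "\<dots> = \<one>\<^bsub>CH0 S\<^esub>" by (simp add: CH0_def)
  finally show ?thesis .
qed

theorem proposition3p2:
  fixes C :: "('n::finite) ppoint set" and w x :: "'n ppoint"
  defines "S \<equiv> segre_product C C"
  assumes "hyperelliptic_curve C" and "weierstrass_point C w" and "x \<in> C"
  shows "point_class S (segre x x)
           \<otimes>\<^bsub>CH0 S\<^esub> inv\<^bsub>CH0 S\<^esub> point_class S (segre x w)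
           \<otimes>\<^bsub>CH0 S\<^esub> inv\<^bsub>CH0 S\<^esub> point_class S (segre w x)
           \<otimes>\<^bsub>CH0 S\<^esub> point_class S (segre w w) = \<one>\<^bsub>CH0 S\<^esub>"
proof -
  obtain \<iota> \<pi> where w: "w \<in> C" "\<iota> w = w" and \<iota>: "morphism C C \<iota>" "\<forall>p\<in>C. \<iota> (\<iota> p) = p" "\<exists>p\<in>C. \<iota> p \<noteq> p"
    and \<pi>: "double_cover_P1 C \<pi>" "\<forall>p\<in>C. \<pi> (\<iota> p) = \<pi> p"
    using assms(3) unfolding weierstrass_point_def hyperelliptic_involution_def by blast
  have C: "proj_variety C" "zdim C = 1" "smooth C"
    using assms(2) unfolding hyperelliptic_curve_def proj_curve_def by auto
  interpret double_cover_square C \<iota> \<pi> w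
    by unfold_locales (use C \<iota> \<pi> w in \<open>auto simp: double_cover_P1_def\<close>)
  show ?thesis
  proof (rule CH0_square_class)
    show "segre x x \<in> S" "segre x w \<in> S" "segre w x \<in> S" "segre w w \<in> S"
      unfolding S_def segre_product_def using w(1) assms(4) by blast+
    show "frag_of (segre x x) - frag_of (segre x w) - frag_of (segre w x) + frag_of (segre w w) \<in> rat_equiv_zero S"
      using sq_cycle_relation[OF assms(4)] unfolding sq_cycle_def S_def .
  qed
qed

end
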